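(* Let $V$ be a $3$-dimensional $\mathbb{C}$-linear space equipped with a hermitian form $\langle-,-\rangle$ of signature $++-$. There exists a discrete subgroup $G\le\mathrm{SU}(V)$, isomorphic to the fundamental group of a closed orientable surface of genus $3$, such that $G$ is $\mathbb{C}$-Fuchsian, $G$ is not $\mathbb{R}$-Fuchsian, and every element $I\in G$ has, in a suitable basis $e_0,e_1,e_2$ of $V$, the form $$I=\begin{pmatrix}1&0&0\\0&r^{-1}\alpha&0\\0&0&r\alpha\end{pmatrix}$$ with $r>0$ and $\alpha=\pm1$, where $e_1,e_2$ are isotropic points in the complex geodesic stabilized by $G$ and $e_0$ is its polar point. In particular, every loxodromic element of $G$ is either hyperbolic or loxodromic whose elliptic part is of order $2$. Consequently, the following assertion is false: "a complex hyperbolic non-elementary Kleinian group $G$ acting on the complex hyperbolic plane $\mathbf{H}_{\mathbb{C}}^2$ is $\mathbb{R}$-Fuchsian if and only if every loxodromic element of $G$ is either hyperbolic or loxodromic whose elliptic part is of order $2$".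
   Context: $\mathrm{SU}(V)$ is the group of $\mathbb{C}$-linear automorphisms of $V$ of determinant $1$ preserving the hermitian form; it acts on the complex hyperbolic plane $\mathbf{H}_{\mathbb{C}}^2$ of negative points of $\mathbb{P}V$, with ideal boundary the isotropic points. A complex geodesic is the projectivization of a $2$-dimensional $\mathbb{C}$-subspace $U\le V$ on which the form has signature $+-$; its polar point is the positive line $U^\perp$. A group $G\le\mathrm{SU}(V)$ is $\mathbb{C}$-Fuchsian if it is discrete and stabilizes a complex geodesic; it is $\mathbb{R}$-Fuchsian if it leaves invariant a totally real plane in $\mathbf{H}_{\mathbb{C}}^2$, i.e. the set of negative points of $\mathbb{P}V$ represented by vectors of a $3$-dimensional $\mathbb{R}$-subspace $W\le V$ with $W\cap iW=0$ on which the hermitian form is real-valued of signature $++-$. An element of $\mathrm{SU}(V)$ is loxodromic if it has an eigenvalue of modulus different from $1$. A loxodromic element can be written, up to multiplication by a cubic root of unity (a scalar acting trivially on $\mathbf{H}_{\mathbb{C}}^2$), in a basis $e_0,e_1,e_2$ with $e_1,e_2$ isotropic, $\langle e_1,e_2\rangle\neq0$, and $e_0$ positive and orthogonal to $e_1,e_2$, as $\mathrm{diag}(\alpha^{-2},r^{-1}\alpha,r\alpha)$ with $|\alpha|=1$, $r>0$, $r\ne1$; its elliptic part is the transformation of $\mathbf{H}_{\mathbb{C}}^2$ given by $\mathrm{diag}(\alpha^{-2},\alpha,\alpha)$, and it is called hyperbolic if its elliptic part is trivial. *)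

theory Defs
  imports "HOL-Analysis.Analysis" "HOL-Algebra.Group"
begin

section \<open>Fundamental groups of topological spaces\<close>

definition loops_at :: "'a topology \<Rightarrow> 'a \<Rightarrow> (real \<Rightarrow> 'a) set" where
  "loops_at X x = {p. pathin X p \<and> p 0 = x \<and> p 1 = x}"

definition loop_homotopy :: "'a topology \<Rightarrow> 'a \<Rightarrow> ((real \<Rightarrow> 'a) \<times> (real \<Rightarrow> 'a)) set" where
  "loop_homotopy X x = {(p, q). p \<in> loops_at X x \<and> q \<in> loops_at X x \<and>
     homotopic_with (\<lambda>r. r 0 = x \<and> r 1 = x) (top_of_set {0..1}) X p q}"

text \<open>The library's \<open>joinpaths\<close> needs a target in class \<open>topological_space\<close>.\<close>
definition concat_paths :: "(real \<Rightarrow> 'a) \<Rightarrow> (real \<Rightarrow> 'a) \<Rightarrow> real \<Rightarrow> 'a" where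
  "concat_paths p q = (\<lambda>t. if t \<le> 1/2 then p (2 * t) else q (2 * t - 1))"

definition fundamental_group :: "'a topology \<Rightarrow> 'a \<Rightarrow> (real \<Rightarrow> 'a) set monoid" where
  "fundamental_group X x =
     \<lparr>carrier = loops_at X x // loop_homotopy X x,
      monoid.mult = (\<lambda>A B. \<Union>p\<in>A. \<Union>q\<in>B. loop_homotopy X x `` {concat_paths p q}),
      one = loop_homotopy X x `` {\<lambda>_. x}\<rparr>"


section \<open>The closed orientable surface of genus \<open>g\<close>\<close>

text \<open>
  For \<open>g \<ge> 1\<close>, the surface is the closed unit disc, seen as a \<open>4g\<close>-gon whose sides are the
  arcs of length \<open>2\<pi>/4g\<close> of the unit circle, with its sides glued in pairs according to the
  boundary word \<open>a\<^sub>1 b\<^sub>1 a\<^sub>1\<inverse> b\<^sub>1\<inverse> \<dots> a\<^sub>g b\<^sub>g a\<^sub>g\<inverse> b\<^sub>g\<inverse>\<close>, with the quotient topology.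
\<close>

definition polygon_side :: "nat \<Rightarrow> nat \<Rightarrow> real \<Rightarrow> complex" where
  "polygon_side g k t = cis (2 * pi * (real k + t) / (4 * real g))"

definition side_gluing :: "nat \<Rightarrow> complex \<Rightarrow> complex \<Rightarrow> bool" where
  "side_gluing g x y \<longleftrightarrow> (\<exists>i<g. \<exists>t\<in>{0..1}.
     (x = polygon_side g (4 * i) t \<and> y = polygon_side g (4 * i + 2) (1 - t)) \<or>
     (x = polygon_side g (4 * i + 1) t \<and> y = polygon_side g (4 * i + 3) (1 - t)))"

definition gluing_class :: "nat \<Rightarrow> complex \<Rightarrow> complex set" where
  "gluing_class g z = {w \<in> cball 0 1. equivclp (side_gluing g) z w}"

definition closed_orientable_surface :: "nat \<Rightarrow> complex set topology" where
  "closed_orientable_surface g = topology (\<lambda>U. U \<subseteq> gluing_class g ` cball 0 1 \<and>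
     openin (top_of_set (cball 0 1)) {z \<in> cball 0 1. gluing_class g z \<in> U})"

lemma openin_closed_orientable_surface:
  "openin (closed_orientable_surface g) U \<longleftrightarrow> U \<subseteq> gluing_class g ` cball 0 1 \<and>
     openin (top_of_set (cball 0 1)) {z \<in> cball 0 1. gluing_class g z \<in> U}"
proof -
  have "istopology (\<lambda>U. U \<subseteq> gluing_class g ` cball 0 1 \<and>
     openin (top_of_set (cball 0 1)) {z \<in> cball 0 1. gluing_class g z \<in> U})"
    unfolding istopology_def
  proof (intro conjI allI impI)
    fix S T assume S: "S \<subseteq> gluing_class g ` cball 0 1 \<and>
        openin (top_of_set (cball 0 1)) {z \<in> cball 0 1. gluing_class g z \<in> S}"
      and T: "T \<subseteq> gluing_class g ` cball 0 1 \<and>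
        openin (top_of_set (cball 0 1)) {z \<in> cball 0 1. gluing_class g z \<in> T}"
    show "S \<inter> T \<subseteq> gluing_class g ` cball 0 1" using S by blast
    have "{z \<in> cball 0 1. gluing_class g z \<in> S \<inter> T} =
        {z \<in> cball 0 1. gluing_class g z \<in> S} \<inter> {z \<in> cball 0 1. gluing_class g z \<in> T}"
      by blast
    then show "openin (top_of_set (cball 0 1)) {z \<in> cball 0 1. gluing_class g z \<in> S \<inter> T}"
      using S T by (simp only: openin_Int)
  next
    fix K assume K: "\<forall>S\<in>K. S \<subseteq> gluing_class g ` cball 0 1 \<and>
        openin (top_of_set (cball 0 1)) {z \<in> cball 0 1. gluing_class g z \<in> S}"
    show "\<Union>K \<subseteq> gluing_class g ` cball 0 1" using K by blast
    have "{z \<in> cball 0 1. gluing_class g z \<in> \<Union>K} =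
        (\<Union>S\<in>K. {z \<in> cball 0 1. gluing_class g z \<in> S})"
      by blast
    moreover have "openin (top_of_set (cball 0 1)) (\<Union>S\<in>K. {z \<in> cball 0 1. gluing_class g z \<in> S})"
      using K by (intro openin_Union) blast
    ultimately show "openin (top_of_set (cball 0 1)) {z \<in> cball 0 1. gluing_class g z \<in> \<Union>K}"
      by (rule ssubst)
  qed
  then show ?thesis
    unfolding closed_orientable_surface_def by (subst topology_inverse') auto
qed

lemma topspace_closed_orientable_surface:
  "topspace (closed_orientable_surface g) = gluing_class g ` cball 0 1"
proof
  show "topspace (closed_orientable_surface g) \<subseteq> gluing_class g ` cball 0 1"
    using openin_closed_orientable_surface openin_topspace by blast
  have "{z \<in> cball 0 1. gluing_class g z \<in> gluing_class g ` cball 0 1} = cball 0 1"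
    by blast
  then have "openin (closed_orientable_surface g) (gluing_class g ` cball 0 1)"
    unfolding openin_closed_orientable_surface by (metis openin_subtopology_self subset_refl)
  then show "gluing_class g ` cball 0 1 \<subseteq> topspace (closed_orientable_surface g)"
    by (rule openin_subset)
qed

lemma quotient_map_closed_orientable_surface:
  "quotient_map (top_of_set (cball 0 1)) (closed_orientable_surface g) (gluing_class g)"
  unfolding quotient_map_def topspace_closed_orientable_surface
    openin_closed_orientable_surface topspace_euclidean_subtopology
  by blast


section \<open>The complex hyperbolic plane\<close>

context vector_space
begin

definition is_basis :: "('n \<Rightarrow> 'b) \<Rightarrow> bool" where
  "is_basis e \<longleftrightarrow> inj e \<and> independent (range e) \<and> span (range e) = UNIV"

definition matrix_of :: "('n::finite \<Rightarrow> 'b) \<Rightarrow> ('b \<Rightarrow> 'b) \<Rightarrow> 'a ^ 'n ^ 'n" where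
  "matrix_of e f = (\<chi> i j. representation (range e) (f (e j)) (e i))"

end

text \<open>Elements of type \<open>3\<close> are written \<open>0, 1, 2\<close> below.\<close>
definition diag3 :: "complex \<Rightarrow> complex \<Rightarrow> complex \<Rightarrow> complex ^ 3 ^ 3" where
  "diag3 a b c = (\<chi> i j. if i = j then (if i = 0 then a else if i = 1 then b else c) else 0)"

locale hermitian_space = vector_space scale
  for scale :: "complex \<Rightarrow> 'v::ab_group_add \<Rightarrow> 'v" (infixr \<open>*\<^sub>C\<close> 75) +
  fixes form :: "'v \<Rightarrow> 'v \<Rightarrow> complex"
  assumes dim_eq_3: "dim UNIV = 3"
    and form_add: "form (x + y) z = form x z + form y z"
    and form_scale: "form (a *\<^sub>C x) z = a * form x z"
    and form_cnj: "form y x = cnj (form x y)"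
    and form_signature: "\<exists>e :: 3 \<Rightarrow> 'v. is_basis e \<and> (\<forall>i j. i \<noteq> j \<longrightarrow> form (e i) (e j) = 0) \<and>
          Re (form (e 0) (e 0)) > 0 \<and> Re (form (e 1) (e 1)) > 0 \<and> Re (form (e 2) (e 2)) < 0"
begin

definition determinant :: "('v \<Rightarrow> 'v) \<Rightarrow> complex" where
  "determinant f = det (matrix_of (SOME e :: 3 \<Rightarrow> 'v. is_basis e) f)"

definition SU :: "('v \<Rightarrow> 'v) monoid" where
  "SU = \<lparr>carrier = {f. Vector_Spaces.linear scale scale f \<and> bij f \<and>
           (\<forall>x y. form (f x) (f y) = form x y) \<and> determinant f = 1},
         monoid.mult = (\<circ>), one = id\<rparr>"

text \<open>The topology on \<open>SU\<close> is that of matrix entries, in any basis.\<close>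
definition discrete_subgroup :: "('v \<Rightarrow> 'v) set \<Rightarrow> bool" where
  "discrete_subgroup G \<longleftrightarrow> subgroup G SU \<and>
     discrete (matrix_of (SOME e :: 3 \<Rightarrow> 'v. is_basis e) ` G)"

text \<open>Points of the projective plane are the complex lines \<open>span {v}\<close>, and a linear map \<open>f\<close>
  acts on them by \<open>p \<mapsto> f ` p\<close>.\<close>

definition projectivization :: "'v set \<Rightarrow> 'v set set" where
  "projectivization U = {span {v} | v. v \<in> U \<and> v \<noteq> 0}"

definition isotropic_points :: "'v set set" where
  "isotropic_points = {span {v} | v. v \<noteq> 0 \<and> form v v = 0}"

definition hyperbolic_plane :: "'v set set" where
  "hyperbolic_plane = {span {v} | v. Re (form v v) < 0}"

definition leaves_invariant :: "('v \<Rightarrow> 'v) set \<Rightarrow> 'v set set \<Rightarrow> bool" where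
  "leaves_invariant G S \<longleftrightarrow> (\<forall>f\<in>G. (\<lambda>p. f ` p) ` S = S)"

definition geodesic_subspace :: "'v set \<Rightarrow> bool" where
  "geodesic_subspace U \<longleftrightarrow> subspace U \<and> dim U = 2 \<and>
     (\<exists>u\<in>U. \<exists>v\<in>U. form u v = 0 \<and> Re (form u u) > 0 \<and> Re (form v v) < 0)"

definition complex_geodesic :: "'v set set \<Rightarrow> bool" where
  "complex_geodesic L \<longleftrightarrow> (\<exists>U. geodesic_subspace U \<and> L = projectivization U)"

text \<open>For a complex geodesic \<open>L\<close>, \<open>\<Union>L\<close> is the subspace whose projectivization is \<open>L\<close>.\<close>
definition polar_point :: "'v set set \<Rightarrow> 'v set" where
  "polar_point L = {x. \<forall>u\<in>\<Union>L. form x u = 0}"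

definition real_scale :: "real \<Rightarrow> 'v \<Rightarrow> 'v" where
  "real_scale r v = complex_of_real r *\<^sub>C v"

definition totally_real_subspace :: "'v set \<Rightarrow> bool" where
  "totally_real_subspace W \<longleftrightarrow>
     module.subspace real_scale W \<and> vector_space.dim real_scale W = 3 \<and>
     W \<inter> (\<lambda>w. \<i> *\<^sub>C w) ` W = {0} \<and>
     (\<forall>x\<in>W. \<forall>y\<in>W. form x y \<in> \<real>) \<and>
     (\<exists>u\<in>W. \<exists>v\<in>W. \<exists>w\<in>W. form u v = 0 \<and> form u w = 0 \<and> form v w = 0 \<and>
        Re (form u u) > 0 \<and> Re (form v v) > 0 \<and> Re (form w w) < 0)"

definition totally_real_plane :: "'v set set \<Rightarrow> bool" where
  "totally_real_plane R \<longleftrightarrow> (\<exists>W. totally_real_subspace W \<and>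
     R = {span {w} | w. w \<in> W \<and> Re (form w w) < 0})"

definition C_Fuchsian :: "('v \<Rightarrow> 'v) set \<Rightarrow> bool" where
  "C_Fuchsian G \<longleftrightarrow> discrete_subgroup G \<and> (\<exists>L. complex_geodesic L \<and> leaves_invariant G L)"

definition R_Fuchsian :: "('v \<Rightarrow> 'v) set \<Rightarrow> bool" where
  "R_Fuchsian G \<longleftrightarrow> subgroup G SU \<and> (\<exists>R. totally_real_plane R \<and> leaves_invariant G R)"

definition loxodromic :: "('v \<Rightarrow> 'v) \<Rightarrow> bool" where
  "loxodromic f \<longleftrightarrow> f \<in> carrier SU \<and> (\<exists>c v. v \<noteq> 0 \<and> f v = c *\<^sub>C v \<and> cmod c \<noteq> 1)"

definition loxodromic_basis :: "(3 \<Rightarrow> 'v) \<Rightarrow> bool" where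
  "loxodromic_basis e \<longleftrightarrow> is_basis e \<and>
     form (e 1) (e 1) = 0 \<and> form (e 2) (e 2) = 0 \<and> form (e 1) (e 2) \<noteq> 0 \<and>
     Re (form (e 0) (e 0)) > 0 \<and> form (e 0) (e 1) = 0 \<and> form (e 0) (e 2) = 0"

definition transformation :: "('v \<Rightarrow> 'v) \<Rightarrow> 'v set \<Rightarrow> 'v set" where
  "transformation f = (\<lambda>p\<in>hyperbolic_plane. f ` p)"

text \<open>The pair \<open>(\<alpha>, \<omega>)\<close> is only determined up to \<open>(\<zeta> \<alpha>, \<zeta>\<inverse> \<omega>)\<close> with \<open>\<zeta>\<close> a cubic root of unity,
  which does not change the transformation \<open>T\<close> of the hyperbolic plane.\<close>
definition is_elliptic_part :: "('v \<Rightarrow> 'v) \<Rightarrow> ('v set \<Rightarrow> 'v set) \<Rightarrow> bool" where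
  "is_elliptic_part f T \<longleftrightarrow>
     (\<exists>e (\<omega>::complex) (\<alpha>::complex) (r::real) E. loxodromic_basis e \<and> \<omega> ^ 3 = 1 \<and>
        cmod \<alpha> = 1 \<and> r > 0 \<and> r \<noteq> 1 \<and>
        matrix_of e f = diag3 (\<omega> * inverse (\<alpha>\<^sup>2)) (\<omega> * (\<alpha> / of_real r)) (\<omega> * (of_real r * \<alpha>)) \<and>
        Vector_Spaces.linear scale scale E \<and> matrix_of e E = diag3 (inverse (\<alpha>\<^sup>2)) \<alpha> \<alpha> \<and>
        T = transformation E)"

definition hyperbolic :: "('v \<Rightarrow> 'v) \<Rightarrow> bool" where
  "hyperbolic f \<longleftrightarrow> loxodromic f \<and> is_elliptic_part f (\<lambda>p\<in>hyperbolic_plane. p)"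

definition elliptic_part_of_order_2 :: "('v \<Rightarrow> 'v) \<Rightarrow> bool" where
  "elliptic_part_of_order_2 f \<longleftrightarrow> loxodromic f \<and>
     (\<exists>T. is_elliptic_part f T \<and> T \<noteq> (\<lambda>p\<in>hyperbolic_plane. p) \<and>
        compose hyperbolic_plane T T = (\<lambda>p\<in>hyperbolic_plane. p))"

text \<open>Non-elementary: no finite orbit in the hyperbolic plane together with its ideal boundary.\<close>
definition non_elementary :: "('v \<Rightarrow> 'v) set \<Rightarrow> bool" where
  "non_elementary G \<longleftrightarrow>
     (\<forall>p \<in> hyperbolic_plane \<union> isotropic_points. infinite ((\<lambda>f. f ` p) ` G))"

text \<open>Kleinian groups are taken in \<open>SU\<close>; its centre is finite and acts trivially.\<close>
definition non_elementary_Kleinian :: "('v \<Rightarrow> 'v) set \<Rightarrow> bool" where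
  "non_elementary_Kleinian G \<longleftrightarrow> discrete_subgroup G \<and> non_elementary G"

end

end

theory Submission
  imports Defs "HOL-Computational_Algebra.Primes"
begin

text \<open>
  The sides of the regular hyperbolic 12-gon with angles \<open>\<pi>/6\<close> are paired, according to the boundary word of the
  surface, by elements \<open>gen k\<close> of \<open>SU(1,1)\<close>. Crossing a wall that separates a point from the polygon brings the
  point closer to the centre, and two such descents can be joined again because the twelve copies of the polygon
  at a vertex close up. As in Newman's lemma, every orbit then has an essentially unique representative in the
  polygon, so the copies tessellate the plane and the generated group acts freely. Descents terminate because the
  group is arithmetic: its entries are algebraic integers, and the Galois conjugate of the form is definite. The
  latter also excludes parabolic elements. The plane thus covers the glued polygon, the group is the
  fundamental group, and its elements other than 1 have real trace of modulus greater than 2.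

  \<open>SU(1,1)\<close> acts on \<open>V\<close> with a fixed vector \<open>b0\<close>, so the group preserves a complex geodesic and its elements have the
  eigenvalues \<open>1\<close>, \<open>\<plusminus>r\<close>, \<open>\<plusminus>1/r\<close>. It cannot preserve a totally real plane, as this would force an antilinear map
  commuting with it to preserve and to change the sign of the form on the orthogonal complement of \<open>b0\<close>.
\<close>


section \<open>The group \<open>SU(1,1)\<close> and its action on the hyperbolic plane\<close>

text \<open>Elements of SU(1,1) have real trace, so loxodromic ones have eigenvalues \<plusminus>r
  and \<plusminus>1/r; the work lies in realising the surface group inside SU(1,1) itself, signs
  included. As -1 acts trivially on the plane, it is essential that the product around the vertex is
  +1 and not -1. Freeness then gives equality in SU(1,1), and no central extension of the surface
  group appears.

  For genus 3 the inradius satisfies cosh r = cos (pi/12) / sin (pi/12) = 2 + sqrt 3. After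
  splitting off one common factor, the entries therefore lie in the ring generated by a twelfth root
  of unity, and sqrt 3 -> - sqrt 3 turns cosh r into 2 - sqrt 3 < 1, so the conjugate of (sinh r)^2
  is negative. Finiteness and the vertex relation thus reduce to integer arithmetic, without a
  general theorem on polygons.

  Covering theory is used for subsets of a topological type, whereas the surface is a topology on a
  set of classes. For this reason the glued disc is also embedded explicitly in a space of real
  dimension 6.\<close>

definition su_mult :: "complex \<times> complex \<Rightarrow> complex \<times> complex \<Rightarrow> complex \<times> complex" (infixl \<open>\<odot>\<close> 70) where
  "f \<odot> g = (fst f * fst g + snd f * cnj (snd g), fst f * snd g + snd f * cnj (fst g))"

definition su_one :: "complex \<times> complex" where
  "su_one = (1, 0)"

definition su_inv :: "complex \<times> complex \<Rightarrow> complex \<times> complex" where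
  "su_inv f = (cnj (fst f), - snd f)"

text \<open>The pair \<open>(a, b)\<close> stands for the matrix with rows \<open>(a, b)\<close> and
  \<open>(cnj b, cnj a)\<close>. The condition |a|^2 - |b|^2 = 1 is written over the complex numbers
  so that \<open>algebra\<close> can use it.\<close>

definition su11 :: "(complex \<times> complex) set" where
  "su11 = {f. fst f * cnj (fst f) = snd f * cnj (snd f) + 1}"

lemma su_mult_assoc: "(f \<odot> g) \<odot> h = f \<odot> (g \<odot> h)"
  by (simp add: su_mult_def algebra_simps)

lemma su_one_left [simp]: "su_one \<odot> f = f"
  and su_one_right [simp]: "f \<odot> su_one = f"
  by (simp_all add: su_mult_def su_one_def)

lemma su_inv_left: "f \<in> su11 \<Longrightarrow> su_inv f \<odot> f = su_one"
  and su_inv_right: "f \<in> su11 \<Longrightarrow> f \<odot> su_inv f = su_one"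
  by (auto simp: su_mult_def su_one_def su_inv_def su11_def algebra_simps)

lemma su11_one: "su_one \<in> su11"
  by (simp add: su11_def su_one_def)

lemma su11_inv: "f \<in> su11 \<Longrightarrow> su_inv f \<in> su11"
  by (simp add: su11_def su_inv_def mult.commute)

lemma su11_mult: assumes "f \<in> su11" "g \<in> su11" shows "f \<odot> g \<in> su11"
proof -
  have "fst f * cnj (fst f) = snd f * cnj (snd f) + 1" "fst g * cnj (fst g) = snd g * cnj (snd g) + 1"
    using assms by (auto simp: su11_def)
  then show ?thesis
    unfolding su11_def su_mult_def mem_Collect_eq fst_conv snd_conv complex_cnj_add complex_cnj_mult complex_cnj_cnj
    by algebra
qed

lemma su11_cmod: "f \<in> su11 \<longleftrightarrow> (cmod (fst f))\<^sup>2 = (cmod (snd f))\<^sup>2 + 1"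
proof -
  have "f \<in> su11 \<longleftrightarrow> complex_of_real ((cmod (fst f))\<^sup>2) = complex_of_real ((cmod (snd f))\<^sup>2 + 1)"
    by (simp add: su11_def complex_norm_square del: of_real_power)
  then show ?thesis unfolding of_real_eq_iff .
qed

text \<open>The hyperbolic plane is the sheet \<open>t = sqrt (1 + |x|\<^sup>2)\<close> of the hyperboloid in \<open>\<complex> \<times> \<real>\<close>, projected to
  the coordinate \<open>x\<close>; \<open>su_act\<close> is the resulting action of \<open>SU(1,1) \<rightarrow> SO(2,1)\<close>.\<close>

definition tt :: "complex \<Rightarrow> real" where
  "tt x = sqrt (1 + (cmod x)\<^sup>2)"

definition su_act :: "complex \<times> complex \<Rightarrow> complex \<Rightarrow> complex" where
  "su_act f x = (fst f)\<^sup>2 * x + (snd f)\<^sup>2 * cnj x + 2 * fst f * snd f * of_real (tt x)"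

lemma tt_pos: "tt x > 0"
  by (simp add: tt_def add_pos_nonneg)

lemma tt_ge_1: "tt x \<ge> 1"
  by (simp add: tt_def)

lemma tt_sq: "(tt x)\<^sup>2 = 1 + (cmod x)\<^sup>2"
  by (simp add: tt_def)

lemma tt_sq_complex: "(complex_of_real (tt x))\<^sup>2 = 1 + x * cnj x"
  by (metis complex_norm_square of_real_1 of_real_add of_real_power tt_sq)

lemma cmod_less_tt: "cmod x < tt x"
  unfolding tt_def by (metis less_add_same_cancel2 norm_ge_zero real_sqrt_unique real_sqrt_less_iff zero_less_one)

lemma tt_le: "tt x \<le> 1 + cmod x"
  unfolding tt_def by (rule real_le_lsqrt) (auto simp: power2_eq_square algebra_simps)

lemma tt_zero [simp]: "tt 0 = 1" by (simp add: tt_def)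

lemma continuous_on_tt: "continuous_on S tt"
  unfolding tt_def by (intro continuous_intros)

lemma continuous_on_su_act: "continuous_on S (su_act f)"
  unfolding su_act_def by (intro continuous_intros continuous_on_tt)

text \<open>The squares agree because t^2 - |x|^2 is invariant. The bound 2 |Re (a cnj b x)| <=
  (|a|^2 + |b|^2) t then selects the nonnegative root.\<close>

lemma tt_su_act:
  assumes "f \<in> su11"
  shows "tt (su_act f x) = ((cmod (fst f))\<^sup>2 + (cmod (snd f))\<^sup>2) * tt x + 2 * Re (fst f * cnj (snd f) * x)"
    (is "_ = ?R")
proof -
  define a b where "a = fst f" and "b = snd f"
  define t where "t = complex_of_real (tt x)"
  have ab: "a * cnj a = b * cnj b + 1" using assms by (simp add: a_def b_def su11_def)
  have t: "t * t = 1 + x * cnj x" using tt_sq_complex[of x] by (simp add: t_def power2_eq_square)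
  have ct: "cnj t = t" by (simp add: t_def)
  have R: "complex_of_real ?R = (a * cnj a + b * cnj b) * t + a * cnj b * x + cnj a * b * cnj x"
    unfolding a_def[symmetric] b_def[symmetric] t_def[symmetric]
    using complex_add_cnj[of "a * cnj b * x"]
    by (simp add: complex_norm_square t_def mult.commute mult.left_commute del: of_real_power)
  have cact: "cnj (su_act f x) = cnj a * cnj a * cnj x + cnj b * cnj b * x + 2 * cnj a * cnj b * t"
    by (simp add: su_act_def a_def b_def t_def power2_eq_square)
  have act: "su_act f x = a * a * x + b * b * cnj x + 2 * a * b * t"
    by (simp add: su_act_def a_def b_def t_def power2_eq_square)
  have "complex_of_real ((tt (su_act f x))\<^sup>2) = 1 + su_act f x * cnj (su_act f x)"
    unfolding of_real_power by (rule tt_sq_complex)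
  also have "\<dots> = complex_of_real (?R\<^sup>2)"
    unfolding of_real_power[of ?R] R cact unfolding act
    using ab t by algebra
  finally have "complex_of_real ((tt (su_act f x))\<^sup>2) = complex_of_real (?R\<^sup>2)" .
  then have sq: "(tt (su_act f x))\<^sup>2 = ?R\<^sup>2" unfolding of_real_eq_iff .
  have "\<bar>Re (a * cnj b * x)\<bar> \<le> cmod a * cmod b * cmod x"
    using abs_Re_le_cmod[of "a * cnj b * x"] by (simp add: norm_mult)
  also have "\<dots> \<le> cmod a * cmod b * tt x"
    using cmod_less_tt[of x] by (intro mult_left_mono) auto
  finally have "2 * \<bar>Re (a * cnj b * x)\<bar> \<le> (2 * cmod a * cmod b) * tt x" by simp
  also have "\<dots> \<le> ((cmod a)\<^sup>2 + (cmod b)\<^sup>2) * tt x"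
    using tt_pos[of x] sum_squares_bound[of "cmod a" "cmod b"] by (intro mult_right_mono) auto
  finally have "?R \<ge> 0" unfolding a_def b_def by linarith
  with sq show ?thesis using tt_pos[of "su_act f x"] by (metis less_imp_le power2_eq_imp_eq)
qed

lemma tt_su_act_complex:
  assumes "f \<in> su11"
  shows "complex_of_real (tt (su_act f x)) = (fst f * cnj (fst f) + snd f * cnj (snd f)) * of_real (tt x)
    + fst f * cnj (snd f) * x + cnj (fst f) * snd f * cnj x"
  unfolding tt_su_act[OF assms]
  using complex_add_cnj[of "fst f * cnj (snd f) * x"]
  by (simp add: complex_norm_square mult.commute mult.left_commute del: of_real_power)

lemma su_act_one [simp]: "su_act su_one x = x"
  by (simp add: su_act_def su_one_def)

lemma su_act_mult:
  assumes "g \<in> su11"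
  shows "su_act (f \<odot> g) x = su_act f (su_act g x)"
  unfolding su_act_def[of f] su_act_def[of "f \<odot> g"] su_mult_def fst_conv snd_conv tt_su_act_complex[OF assms]
  unfolding su_act_def
  by (simp add: algebra_simps power2_eq_square)

lemma su_act_inv: "f \<in> su11 \<Longrightarrow> su_act (su_inv f) (su_act f x) = x"
  by (metis su_act_mult su_act_one su_inv_left)

lemma su_act_inv': "f \<in> su11 \<Longrightarrow> su_act f (su_act (su_inv f) x) = x"
  by (metis su11_inv su_act_mult su_act_one su_inv_right)

text \<open>Since (tt x - |x|)(tt x + |x|) = 1, this bounds the entries of \<open>f\<close> once
  both \<open>x\<close> and its image stay bounded. It is the source of proper
  discontinuity.\<close>

lemma su_act_lower_bound:
  assumes "f \<in> su11"
  shows "((cmod (fst f))\<^sup>2 + (cmod (snd f))\<^sup>2) * (tt x - cmod x) \<le> tt (su_act f x)"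
proof -
  have "\<bar>Re (fst f * cnj (snd f) * x)\<bar> \<le> cmod (fst f) * cmod (snd f) * cmod x"
    using abs_Re_le_cmod[of "fst f * cnj (snd f) * x"] by (simp add: norm_mult)
  moreover have "(2 * cmod (fst f) * cmod (snd f)) * cmod x \<le> ((cmod (fst f))\<^sup>2 + (cmod (snd f))\<^sup>2) * cmod x"
    using sum_squares_bound[of "cmod (fst f)" "cmod (snd f)"] by (intro mult_right_mono) auto
  ultimately have "- 2 * Re (fst f * cnj (snd f) * x) \<le> ((cmod (fst f))\<^sup>2 + (cmod (snd f))\<^sup>2) * cmod x"
    by linarith
  then show ?thesis unfolding tt_su_act[OF assms] by (simp add: algebra_simps)
qed


section \<open>The regular 12-gon with angles \<open>\<pi>/6\<close> and its side pairings\<close>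

text \<open>\<open>cosh_r\<close> and \<open>sinh_r\<close> belong to the inradius \<open>r\<close>, where \<open>cosh r = cot (\<pi>/12)\<close>.\<close>

definition cosh_r :: real where "cosh_r = 2 + sqrt 3"
definition sinh_r :: real where "sinh_r = sqrt (6 + 4 * sqrt 3)"

lemma cosh_r_pos: "cosh_r > 0" by (simp add: cosh_r_def add_pos_nonneg)
lemma sinh_r_pos: "sinh_r > 0" by (simp add: sinh_r_def add_pos_nonneg)

lemma cosh_r_sq: "cosh_r\<^sup>2 = 7 + 4 * sqrt 3"
  by (simp add: cosh_r_def power2_eq_square algebra_simps)

lemma sinh_r_sq: "sinh_r\<^sup>2 = 6 + 4 * sqrt 3"
  by (simp add: sinh_r_def add_nonneg_nonneg)

definition om :: "int \<Rightarrow> complex" where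
  "om k = cis ((2 * real_of_int k + 1) * pi / 12)"

definition sg :: "int \<Rightarrow> int" where
  "sg k = (if k mod 4 < 2 then 1 else -1)"

text \<open>Side \<open>k\<close> has outer normal direction \<open>om k\<close>; the word \<open>a b a\<inverse> b\<inverse> \<dots>\<close> pairs it with side \<open>partner k\<close>.
  All indices are read modulo 12.\<close>

definition partner :: "int \<Rightarrow> int" where
  "partner k = k + 2 * sg k"

text \<open>\<open>su_act\<close> involves only the squares and the product of the two entries, so
  the phases are half-angles and a sign is free. With this choice of sign every \<open>gen k\<close>
  has trace \<open>cosh_r\<close>.\<close>

definition gen :: "int \<Rightarrow> complex \<times> complex" where
  "gen k = (of_real cosh_r * cis (- (of_int (sg k) * pi / 3)), of_real sinh_r * om (k + 4 * sg k))"

text \<open>The Lorentz product of the point \<open>(x, tt x)\<close> with the unit spacelike normal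
  \<open>(cosh_r * om k, sinh_r)\<close> of side \<open>k\<close>, i.e. the hyperbolic sine of the
  signed distance; it is positive beyond the side.\<close>

definition wall :: "int \<Rightarrow> complex \<Rightarrow> real" where
  "wall k x = cosh_r * Re (x * cnj (om k)) - sinh_r * tt x"

definition polygon :: "complex set" where
  "polygon = {x. \<forall>k. wall k x \<le> 0}"

lemma sg_cases: "sg k = 1 \<or> sg k = -1" by (simp add: sg_def)

lemma sg_eq_1: "k mod 4 < 2 \<Longrightarrow> sg k = 1"
  and sg_eq_minus_1: "\<not> k mod 4 < 2 \<Longrightarrow> sg k = -1"
  by (simp_all only: sg_def if_True if_False not_False_eq_True)

lemma int_mod_4_cases: "k mod 4 = 0 \<or> k mod 4 = 1 \<or> k mod 4 = 2 \<or> k mod 4 = (3 :: int)"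
proof -
  have "0 \<le> k mod 4" "k mod 4 < 4" by simp_all
  then show ?thesis by linarith
qed

lemma int_mod_add: "k mod n = r \<Longrightarrow> (k + c) mod n = (r + c) mod (n :: int)"
  using mod_add_left_eq[of k n c] by simp

lemma mod_12_diff_0: "(j - k) mod 12 = 0 \<Longrightarrow> j mod 12 = k mod (12 :: int)"
  by (simp add: mod_eq_dvd_iff dvd_eq_mod_eq_0)

lemma mod_12_diff_1: "(j - k) mod 12 = 1 \<Longrightarrow> (j - 1) mod 12 = k mod (12 :: int)"
  using int_mod_add[of "j - k" 12 1 "-1"] by (intro mod_12_diff_0) (simp add: algebra_simps)

lemma mod_12_diff_11: "(j - k) mod 12 = 11 \<Longrightarrow> (k - j) mod 12 = (1 :: int)"
  using zmod_zminus1_eq_if[of "j - k" 12] by simp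

lemma sg_partner: "sg (partner k) = - sg k"
proof (cases "k mod 4 < 2")
  case True
  then have "k mod 4 = 0 \<or> k mod 4 = 1" using int_mod_4_cases[of k] by auto
  then have "\<not> (k + 2) mod 4 < 2" using int_mod_add[of k 4 0 2] int_mod_add[of k 4 1 2] by auto
  then have "sg (k + 2) = - 1" by (rule sg_eq_minus_1)
  then show ?thesis using sg_eq_1[OF True] by (simp add: partner_def)
next
  case False
  then have "k mod 4 = 2 \<or> k mod 4 = 3" using int_mod_4_cases[of k] by auto
  then have "(k - 2) mod 4 < 2" using int_mod_add[of k 4 2 "-2"] int_mod_add[of k 4 3 "-2"] by auto
  then have "sg (k - 2) = 1" by (rule sg_eq_1)
  then show ?thesis using sg_eq_minus_1[OF False] by (simp add: partner_def)
qed

lemma partner_partner [simp]: "partner (partner k) = k"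
  unfolding partner_def[of "partner k"] sg_partner by (simp add: partner_def)

lemma cis_periodic_int: "cis (x + 2 * pi * real_of_int m) = cis x"
  unfolding cis_mult[symmetric] cis_multiple_2pi[OF Ints_of_int] by simp

lemma om_mod: assumes "j mod 12 = k mod 12" shows "om j = om k"
proof -
  have m: "j = k + 12 * (j div 12 - k div 12)" (is "_ = _ + 12 * ?m")
    using assms by (simp add: right_diff_distrib minus_mod_eq_mult_div[symmetric])
  have "(2 * real_of_int j + 1) * pi / 12 = (2 * real_of_int k + 1) * pi / 12 + 2 * pi * real_of_int ?m"
    by (subst m) (simp add: field_simps)
  then have "om j = cis ((2 * real_of_int k + 1) * pi / 12 + 2 * pi * real_of_int ?m)"
    unfolding om_def by (rule arg_cong)
  then show ?thesis unfolding cis_periodic_int om_def .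
qed

lemma sg_mod: assumes "j mod 12 = k mod 12" shows "sg j = sg k"
proof -
  have "j mod 4 = k mod 4" using arg_cong[OF assms, of "\<lambda>i. i mod 4"] by (simp add: mod_mod_cancel)
  then show ?thesis unfolding sg_def by (simp only:)
qed

lemma partner_mod: assumes "j mod 12 = k mod 12" shows "partner j mod 12 = partner k mod 12"
  unfolding partner_def sg_mod[OF assms] using assms by (rule mod_add_cong[OF _ refl])

lemma gen_mod: assumes "j mod 12 = k mod 12" shows "gen j = gen k"
proof -
  have "(j + 4 * sg j) mod 12 = (k + 4 * sg k) mod 12"
    unfolding sg_mod[OF assms] using assms by (rule mod_add_cong[OF _ refl])
  then have "om (j + 4 * sg j) = om (k + 4 * sg k)" by (rule om_mod)
  then show ?thesis using sg_mod[OF assms] by (simp add: gen_def)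
qed

lemma wall_mod: "j mod 12 = k mod 12 \<Longrightarrow> wall j x = wall k x"
  using om_mod[of j k] by (simp add: wall_def)

lemma norm_om [simp]: "cmod (om k) = 1" by (simp add: om_def)

lemma om_cnj [simp]: "om k * cnj (om k) = 1" by (simp add: om_def cis_cnj cis_mult)

lemma om_mult: "om j * om k = cis ((real_of_int (j + k) + 1) * pi / 6)"
  unfolding om_def cis_mult by (rule arg_cong[where f=cis]) (simp add: field_simps)

lemma om_mult_cong: "j + k = m + n \<Longrightarrow> om j * om k = om m * om n"
  by (simp add: om_mult)

lemma om_mult_cnj: "om j * cnj (om k) = cis (real_of_int (j - k) * pi / 6)"
  unfolding om_def cis_cnj cis_mult by (rule arg_cong[where f=cis]) (simp add: field_simps)

lemma minus_cis_int: "- cis x = cis (x + of_int (sg k) * pi)"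
  using sg_cases[of k] by (auto simp: complex_eq_iff)

lemma gen_sq_fst: "(fst (gen k))\<^sup>2 = - (of_real (cosh_r\<^sup>2) * om (partner k) * cnj (om k))"
proof -
  have "om (partner k) * cnj (om k) = cis (of_int (sg k) * pi / 3)"
    unfolding om_mult_cnj by (simp add: partner_def mult.commute)
  also have "\<dots> = - cis (of_int (sg k) * pi / 3 - of_int (sg k) * pi)"
    using minus_cis_int[of "of_int (sg k) * pi / 3 - of_int (sg k) * pi" k] by (simp add: mult.commute)
  also have "of_int (sg k) * pi / 3 - of_int (sg k) * pi = - (2 * (of_int (sg k) * pi / 3))" by simp
  finally have 1: "om (partner k) * cnj (om k) = - cis (- (2 * (of_int (sg k) * pi / 3)))" .
  show ?thesis
    unfolding mult.assoc 1 by (simp add: gen_def power_mult_distrib Complex.DeMoivre)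
qed

lemma gen_sq_snd: "(snd (gen k))\<^sup>2 = - (of_real (sinh_r\<^sup>2) * om k * om (partner k))"
proof -
  have "om (k + 4 * sg k) * om (k + 4 * sg k) = cis ((4 * real_of_int k + 16 * of_int (sg k) + 2) * pi / 12)"
    unfolding om_def cis_mult by (rule arg_cong[where f=cis]) (simp add: field_simps)
  also have "(4 * real_of_int k + 16 * of_int (sg k) + 2) * pi / 12
     = (4 * real_of_int k + 4 * of_int (sg k) + 2) * pi / 12 + of_int (sg k) * pi" by (simp add: field_simps)
  also have "cis \<dots> = - cis ((4 * real_of_int k + 4 * of_int (sg k) + 2) * pi / 12)"
    by (rule minus_cis_int[symmetric])
  also have "cis ((4 * real_of_int k + 4 * of_int (sg k) + 2) * pi / 12) = om k * om (partner k)"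
    unfolding om_def cis_mult partner_def by (rule arg_cong[where f=cis]) (simp add: field_simps)
  finally show ?thesis by (simp add: gen_def power2_eq_square mult.assoc mult.left_commute)
qed

lemma gen_mult: "fst (gen k) * snd (gen k) = of_real (cosh_r * sinh_r) * om (partner k)"
proof -
  have "cis (- (of_int (sg k) * pi / 3)) * om (k + 4 * sg k) = om (partner k)"
    unfolding om_def cis_mult partner_def by (rule arg_cong[where f=cis]) (simp add: field_simps)
  then show ?thesis by (simp add: gen_def mult.assoc mult.left_commute)
qed

lemma cmod_gen: "cmod (fst (gen k)) = cosh_r" "cmod (snd (gen k)) = sinh_r"
  using cosh_r_pos sinh_r_pos by (simp_all add: gen_def norm_mult)

lemma gen_su11: "gen k \<in> su11"
  by (simp add: su11_cmod cmod_gen cosh_r_sq sinh_r_sq)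

lemma gen_partner: "gen (partner k) = su_inv (gen k)"
proof -
  have "om (partner k + 4 * sg (partner k)) = cis ((2 * real_of_int k - 4 * of_int (sg k) + 1) * pi / 12)"
    unfolding om_def sg_partner by (rule arg_cong[where f=cis]) (simp add: partner_def field_simps)
  also have "\<dots> = - cis ((2 * real_of_int k - 4 * of_int (sg k) + 1) * pi / 12 + of_int (sg k) * pi)"
    using minus_cis_int[of "(2 * real_of_int k - 4 * of_int (sg k) + 1) * pi / 12" k] by (metis minus_minus)
  also have "cis ((2 * real_of_int k - 4 * of_int (sg k) + 1) * pi / 12 + of_int (sg k) * pi) = om (k + 4 * sg k)"
    unfolding om_def by (rule arg_cong[where f=cis]) (simp add: field_simps)
  finally show ?thesis
    by (simp add: gen_def su_inv_def sg_partner cis_cnj)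
qed

lemma gen_partner_cancel: "gen (partner k) \<odot> (gen k \<odot> f) = f"
  by (metis gen_partner gen_su11 su_inv_left su_mult_assoc su_one_left)

text \<open>\<open>gen k\<close> is the reflection in side \<open>k\<close> followed by the Euclidean reflection that exchanges the
  sides \<open>k\<close> and \<open>partner k\<close>.\<close>

lemma act_gen:
  "su_act (gen k) x = om k * om (partner k) * cnj (x - of_real (2 * wall k x * cosh_r) * om k)"
proof -
  define o1 o2 where "o1 = om k" and "o2 = om (partner k)"
  have cs: "complex_of_real cosh_r ^ 2 = of_real sinh_r ^ 2 + 1"
    by (simp only: of_real_power[symmetric] cosh_r_sq sinh_r_sq) simp
  have oo: "o1 * cnj o1 = 1" by (simp add: o1_def)
  have w: "complex_of_real (2 * wall k x) = of_real cosh_r * (x * cnj o1 + cnj x * o1) - 2 * of_real sinh_r * of_real (tt x)"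
    unfolding wall_def o1_def using complex_add_cnj[of "x * cnj (om k)"] by simp
  have "su_act (gen k) x = - (of_real cosh_r ^ 2 * o2 * cnj o1) * x - (of_real sinh_r ^ 2 * o1 * o2) * cnj x
      + 2 * (of_real cosh_r * of_real sinh_r * o2) * of_real (tt x)"
    unfolding su_act_def gen_sq_fst gen_sq_snd o1_def o2_def using gen_mult[of k] by (simp add: mult.assoc)
  moreover have "om k * om (partner k) * cnj (x - of_real (2 * wall k x * cosh_r) * om k)
     = o1 * o2 * (cnj x - (of_real cosh_r * (x * cnj o1 + cnj x * o1) - 2 * of_real sinh_r * of_real (tt x)) * of_real cosh_r * cnj o1)"
    unfolding o1_def[symmetric] o2_def[symmetric] of_real_mult[of "2 * wall k x"] w by simp
  ultimately show ?thesis using oo cs by algebra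
qed

text \<open>Crossing side \<open>k\<close> from outside, where \<open>wall k x\<close> is positive,
  lowers the height \<open>tt\<close>. This is what makes descents terminate.\<close>

lemma tt_gen: "tt (su_act (gen k) x) = tt x - 2 * wall k x * sinh_r"
proof -
  define y where "y = - ((2 * real_of_int k + 1) * pi / 12)"
  have "cis (- (of_int (sg k) * pi / 3)) * cnj (om (k + 4 * sg k)) = cis (y - of_int (sg k) * pi)"
    unfolding om_def cis_cnj cis_mult y_def by (rule arg_cong[where f=cis]) (simp add: field_simps)
  also have "\<dots> = - cis y"
    using minus_cis_int[of "y - of_int (sg k) * pi" k] by (metis diff_add_cancel minus_minus)
  also have "cis y = cnj (om k)" by (simp add: om_def cis_cnj y_def)
  finally have "fst (gen k) * cnj (snd (gen k)) = - of_real (cosh_r * sinh_r) * cnj (om k)"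
    by (simp add: gen_def mult.assoc mult.left_commute)
  then have "fst (gen k) * cnj (snd (gen k)) * x = - of_real (cosh_r * sinh_r) * (x * cnj (om k))"
    by (simp add: mult.commute mult.left_commute)
  then have 1: "Re (fst (gen k) * cnj (snd (gen k)) * x) = - (cosh_r * sinh_r * Re (x * cnj (om k)))"
    by simp
  have "cosh_r\<^sup>2 = sinh_r\<^sup>2 + 1" by (simp add: cosh_r_sq sinh_r_sq)
  then show ?thesis
    unfolding tt_su_act[OF gen_su11] 1 cmod_gen wall_def by algebra
qed

lemma om_Re_unfold: "Re (om j * cnj (om k)) = cos (real_of_int (j - k) * pi / 6)"
  by (simp add: om_mult_cnj)

text \<open>\<open>gen k\<close> is a reflection in side \<open>k\<close> followed by a Euclidean
  reflection that carries index \<open>k + partner k - j\<close> to \<open>j\<close>. The bracket is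
  the Lorentz product of the normals of sides \<open>partner k\<close> and \<open>j\<close>.\<close>

lemma wall_gen:
  "wall j (su_act (gen k) x) = wall (k + partner k - j) x
     - 2 * wall k x * (cosh_r\<^sup>2 * cos (real_of_int (partner k - j) * pi / 6) - sinh_r\<^sup>2)"
proof -
  define i where "i = k + partner k - j"
  define y where "y = x - of_real (2 * wall k x * cosh_r) * om k"
  have "om k * om (partner k) = om i * om j" by (rule om_mult_cong) (simp add: i_def)
  then have "su_act (gen k) x * cnj (om j) = om i * cnj y * (om j * cnj (om j))"
    unfolding act_gen y_def[symmetric] by (simp add: mult_ac)
  then have "Re (su_act (gen k) x * cnj (om j)) = Re (cnj (y * cnj (om i)))" by simp
  also have "\<dots> = Re (y * cnj (om i))" by (rule cnj.simps)
  also have "\<dots> = Re (x * cnj (om i)) - 2 * wall k x * cosh_r * Re (om k * cnj (om i))"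
    unfolding y_def left_diff_distrib mult.assoc minus_complex.sel by (simp add: mult.assoc)
  finally have *: "Re (su_act (gen k) x * cnj (om j)) = \<dots>" .
  have "real_of_int (k - i) * pi / 6 = - (real_of_int (partner k - j) * pi / 6)"
    by (simp add: i_def field_simps)
  then have c: "Re (om k * cnj (om i)) = cos (real_of_int (partner k - j) * pi / 6)"
    unfolding om_Re_unfold by (simp only: cos_minus)
  show ?thesis
    unfolding i_def[symmetric] wall_def[of j] wall_def[of i] tt_gen * c
    by (simp only: algebra_simps power2_eq_square)
qed

lemma wall_gen_partner: "wall (partner k) (su_act (gen k) x) = - wall k x"
  unfolding wall_gen by (simp add: cosh_r_sq sinh_r_sq)

text \<open>Consecutive normals have Lorentz product - cos (pi/6), because the polygon has angles
  pi/6; hence the coefficient sqrt 3 = 2 cos (pi/6).\<close>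

lemma wall_gen_partner_Suc: "wall (partner k + 1) (su_act (gen k) x) = wall (k - 1) x + sqrt 3 * wall k x"
  unfolding wall_gen by (simp add: cosh_r_sq sinh_r_sq cos_30 algebra_simps)

lemma wall_gen_zero: "wall k x = 0 \<Longrightarrow> wall j (su_act (gen k) x) = wall (k + partner k - j) x"
  by (simp add: wall_gen)

lemma cos_le_between:
  assumes "0 \<le> y" "y \<le> x" "x \<le> 2 * pi - y"
  shows "cos x \<le> cos y"
proof (cases "x \<le> pi")
  case True
  with assms show ?thesis by (intro cos_monotone_0_pi_le) auto
next
  case False
  have "cos (2 * pi - x) \<le> cos y" using assms False by (intro cos_monotone_0_pi_le) auto
  then show ?thesis by simp
qed

lemma cos_int_mod_12: "cos (x + real_of_int d * pi / 6) = cos (x + real_of_int (d mod 12) * pi / 6)"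
proof -
  have "real_of_int d = real_of_int (d mod 12) + 12 * real_of_int (d div 12)"
    by (metis add.commute mult_div_mod_eq of_int_add of_int_mult of_int_numeral)
  then have "x + real_of_int d * pi / 6 = (x + real_of_int (d mod 12) * pi / 6) + 2 * pi * real_of_int (d div 12)"
    by (simp add: field_simps)
  then have "cis (x + real_of_int d * pi / 6) = cis (x + real_of_int (d mod 12) * pi / 6)"
    by (simp only: cis_periodic_int)
  then show ?thesis by (metis cis.sel(1))
qed

text \<open>For sides that are neither equal nor adjacent, |om j + om k| <= sqrt 3 and
  \<open>cosh_r * sqrt 3 \<le> 2 * sinh_r\<close>. The sum of the two normals is then not spacelike
  and has negative Lorentz product with every point of the sheet.\<close>

lemma adjacent_walls:
  assumes "wall j x \<ge> 0" "wall k x \<ge> 0"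
  shows "(j - k) mod 12 \<in> {0, 1, 11}"
proof (rule ccontr)
  assume *: "\<not> ?thesis"
  define d where "d = (j - k) mod 12"
  have "d \<noteq> 0" "d \<noteq> 1" "d \<noteq> 11" using * by (auto simp: d_def)
  moreover have "0 \<le> d" "d < 12" unfolding d_def by simp_all
  ultimately have d: "2 \<le> d" "d \<le> 10" by auto
  then have d': "2 \<le> real_of_int d" "real_of_int d \<le> 10" by auto
  have "cos (real_of_int (j - k) * pi / 6) = cos (real_of_int d * pi / 6)"
    using cos_int_mod_12[of 0 "j - k"] by (simp add: d_def)
  also have "\<dots> \<le> cos (pi / 3)"
    using d' by (intro cos_le_between) (auto simp: field_simps)
  finally have c: "cos (real_of_int (j - k) * pi / 6) \<le> 1 / 2" by (simp add: cos_60)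
  have "(cmod (om j + om k))\<^sup>2 = (cmod (om j))\<^sup>2 + (cmod (om k))\<^sup>2 + 2 * Re (om j * cnj (om k))"
    unfolding cmod_power2 by (simp add: power2_eq_square algebra_simps)
  then have "(cmod (om j + om k))\<^sup>2 = 2 + 2 * cos (real_of_int (j - k) * pi / 6)"
    unfolding om_Re_unfold by simp
  then have "(cmod (om j + om k))\<^sup>2 \<le> (sqrt 3)\<^sup>2" using c by simp
  then have n: "cmod (om j + om k) \<le> sqrt 3" by (rule power2_le_imp_le) simp
  have "(cosh_r * sqrt 3)\<^sup>2 \<le> (2 * sinh_r)\<^sup>2"
    unfolding power_mult_distrib cosh_r_sq sinh_r_sq by simp
  then have cs: "cosh_r * sqrt 3 \<le> 2 * sinh_r"
    by (rule power2_le_imp_le) (use sinh_r_pos in simp)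
  have "0 \<le> wall j x + wall k x" using assms by simp
  also have "\<dots> = cosh_r * Re (x * cnj (om j + om k)) - 2 * sinh_r * tt x"
    by (simp add: wall_def algebra_simps)
  also have "\<dots> \<le> cosh_r * (cmod x * sqrt 3) - 2 * sinh_r * tt x"
  proof -
    have "Re (x * cnj (om j + om k)) \<le> cmod x * cmod (om j + om k)"
      using complex_Re_le_cmod[of "x * cnj (om j + om k)"] by (simp only: norm_mult complex_mod_cnj)
    also have "\<dots> \<le> cmod x * sqrt 3" using n by (simp add: mult_left_mono)
    finally show ?thesis using cosh_r_pos by simp
  qed
  also have "\<dots> \<le> 2 * sinh_r * cmod x - 2 * sinh_r * tt x"
    using mult_right_mono[OF cs, of "cmod x"] by (simp add: mult_ac)
  also have "\<dots> < 0" using cmod_less_tt[of x] sinh_r_pos by simp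
  finally show False by simp
qed


subsection \<open>The cycle of vertices\<close>

text \<open>Crossing side \<open>j\<close> near its initial vertex leads to the vertex where side \<open>partner j + 1\<close> begins.
  Iterating from side 0 visits the sides \<open>0, 3, 2, 1, 4, 7, 6, 5, 8, 11, 10, 9\<close> in turn; this is \<open>kap\<close>.\<close>

definition kap :: "int \<Rightarrow> int" where
  "kap i = (if i mod 4 = 1 then i + 2 else if i mod 4 = 3 then i - 2 else i)"

lemma kap_kap: "kap (kap i) = i"
proof -
  have "i mod 4 = 1 \<Longrightarrow> (i + 2) mod 4 = 3" "i mod 4 = 3 \<Longrightarrow> (i - 2) mod 4 = 1"
    using int_mod_add[of i 4 1 2] int_mod_add[of i 4 3 "-2"] by auto
  then show ?thesis unfolding kap_def by auto
qed

lemma kap_Suc: "kap (i + 1) = partner (kap i) + 1"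
proof -
  consider "i mod 4 = 0" | "i mod 4 = 1" | "i mod 4 = 2" | "i mod 4 = 3" using int_mod_4_cases[of i] by blast
  then show ?thesis
  proof cases
    case 1
    then have "(i + 1) mod 4 = 1" "i mod 4 < 2" using int_mod_add[of i 4 0 1] by simp_all
    then show ?thesis using 1 sg_eq_1[of i] by (simp add: kap_def partner_def)
  next
    case 2
    then have "(i + 1) mod 4 = 2" "\<not> (i + 2) mod 4 < 2"
      using int_mod_add[of i 4 1 1] int_mod_add[of i 4 1 2] by simp_all
    then show ?thesis using 2 sg_eq_minus_1[of "i + 2"] by (simp add: kap_def partner_def)
  next
    case 3
    then have "(i + 1) mod 4 = 3" "\<not> i mod 4 < 2" using int_mod_add[of i 4 2 1] by simp_all
    then show ?thesis using 3 sg_eq_minus_1[of i] by (simp add: kap_def partner_def)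
  next
    case 4
    then have "(i + 1) mod 4 = 0" "(i - 2) mod 4 < 2"
      using int_mod_add[of i 4 3 1] int_mod_add[of i 4 3 "-2"] by simp_all
    then show ?thesis using 4 sg_eq_1[of "i - 2"] by (simp add: kap_def partner_def)
  qed
qed

lemma kap_mod: assumes "i mod 12 = j mod 12" shows "kap i mod 12 = kap j mod 12"
proof -
  have h: "i mod 4 = j mod 4"
    using arg_cong[OF assms, of "\<lambda>i. i mod 4"] by (simp add: mod_mod_cancel)
  have h': "(i + 2) mod 12 = (j + 2) mod 12" "(i - 2) mod 12 = (j - 2) mod 12"
    by (rule mod_add_cong[OF assms refl], rule mod_diff_cong[OF assms refl])
  show ?thesis
    unfolding kap_def h using h' assms by (cases "j mod 4 = 1"; cases "j mod 4 = 3") (simp_all only: if_True if_False refl)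
qed

lemma kap_mod_iff: "kap i mod 12 = kap j mod 12 \<longleftrightarrow> i mod 12 = j mod 12"
  by (metis kap_kap kap_mod)

subsection \<open>Coordinates in \<open>\<int>[\<zeta>]\<close>, \<open>\<zeta> = exp (i\<pi>/6)\<close>\<close>

type_synonym zint = "int \<times> int \<times> int \<times> int"

definition zeval :: "complex \<Rightarrow> zint \<Rightarrow> complex" where
  "zeval w = (\<lambda>(p, q, r, t). of_int p + of_int q * w + of_int r * w\<^sup>2 + of_int t * w ^ 3)"

definition zadd :: "zint \<Rightarrow> zint \<Rightarrow> zint" where
  "zadd = (\<lambda>(p, q, r, t) (p', q', r', t'). (p + p', q + q', r + r', t + t'))"

text \<open>Polynomial multiplication modulo the cyclotomic polynomial w^4 - w^2 + 1, using w^4 =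
  w^2 - 1, w^5 = w^3 - w and w^6 = -1.\<close>

definition zmul :: "zint \<Rightarrow> zint \<Rightarrow> zint" where
  "zmul = (\<lambda>(p, q, r, t) (p', q', r', t').
     (p * p' - (q * t' + r * r' + t * q') - t * t',
      p * q' + q * p' - (r * t' + t * r'),
      p * r' + q * q' + r * p' + (q * t' + r * r' + t * q'),
      p * t' + q * r' + r * q' + t * p' + (r * t' + t * r')))"

text \<open>On the unit circle conjugation is inversion, and w^6 = -1 gives 1/w = - w^5 = w -
  w^3.\<close>

definition zcnj :: "zint \<Rightarrow> zint" where
  "zcnj = (\<lambda>(p, q, r, t). (p + r, q, - r, - q - t))"

text \<open>Only the two identities that evaluation requires, so that one integer computation is
  valid at both conjugates \<open>zeta1\<close> and \<open>zeta2\<close>.\<close>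

definition zeta12 :: "complex \<Rightarrow> bool" where
  "zeta12 w \<longleftrightarrow> w ^ 4 = w\<^sup>2 - 1 \<and> cnj w = w - w ^ 3"

lemma zeval_add: "zeval w (zadd x y) = zeval w x + zeval w y"
  by (auto simp: zeval_def zadd_def algebra_simps split: prod.splits)

lemma zeval_mul: assumes "zeta12 w" shows "zeval w (zmul x y) = zeval w x * zeval w y"
proof -
  obtain p q r t p' q' r' t' where xy: "x = (p, q, r, t)" "y = (p', q', r', t')" by (metis prod.exhaust)
  have w: "w * w * w * w = w * w - 1"
    using assms by (simp add: zeta12_def eval_nat_numeral mult.assoc)
  show ?thesis
    unfolding xy zeval_def zmul_def prod.case of_int_add of_int_diff of_int_mult power2_eq_square power3_eq_cube
    using w by algebra
qed

lemma zeval_cnj: assumes "zeta12 w" shows "zeval w (zcnj x) = cnj (zeval w x)"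
proof -
  obtain p q r t where x: "x = (p, q, r, t)" by (metis prod.exhaust)
  have w: "w * w * w * w = w * w - 1" and c: "cnj w = w - w * w * w"
    using assms by (simp_all add: zeta12_def eval_nat_numeral mult.assoc)
  show ?thesis
    unfolding x zeval_def zcnj_def prod.case of_int_add of_int_diff of_int_mult of_int_minus
      power2_eq_square power3_eq_cube complex_cnj_add complex_cnj_mult complex_cnj_of_int c
    using w by algebra
qed

fun zpow :: "nat \<Rightarrow> zint" where
  "zpow 0 = (1, 0, 0, 0)"
| "zpow (Suc n) = zmul (0, 1, 0, 0) (zpow n)"

lemma zeval_pow: "zeta12 w \<Longrightarrow> zeval w (zpow n) = w ^ n"
proof (induction n)
  case 0
  show ?case by (simp add: zeval_def)
next
  case (Suc n)
  have "zeval w (0, 1, 0, 0) = w" by (simp add: zeval_def)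
  then show ?case using Suc by (simp add: zeval_mul)
qed

abbreviation zeta1 :: complex where "zeta1 \<equiv> cis (pi / 6)"
text \<open>The image of \<open>zeta1\<close> under the Galois automorphism zeta -> zeta^5, which
  fixes \<i> = zeta^3 and changes the sign of sqrt 3.\<close>

abbreviation zeta2 :: complex where "zeta2 \<equiv> cis (5 * pi / 6)"

lemma zeta1_eq: "zeta1 = Complex (sqrt 3 / 2) (1 / 2)"
  by (simp add: complex_eq_iff cos_30 sin_30)

lemma zeta2_eq: "zeta2 = Complex (- sqrt 3 / 2) (1 / 2)"
proof -
  have "5 * pi / 6 = pi - pi / 6" by simp
  then have "cos (5 * pi / 6) = - cos (pi / 6)" "sin (5 * pi / 6) = sin (pi / 6)"
    by (metis cos_pi_minus, metis sin_pi_minus)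
  then show ?thesis by (simp add: complex_eq_iff cos_30 sin_30)
qed

lemma zeta1_sq: "zeta1\<^sup>2 = Complex (1 / 2) (sqrt 3 / 2)" and zeta1_cube: "zeta1 ^ 3 = \<i>"
  unfolding zeta1_eq by (simp_all add: complex_eq_iff power2_eq_square power3_eq_cube)

lemma zeta2_sq: "zeta2\<^sup>2 = Complex (1 / 2) (- sqrt 3 / 2)" and zeta2_cube: "zeta2 ^ 3 = \<i>"
  unfolding zeta2_eq by (simp_all add: complex_eq_iff power2_eq_square power3_eq_cube)

lemma zeta12_zeta1: "zeta12 zeta1"
proof -
  have "zeta1 ^ 4 = zeta1 * zeta1 ^ 3" by (simp add: eval_nat_numeral)
  then show ?thesis unfolding zeta12_def zeta1_sq zeta1_cube by (simp add: zeta1_eq complex_eq_iff)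
qed

lemma zeta12_zeta2: "zeta12 zeta2"
proof -
  have "zeta2 ^ 4 = zeta2 * zeta2 ^ 3" by (simp add: eval_nat_numeral)
  then show ?thesis unfolding zeta12_def zeta2_sq zeta2_cube by (simp add: zeta2_eq complex_eq_iff)
qed


text \<open>A pair \<open>(x, y)\<close> represents the entries \<open>x\<close> and
  \<open>c * y\<close>, with a factor \<open>c\<close> common to the whole group whose squared
  modulus is 6 + 8 zeta - 4 zeta^3. It absorbs both the irrationality \<open>sinh_r\<close> and the
  odd multiples of pi/12 in the phases \<open>om\<close>.\<close>

definition zsu_mult :: "zint \<times> zint \<Rightarrow> zint \<times> zint \<Rightarrow> zint \<times> zint" where
  "zsu_mult = (\<lambda>(x, y) (x', y').
     (zadd (zmul x x') (zmul (6, 8, 0, -4) (zmul y (zcnj y'))), zadd (zmul x y') (zmul y (zcnj x'))))"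

definition zsu_eval :: "complex \<Rightarrow> complex \<Rightarrow> zint \<times> zint \<Rightarrow> complex \<times> complex" where
  "zsu_eval w c = (\<lambda>(x, y). (zeval w x, c * zeval w y))"

text \<open>The element 2 + 2 zeta - zeta^3 is 2 + sqrt 3 = \<open>cosh_r\<close> at
  \<open>zeta1\<close> and 2 - sqrt 3 at \<open>zeta2\<close>; the powers of zeta are the phases of
  \<open>gen k\<close>, relative to \<open>om 0\<close> in the second entry.\<close>

definition zgen :: "int \<Rightarrow> zint \<times> zint" where
  "zgen k = (zmul (2, 2, 0, -1) (zpow (nat ((- 2 * sg k) mod 12))), zpow (nat ((k + 4 * sg k) mod 12)))"

text \<open>\<open>6 + 8\<zeta> - 4\<zeta>\<^sup>3\<close> is \<open>6 + 4\<surd>3 = (sinh r)\<^sup>2\<close> at \<open>zeta1\<close> and \<open>6 - 4\<surd>3 < 0\<close> at the conjugate \<open>zeta2\<close>, where the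
  hermitian form is therefore definite.\<close>

lemma zeval_sinh1: "zeval zeta1 (6, 8, 0, -4) = of_real (6 + 4 * sqrt 3)"
  unfolding zeval_def prod.case zeta1_sq zeta1_cube by (simp add: zeta1_eq complex_eq_iff)

lemma zeval_sinh2: "zeval zeta2 (6, 8, 0, -4) = of_real (6 - 4 * sqrt 3)"
  unfolding zeval_def prod.case zeta2_sq zeta2_cube by (simp add: zeta2_eq complex_eq_iff)

lemma zsu_eval_mult:
  assumes "zeta12 w" "c * cnj c = zeval w (6, 8, 0, -4)"
  shows "zsu_eval w c (zsu_mult f g) = zsu_eval w c f \<odot> zsu_eval w c g"
proof -
  obtain x y x' y' where fg: "f = (x, y)" "g = (x', y')" by (metis prod.exhaust)
  show ?thesis
    unfolding fg zsu_eval_def zsu_mult_def prod.case zeval_add zeval_mul[OF assms(1)] zeval_cnj[OF assms(1)]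
      assms(2)[symmetric] su_mult_def fst_conv snd_conv complex_cnj_mult
    by (simp add: algebra_simps)
qed

abbreviation zscale :: complex where "zscale \<equiv> of_real sinh_r * om 0"

lemma zscale: "zscale * cnj zscale = zeval zeta1 (6, 8, 0, -4)"
proof -
  have "zscale * cnj zscale = of_real (sinh_r * sinh_r) * (om 0 * cnj (om 0))" by (simp add: mult_ac del: om_cnj)
  also have "sinh_r * sinh_r = 6 + 4 * sqrt 3" using sinh_r_sq by (simp add: power2_eq_square)
  finally show ?thesis unfolding zeval_sinh1 by simp
qed

lemma zeta1_pow: "zeta1 ^ nat (j mod 12) = cis (real_of_int j * pi / 6)"
proof -
  have "zeta1 ^ nat (j mod 12) = cis (real_of_int (j mod 12) * pi / 6)"
    by (simp add: Complex.DeMoivre)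
  also have "\<dots> = cis (real_of_int (j mod 12) * pi / 6 + 2 * pi * real_of_int (j div 12))"
    by (simp only: cis_periodic_int)
  also have "real_of_int (j mod 12) * pi / 6 + 2 * pi * real_of_int (j div 12)
      = (real_of_int (j mod 12) + 12 * real_of_int (j div 12)) * pi / 6" by (simp add: field_simps)
  also have "real_of_int (j mod 12) + 12 * real_of_int (j div 12) = real_of_int j"
    by (metis add.commute mult_div_mod_eq of_int_add of_int_mult of_int_numeral)
  finally show ?thesis .
qed

lemma gen_zgen: "gen k = zsu_eval zeta1 zscale (zgen k)"
proof -
  have "zeval zeta1 (2, 2, 0, -1) = of_real cosh_r"
    unfolding zeval_def prod.case zeta1_sq zeta1_cube cosh_r_def by (simp add: zeta1_eq complex_eq_iff)
  moreover have "om (k + 4 * sg k) = om 0 * cis (real_of_int (k + 4 * sg k) * pi / 6)"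
    unfolding om_def cis_mult by (rule arg_cong[where f=cis]) (simp add: field_simps)
  moreover have "cis (real_of_int (- 2 * sg k) * pi / 6) = cis (- (of_int (sg k) * pi / 3))"
    by (rule arg_cong[where f=cis]) (simp add: field_simps)
  ultimately show ?thesis
    unfolding gen_def zgen_def zsu_eval_def prod.case zeval_mul[OF zeta12_zeta1] zeval_pow[OF zeta12_zeta1] zeta1_pow
    by simp
qed

section \<open>The relation at the vertex\<close>

primrec vertex_word :: "nat \<Rightarrow> complex \<times> complex" where
  "vertex_word 0 = su_one"
| "vertex_word (Suc n) = gen (kap (int n)) \<odot> vertex_word n"

primrec zvertex_word :: "nat \<Rightarrow> zint \<times> zint" where
  "zvertex_word 0 = ((1, 0, 0, 0), (0, 0, 0, 0))"
| "zvertex_word (Suc n) = zsu_mult (zgen (kap (int n))) (zvertex_word n)"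

lemma vertex_word_zvertex_word: "vertex_word n = zsu_eval zeta1 zscale (zvertex_word n)"
proof (induction n)
  case 0
  show ?case by (simp add: zsu_eval_def zeval_def su_one_def)
next
  case (Suc n)
  then show ?case by (simp add: zsu_eval_mult[OF zeta12_zeta1 zscale] gen_zgen)
qed

text \<open>Twelve angles pi/6 add up to 2 pi, so geometrically the product is \<plusminus>1. The
  exact computation confirms this and decides the sign.\<close>

lemma zvertex_word_12: "zvertex_word 12 = ((1, 0, 0, 0), (0, 0, 0, 0))"
  by code_simp

lemma vertex_word_12: "vertex_word 12 = su_one"
  unfolding vertex_word_zvertex_word zvertex_word_12 by (simp add: zsu_eval_def zeval_def su_one_def)

text \<open>\<open>vertex_elem\<close> turns the vertex relation into a potential, periodic in the index.\<close>
definition vertex_elem :: "int \<Rightarrow> complex \<times> complex" where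
  "vertex_elem i = vertex_word (nat (i mod 12))"

lemma vertex_elem_mod: "i mod 12 = j mod 12 \<Longrightarrow> vertex_elem i = vertex_elem j"
  by (simp add: vertex_elem_def)

lemma vertex_elem_Suc: "vertex_elem (i + 1) = gen (kap i) \<odot> vertex_elem i"
proof -
  define n where "n = nat (i mod 12)"
  have n: "int n = i mod 12" "n < 12" unfolding n_def by (auto simp: nat_less_iff)
  have "int n mod 12 = i mod 12" using n by simp
  then have g: "gen (kap (int n)) = gen (kap i)" by (intro gen_mod kap_mod)
  have s: "vertex_word (Suc n) = gen (kap i) \<odot> vertex_elem i"
    by (simp add: g vertex_elem_def n_def[symmetric])
  have "(i + 1) mod 12 = (int n + 1) mod 12" unfolding n(1) by (simp add: mod_simps)
  then have *: "vertex_elem (i + 1) = vertex_word (nat ((int n + 1) mod 12))" by (simp add: vertex_elem_def)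
  show ?thesis
  \<comment> \<open>At residue 11 the index wraps around, and \<open>vertex_word_12\<close> is what
    closes the cycle.\<close>
  proof (cases "n = 11")
    case True
    then have "vertex_elem (i + 1) = vertex_word 0" using * by simp
    also have "\<dots> = vertex_word (Suc n)" using vertex_word_12 True by (simp add: eval_nat_numeral)
    finally show ?thesis using s by simp
  next
    case False
    then have "nat ((int n + 1) mod 12) = Suc n" using n(2) by simp
    with * have "vertex_elem (i + 1) = vertex_word (Suc n)" by (simp only:)
    then show ?thesis using s by (simp only:)
  qed
qed


section \<open>The group generated by the side pairings\<close>

text \<open>Inverses come for free, since the inverse of \<open>gen k\<close> is
  \<open>gen (partner k)\<close>.\<close>

inductive_set surf_group :: "(complex \<times> complex) set" where
  surf_group_one: "su_one \<in> surf_group"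
| surf_group_step: "f \<in> surf_group \<Longrightarrow> gen k \<odot> f \<in> surf_group"

lemma surf_group_su11: "f \<in> surf_group \<Longrightarrow> f \<in> su11"
  by (induction rule: surf_group.induct) (auto intro: su11_one su11_mult gen_su11)

lemma surf_group_mult: "f \<in> surf_group \<Longrightarrow> g \<in> surf_group \<Longrightarrow> f \<odot> g \<in> surf_group"
  by (induction rule: surf_group.induct) (auto simp: su_mult_assoc intro: surf_group_step)

lemma gen_in_surf_group: "gen k \<in> surf_group"
  using surf_group_step[OF surf_group_one, of k] by simp

lemma su_inv_mult: "su_inv (f \<odot> g) = su_inv g \<odot> su_inv f"
  by (simp add: su_inv_def su_mult_def algebra_simps)

lemma surf_group_inv: "f \<in> surf_group \<Longrightarrow> su_inv f \<in> surf_group"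
proof (induction rule: surf_group.induct)
  case surf_group_one
  then show ?case using surf_group.surf_group_one by (simp add: su_inv_def su_one_def)
next
  case (surf_group_step f k)
  then show ?case using gen_in_surf_group[of "partner k"]
    by (simp add: su_inv_mult gen_partner surf_group_mult)
qed

lemma vertex_word_in_surf_group: "vertex_word n \<in> surf_group"
  by (induction n) (auto intro: surf_group.intros)

lemma vertex_elem_in_surf_group: "vertex_elem i \<in> surf_group"
  by (simp add: vertex_elem_def vertex_word_in_surf_group)

text \<open>Discreteness: the entries lie in a ring of algebraic integers, and the conjugate group is
  contained in a compact unitary group.\<close>

lemma surf_group_zint:
  assumes "f \<in> surf_group"
  shows "\<exists>x y. f = (zeval zeta1 x, zscale * zeval zeta1 y) \<and>
    (cmod (zeval zeta2 x))\<^sup>2 + (4 * sqrt 3 - 6) * (cmod (zeval zeta2 y))\<^sup>2 = 1"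
proof -
  define S where "S = zeval zeta2 (6, 8, 0, -4)"
  \<comment> \<open>The equation |x|^2 - S |y|^2 = 1 of SU(1,1), transported to
    \<open>zeta2\<close>. There S = 6 - 4 sqrt 3 is negative, so it becomes the equation of a
    compact group.\<close>
  define N where "N = (\<lambda>(x, y). zeval zeta2 x * cnj (zeval zeta2 x) = S * (zeval zeta2 y * cnj (zeval zeta2 y)) + 1)"
  have S: "cnj S = S" by (simp add: S_def zeval_sinh2)
  have N_mult: "N (zsu_mult f g)" if "N f" "N g" for f g
  proof -
    obtain x y x' y' where fg: "f = (x, y)" "g = (x', y')" by (metis prod.exhaust)
    show ?thesis
      using that S unfolding N_def fg zsu_mult_def prod.case zeval_add zeval_mul[OF zeta12_zeta2] zeval_cnj[OF zeta12_zeta2]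
        S_def[symmetric] complex_cnj_add complex_cnj_mult complex_cnj_cnj by algebra
  qed
  have N_gen: "N (zgen k)" for k
  proof -
    have c: "zeval zeta2 (2, 2, 0, -1) = of_real (2 - sqrt 3)"
      unfolding zeval_def prod.case zeta2_sq zeta2_cube by (simp add: zeta2_eq complex_eq_iff)
    have *: "zeta2 ^ n * cnj (zeta2 ^ n) = 1" for n
      by (simp add: Complex.DeMoivre cis_cnj cis_mult)
    have sq: "(2 - sqrt 3) * (2 - sqrt 3) = 6 - 4 * sqrt 3 + 1" by (simp add: algebra_simps)
    have **: "of_real (2 - sqrt 3) * zeta2 ^ m * cnj (of_real (2 - sqrt 3) * zeta2 ^ m)
       = of_real ((2 - sqrt 3) * (2 - sqrt 3)) * (zeta2 ^ m * cnj (zeta2 ^ m))" for m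
      by (simp add: mult_ac)
    show ?thesis
      unfolding N_def zgen_def prod.case zeval_mul[OF zeta12_zeta2] zeval_pow[OF zeta12_zeta2] c S_def zeval_sinh2 ** * sq
      by simp
  qed
  have "\<exists>x. f = zsu_eval zeta1 zscale x \<and> N x"
    using assms
  proof (induction rule: surf_group.induct)
    case surf_group_one
    show ?case
      by (rule exI[of _ "((1, 0, 0, 0), (0, 0, 0, 0))"]) (simp add: N_def zsu_eval_def zeval_def su_one_def)
  next
    case (surf_group_step f k)
    then obtain x where "f = zsu_eval zeta1 zscale x" "N x" by blast
    then have "gen k \<odot> f = zsu_eval zeta1 zscale (zsu_mult (zgen k) x) \<and> N (zsu_mult (zgen k) x)"
      by (simp add: gen_zgen zsu_eval_mult[OF zeta12_zeta1 zscale] N_mult N_gen)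
    then show ?case by blast
  qed
  then obtain x y where f: "f = (zeval zeta1 x, zscale * zeval zeta1 y)" and n: "N (x, y)"
  proof -
    assume *: "\<exists>x. f = zsu_eval zeta1 zscale x \<and> N x"
      and that: "\<And>x y. f = (zeval zeta1 x, zscale * zeval zeta1 y) \<Longrightarrow> N (x, y) \<Longrightarrow> thesis"
    obtain z where "f = zsu_eval zeta1 zscale z" "N z" using * by blast
    then show thesis using that[of "fst z" "snd z"] by (simp add: zsu_eval_def split_beta)
  qed
  have "complex_of_real ((cmod (zeval zeta2 x))\<^sup>2) = complex_of_real ((6 - 4 * sqrt 3) * (cmod (zeval zeta2 y))\<^sup>2 + 1)"
    using n unfolding N_def prod.case S_def zeval_sinh2 of_real_add of_real_mult complex_norm_square by simp
  then have "(cmod (zeval zeta2 x))\<^sup>2 = (6 - 4 * sqrt 3) * (cmod (zeval zeta2 y))\<^sup>2 + 1" unfolding of_real_eq_iff .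
  with f show ?thesis by (intro exI[of _ x] exI[of _ y]) (simp add: algebra_simps)
qed

section \<open>Finiteness properties and absence of parabolic elements\<close>

lemma sqrt3_bounds: "1.73 < sqrt 3" "sqrt 3 < 1.7321"
  by (rule real_less_rsqrt, simp add: power2_eq_square) (rule real_less_lsqrt, simp_all add: power2_eq_square)

lemma zeval_parts:
  "Re (zeval zeta1 (p, q, r, t)) = p + q * sqrt 3 / 2 + r / 2"
  "Im (zeval zeta1 (p, q, r, t)) = q / 2 + r * sqrt 3 / 2 + t"
  "Re (zeval zeta2 (p, q, r, t)) = p - q * sqrt 3 / 2 + r / 2"
  "Im (zeval zeta2 (p, q, r, t)) = q / 2 - r * sqrt 3 / 2 + t"
  unfolding zeval_def prod.case zeta1_sq zeta1_cube zeta2_sq zeta2_cube by (simp_all add: zeta1_eq zeta2_eq)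

text \<open>The differences of real and of imaginary parts at the two embeddings are
  \<open>q * sqrt 3\<close> and \<open>r * sqrt 3\<close>. So bounds at both embeddings bound
  \<open>q\<close> and \<open>r\<close>, and then \<open>p\<close> and \<open>t\<close>.\<close>

lemma finite_zint_bounded: "finite {x. cmod (zeval zeta1 x) \<le> K \<and> cmod (zeval zeta2 x) \<le> K}"
proof -
  define I where "I = {- \<lceil>2 * K\<rceil>..\<lceil>2 * K\<rceil>}"
  have "x \<in> I \<times> I \<times> I \<times> I" if x: "cmod (zeval zeta1 x) \<le> K" "cmod (zeval zeta2 x) \<le> K" for x
  proof -
    obtain p q r t where X: "x = (p, q, r, t)" by (metis prod.exhaust)
    have b: "\<bar>Re (zeval zeta1 x)\<bar> \<le> K" "\<bar>Im (zeval zeta1 x)\<bar> \<le> K" "\<bar>Re (zeval zeta2 x)\<bar> \<le> K" "\<bar>Im (zeval zeta2 x)\<bar> \<le> K"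
      using x abs_Re_le_cmod[of "zeval zeta1 x"] abs_Im_le_cmod[of "zeval zeta1 x"]
        abs_Re_le_cmod[of "zeval zeta2 x"] abs_Im_le_cmod[of "zeval zeta2 x"] by linarith+
    have s: "\<bar>u\<bar> \<le> \<bar>u * sqrt 3\<bar>" for u :: real
      using mult_left_mono[of 1 "sqrt 3" "\<bar>u\<bar>"] by (simp add: abs_mult)
    have "\<bar>real_of_int q * sqrt 3\<bar> \<le> 2 * K" "\<bar>real_of_int r * sqrt 3\<bar> \<le> 2 * K"
      using b unfolding X zeval_parts by linarith+
    then have qr: "\<bar>real_of_int q\<bar> \<le> 2 * K" "\<bar>real_of_int r\<bar> \<le> 2 * K"
      using s[of "real_of_int q"] s[of "real_of_int r"] by (meson order_trans)+
    have pt: "\<bar>real_of_int p\<bar> \<le> 2 * K" "\<bar>real_of_int t\<bar> \<le> 2 * K"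
      using b qr unfolding X zeval_parts by linarith+
    have "i \<in> I" if "\<bar>real_of_int i\<bar> \<le> 2 * K" for i
      using that unfolding I_def by (auto simp: abs_le_iff) linarith+
    then show ?thesis using qr pt unfolding X by auto
  qed
  then have "{x. cmod (zeval zeta1 x) \<le> K \<and> cmod (zeval zeta2 x) \<le> K} \<subseteq> I \<times> I \<times> I \<times> I" by blast
  moreover have "finite (I \<times> I \<times> I \<times> I)" by (simp add: I_def)
  ultimately show ?thesis by (rule finite_subset)
qed

text \<open>At \<open>zeta1\<close> the first entry dominates the second; at \<open>zeta2\<close>
  the definite equation bounds both coordinates. The constant 3 is generous, since 4 sqrt 3 - 6 >
  0.9.\<close>

lemma finite_surf_group_bounded: "finite {f \<in> surf_group. cmod (fst f) \<le> K}"
proof -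
  define A where "A = {x. cmod (zeval zeta1 x) \<le> max K 3 \<and> cmod (zeval zeta2 x) \<le> max K 3}"
  have "f \<in> (\<lambda>(x, y). (zeval zeta1 x, zscale * zeval zeta1 y)) ` (A \<times> A)"
    if f: "f \<in> surf_group" "cmod (fst f) \<le> K" for f
  proof -
    obtain x y where fe: "f = (zeval zeta1 x, zscale * zeval zeta1 y)"
      and n: "(cmod (zeval zeta2 x))\<^sup>2 + (4 * sqrt 3 - 6) * (cmod (zeval zeta2 y))\<^sup>2 = 1"
      using surf_group_zint[OF f(1)] by blast
    have c: "4 * sqrt 3 - 6 > 0.9" using sqrt3_bounds by simp
    have n': "0.9 * (cmod (zeval zeta2 y))\<^sup>2 \<le> (4 * sqrt 3 - 6) * (cmod (zeval zeta2 y))\<^sup>2"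
      using c by (intro mult_right_mono) auto
    have "(cmod (zeval zeta2 x))\<^sup>2 \<le> 3\<^sup>2" "(cmod (zeval zeta2 y))\<^sup>2 \<le> 3\<^sup>2"
      using n n' zero_le_power2[of "cmod (zeval zeta2 x)"] zero_le_power2[of "cmod (zeval zeta2 y)"]
      by (simp_all, linarith+)
    then have 1: "cmod (zeval zeta2 x) \<le> 3" "cmod (zeval zeta2 y) \<le> 3"
      by (metis norm_ge_zero power2_le_imp_le zero_le_numeral)+
    have "(cmod (fst f))\<^sup>2 = (cmod (snd f))\<^sup>2 + 1" using surf_group_su11[OF f(1)] su11_cmod by blast
    then have "(cmod (snd f))\<^sup>2 \<le> (cmod (fst f))\<^sup>2" by simp
    then have "cmod (snd f) \<le> cmod (fst f)" by (rule power2_le_imp_le) simp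
    moreover have "cmod (snd f) = sinh_r * cmod (zeval zeta1 y)" using fe sinh_r_pos by (simp add: norm_mult)
    moreover have "1 * cmod (zeval zeta1 y) \<le> sinh_r * cmod (zeval zeta1 y)"
      by (intro mult_right_mono) (simp_all add: sinh_r_def)
    ultimately have "cmod (zeval zeta1 y) \<le> K" using f(2) by simp
    then have "x \<in> A" "y \<in> A" using 1 f(2) unfolding A_def by (auto simp: fe)
    then show ?thesis using fe by auto
  qed
  then have "{f \<in> surf_group. cmod (fst f) \<le> K} \<subseteq> (\<lambda>(x, y). (zeval zeta1 x, zscale * zeval zeta1 y)) ` (A \<times> A)"
    by blast
  then show ?thesis
    by (rule finite_subset) (simp add: A_def finite_zint_bounded)
qed

lemma sqrt3_irrational: assumes "real_of_int m + real_of_int n * sqrt 3 = 0" shows "n = 0"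
proof (rule ccontr)
  assume n: "n \<noteq> 0"
  have "real_of_int m = - (real_of_int n * sqrt 3)" using assms by linarith
  then have "(real_of_int m)\<^sup>2 = 3 * (real_of_int n)\<^sup>2" by (simp add: power_mult_distrib)
  then have "real_of_int (m\<^sup>2) = real_of_int (3 * n\<^sup>2)" by simp
  then have mn: "m\<^sup>2 = 3 * n\<^sup>2" unfolding of_int_eq_iff .
  then have m: "m \<noteq> 0" using n by auto
  have p: "prime_elem (3 :: int)" by (simp add: prime_imp_prime_elem)
  have "multiplicity 3 (m\<^sup>2) = 2 * multiplicity 3 m" using p m by (simp add: prime_elem_multiplicity_power_distrib)
  moreover have "multiplicity 3 (3 * n\<^sup>2) = Suc (2 * multiplicity 3 n)"
    using p n by (simp add: prime_elem_multiplicity_mult_distrib prime_elem_multiplicity_power_distrib)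
  ultimately have "2 * multiplicity 3 m = Suc (2 * multiplicity 3 n)" using mn by metis
  then show False by presburger
qed

text \<open>A trace \<plusminus>2 is rational, hence the same at \<open>zeta2\<close>. There the
  definite equation leaves room for no other coordinate: in a compact unitary group trace
  \<plusminus>2 forces \<plusminus>1.\<close>

lemma surf_group_not_parabolic:
  assumes "f \<in> surf_group" "\<bar>Re (fst f)\<bar> = 1"
  shows "f = (of_real (Re (fst f)), 0)"
proof -
  obtain x y where f: "f = (zeval zeta1 x, zscale * zeval zeta1 y)"
    and n: "(cmod (zeval zeta2 x))\<^sup>2 + (4 * sqrt 3 - 6) * (cmod (zeval zeta2 y))\<^sup>2 = 1"
    using surf_group_zint[OF assms(1)] by blast
  obtain p q r t where X: "x = (p, q, r, t)" by (metis prod.exhaust)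
  obtain p' q' r' t' where Y: "y = (p', q', r', t')" by (metis prod.exhaust)
  have c: "4 * sqrt 3 - 6 > 0" using sqrt3_bounds by simp
  obtain e :: int where e: "Re (fst f) = of_int e" "e\<^sup>2 = 1"
  proof -
    have "Re (fst f) = 1 \<or> Re (fst f) = -1" using assms(2) by linarith
    then show ?thesis using that[of 1] that[of "-1"] by auto
  qed
  have "real_of_int (2 * p + r - 2 * e) + real_of_int q * sqrt 3 = 0"
    using e(1) unfolding f fst_conv X zeval_parts by simp
  then have q: "q = 0" by (rule sqrt3_irrational)
  have "(Re (zeval zeta2 x))\<^sup>2 = 1"
    using e unfolding f fst_conv X zeval_parts q by (metis (no_types, lifting) add.right_neutral diff_zero div_0 mult_zero_left of_int_0 of_int_1 of_int_power)
  then have "(Im (zeval zeta2 x))\<^sup>2 + (4 * sqrt 3 - 6) * (cmod (zeval zeta2 y))\<^sup>2 = 0"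
    using n unfolding cmod_power2[of "zeval zeta2 x"] by linarith
  moreover have "0 \<le> (4 * sqrt 3 - 6) * (cmod (zeval zeta2 y))\<^sup>2" using c by simp
  ultimately have "(Im (zeval zeta2 x))\<^sup>2 = 0" "(4 * sqrt 3 - 6) * (cmod (zeval zeta2 y))\<^sup>2 = 0"
    using zero_le_power2[of "Im (zeval zeta2 x)"] by linarith+
  then have 0: "Im (zeval zeta2 x) = 0" "zeval zeta2 y = 0" using c by auto
  have "real_of_int (2 * t) + real_of_int (- r) * sqrt 3 = 0" using 0(1) unfolding X zeval_parts q by simp
  then have r: "r = 0" using sqrt3_irrational by fastforce
  have i: "Im (zeval zeta1 x) = 0" using 0(1) unfolding X zeval_parts q r by simp
  have y: "Re (zeval zeta2 y) = 0" "Im (zeval zeta2 y) = 0" using 0(2) by simp_all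
  have "real_of_int (2 * p' + r') + real_of_int (- q') * sqrt 3 = 0" using y(1) unfolding Y zeval_parts by simp
  then have q': "q' = 0" using sqrt3_irrational by fastforce
  have "real_of_int (q' + 2 * t') + real_of_int (- r') * sqrt 3 = 0" using y(2) unfolding Y zeval_parts by simp
  then have r': "r' = 0" using sqrt3_irrational by fastforce
  have "p' = 0" "t' = 0" using y unfolding Y zeval_parts q' r' by simp_all
  then have "zeval zeta1 y = 0" by (simp add: Y q' r' zeval_def)
  then show ?thesis using i by (simp add: f complex_eq_iff)
qed


section \<open>The tessellation by copies of the polygon\<close>

text \<open>Proper discontinuity. Multiplying \<open>su_act_lower_bound\<close> by tt z + |z|, the
  inverse of tt z - |z|, bounds the first entry of \<open>g\<close>.\<close>

lemma finite_surf_group_meets: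
  "finite {g \<in> surf_group. \<exists>z. cmod z \<le> r \<and> tt (su_act g z) \<le> K}"
proof -
  define B where "B = max 1 (K * (2 * \<bar>r\<bar> + 1))"
  have "cmod (fst g) \<le> B" if g: "g \<in> surf_group" "cmod z \<le> r" "tt (su_act g z) \<le> K" for g z
  proof -
    have t: "tt z \<le> 1 + cmod z" by (rule tt_le)
    have p: "0 < tt z - cmod z" using cmod_less_tt by simp
    have pr: "(tt z - cmod z) * (tt z + cmod z) = 1"
      using tt_sq[of z] by (simp add: power2_eq_square algebra_simps)
    have "(cmod (fst g))\<^sup>2 * (tt z - cmod z) \<le> ((cmod (fst g))\<^sup>2 + (cmod (snd g))\<^sup>2) * (tt z - cmod z)"
      using p by (intro mult_right_mono) auto
    also have "\<dots> \<le> K" using su_act_lower_bound[OF surf_group_su11[OF g(1)], of z] g(3) by linarith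
    finally have le: "(cmod (fst g))\<^sup>2 * (tt z - cmod z) \<le> K" .
    have K: "0 \<le> K" using tt_pos[of "su_act g z"] g(3) by linarith
    have "(cmod (fst g))\<^sup>2 = (cmod (fst g))\<^sup>2 * (tt z - cmod z) * (tt z + cmod z)"
      using pr by (simp add: mult.assoc)
    also have "\<dots> \<le> K * (tt z + cmod z)" using le tt_pos[of z] by (intro mult_right_mono) auto
    also have "\<dots> \<le> K * (2 * \<bar>r\<bar> + 1)" using K t g(2) by (intro mult_left_mono) linarith+
    also have "\<dots> \<le> B" by (simp add: B_def)
    finally have sq: "(cmod (fst g))\<^sup>2 \<le> B" .
    show ?thesis
    proof (rule ccontr)
      assume "\<not> cmod (fst g) \<le> B"
      then have "B < cmod (fst g)" "1 \<le> cmod (fst g)" by (auto simp: B_def)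
      then have "cmod (fst g) \<le> (cmod (fst g))\<^sup>2"
        using mult_left_mono[of 1 "cmod (fst g)" "cmod (fst g)"] by (simp add: power2_eq_square)
      then show False using sq \<open>B < cmod (fst g)\<close> by linarith
    qed
  qed
  then have "{g \<in> surf_group. \<exists>z. cmod z \<le> r \<and> tt (su_act g z) \<le> K} \<subseteq> {f \<in> surf_group. cmod (fst f) \<le> B}"
    by blast
  then show ?thesis using finite_surf_group_bounded by (rule finite_subset)
qed

section \<open>Descents, slides and landings\<close>

lemma su_act_step: "f \<in> surf_group \<Longrightarrow> su_act (gen k \<odot> f) z = su_act (gen k) (su_act f z)"
  by (rule su_act_mult[OF surf_group_su11])

text \<open>A relation between group elements and not between points of the orbit: a chain of steps
  thus determines the element, and freeness can be deduced from the shape of the chains.\<close>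

definition descent :: "complex \<Rightarrow> complex \<times> complex \<Rightarrow> complex \<times> complex \<Rightarrow> bool" where
  "descent z f g \<longleftrightarrow> (\<exists>k. wall k (su_act f z) > 0 \<and> g = gen k \<odot> f)"

definition slide :: "complex \<Rightarrow> complex \<times> complex \<Rightarrow> complex \<times> complex \<Rightarrow> bool" where
  "slide z f g \<longleftrightarrow> (\<exists>k. su_act f z \<in> polygon \<and> wall k (su_act f z) = 0 \<and> g = gen k \<odot> f)"

definition landing :: "complex \<Rightarrow> complex \<times> complex \<Rightarrow> (complex \<times> complex) set" where
  "landing z f = {g. (descent z)\<^sup>*\<^sup>* f g \<and> su_act g z \<in> polygon}"

text \<open>The number of group elements that bring \<open>z\<close> strictly lower; it is finite by
  proper discontinuity and turns descent of heights into induction over natural numbers.\<close>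

definition rank :: "complex \<Rightarrow> complex \<times> complex \<Rightarrow> nat" where
  "rank z f = card {g \<in> surf_group. tt (su_act g z) < tt (su_act f z)}"

lemma rank_less:
  assumes "g \<in> surf_group" "tt (su_act g z) < tt (su_act f z)"
  shows "rank z g < rank z f"
  unfolding rank_def
proof (rule psubset_card_mono)
  show "finite {g \<in> surf_group. tt (su_act g z) < tt (su_act f z)}"
    by (rule finite_subset[OF _ finite_surf_group_meets[of "cmod z" "tt (su_act f z)"]]) (use less_imp_le in blast)
  show "{h \<in> surf_group. tt (su_act h z) < tt (su_act g z)} \<subset> {h \<in> surf_group. tt (su_act h z) < tt (su_act f z)}"
    using assms by force
qed

lemma descent_in: "f \<in> surf_group \<Longrightarrow> descent z f g \<Longrightarrow> g \<in> surf_group"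
  by (auto simp: descent_def intro: surf_group_step)

lemma descent_height: "f \<in> surf_group \<Longrightarrow> descent z f g \<Longrightarrow> tt (su_act g z) < tt (su_act f z)"
  using sinh_r_pos by (auto simp: descent_def su_act_step tt_gen)

lemma descent_rank: "f \<in> surf_group \<Longrightarrow> descent z f g \<Longrightarrow> rank z g < rank z f"
  by (meson descent_height descent_in rank_less)

lemma descents_in: "(descent z)\<^sup>*\<^sup>* f g \<Longrightarrow> f \<in> surf_group \<Longrightarrow> g \<in> surf_group"
  by (induction rule: rtranclp_induct) (auto intro: descent_in)

lemma slides_in: "(slide z)\<^sup>*\<^sup>* f g \<Longrightarrow> f \<in> surf_group \<Longrightarrow> g \<in> surf_group"
  by (induction rule: rtranclp_induct) (auto simp: slide_def intro: surf_group_step)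

lemma polygon_gen_zero: "x \<in> polygon \<Longrightarrow> wall k x = 0 \<Longrightarrow> su_act (gen k) x \<in> polygon"
  by (simp add: polygon_def wall_gen_zero)

lemma slide_sym:
  assumes "f \<in> surf_group" "slide z f g"
  shows "slide z g f"
proof -
  obtain k where k: "su_act f z \<in> polygon" "wall k (su_act f z) = 0" "g = gen k \<odot> f"
    using assms(2) by (auto simp: slide_def)
  have "wall (partner k) (su_act g z) = 0" "su_act g z \<in> polygon"
    using k by (simp_all add: su_act_step[OF assms(1)] wall_gen_partner polygon_gen_zero)
  moreover have "f = gen (partner k) \<odot> g" by (simp add: k gen_partner_cancel)
  ultimately show ?thesis by (auto simp: slide_def)
qed

lemma slides_sym: "(slide z)\<^sup>*\<^sup>* f g \<Longrightarrow> f \<in> surf_group \<Longrightarrow> (slide z)\<^sup>*\<^sup>* g f"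
proof (induction rule: rtranclp_induct)
  case (step g h)
  then have "slide z h g" using slide_sym slides_in by blast
  then show ?case using step by (meson converse_rtranclp_into_rtranclp)
qed simp

lemma landing_polygon: "su_act f z \<in> polygon \<Longrightarrow> landing z f = {f}"
proof -
  assume f: "su_act f z \<in> polygon"
  then have "\<not> descent z f g" for g by (auto simp: descent_def polygon_def not_less)
  then have "(descent z)\<^sup>*\<^sup>* f g \<Longrightarrow> g = f" for g by (metis converse_rtranclpE)
  with f show ?thesis by (auto simp: landing_def)
qed

lemma landing_mono: "(descent z)\<^sup>*\<^sup>* f g \<Longrightarrow> landing z g \<subseteq> landing z f"
  by (auto simp: landing_def)

lemma landing_nonempty: "f \<in> surf_group \<Longrightarrow> landing z f \<noteq> {}"
proof (induction "rank z f" arbitrary: f rule: less_induct)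
  case less
  show ?case
  proof (cases "su_act f z \<in> polygon")
    case True
    then show ?thesis by (simp add: landing_polygon)
  next
    case False
    then obtain k where "wall k (su_act f z) > 0" by (auto simp: polygon_def not_le)
    then have d: "descent z f (gen k \<odot> f)" by (auto simp: descent_def)
    then have "landing z (gen k \<odot> f) \<noteq> {}"
      using less descent_in descent_rank by blast
    then show ?thesis using landing_mono[of z f "gen k \<odot> f"] d by blast
  qed
qed

text \<open>The twelve copies of the polygon around a vertex: \<open>u (j + 1)\<close> follows \<open>u j\<close> in cyclic order.\<close>

lemma vertex_frame:
  assumes "f \<in> surf_group"
  obtains u where "u i = f" "\<And>j. u j \<in> surf_group" "\<And>j. u (j + 1) = gen (kap j) \<odot> u j"
    "\<And>j k. j mod 12 = k mod 12 \<Longrightarrow> u j = u k"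
proof -
  define u where "u = (\<lambda>j. vertex_elem j \<odot> (su_inv (vertex_elem i) \<odot> f))"
  have "u i = f"
    by (simp add: u_def su_mult_assoc[symmetric] su_inv_right surf_group_su11 vertex_elem_in_surf_group)
  moreover have "u j \<in> surf_group" for j
    by (simp add: u_def surf_group_mult surf_group_inv vertex_elem_in_surf_group assms)
  moreover have "u (j + 1) = gen (kap j) \<odot> u j" for j
    by (simp add: u_def vertex_elem_Suc su_mult_assoc)
  moreover have "u j = u k" if "j mod 12 = k mod 12" for j k
    using vertex_elem_mod[OF that] by (simp add: u_def)
  ultimately show thesis by (rule that)
qed

text \<open>The \<open>u j\<close> are the successive copies around one vertex, and
  \<open>L j\<close> is the wall value of \<open>z\<close>, seen from \<open>u j\<close>, at the
  side that leads to \<open>u (j + 1)\<close>.\<close>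

context
  fixes u :: "int \<Rightarrow> complex \<times> complex" and z :: complex and L :: "int \<Rightarrow> real"
  assumes u_in: "\<And>j. u j \<in> surf_group" and u_Suc: "\<And>j. u (j + 1) = gen (kap j) \<odot> u j"
    and u_mod: "\<And>j k. j mod 12 = k mod 12 \<Longrightarrow> u j = u k"
  defines "L \<equiv> \<lambda>j. wall (kap j) (su_act (u j) z)"
begin

lemma frame_kap: "kap j - 1 = partner (kap (j - 1))"
  using kap_Suc[of "j - 1"] by simp

lemma frame_pred: "u (j - 1) = gen (kap j - 1) \<odot> u j"
  using u_Suc[of "j - 1"] by (simp add: frame_kap gen_partner_cancel)

lemma frame_wall_pred: "wall (kap j - 1) (su_act (u j) z) = - L (j - 1)"
proof -
  have "u j = gen (kap (j - 1)) \<odot> u (j - 1)" using u_Suc[of "j - 1"] by simp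
  then have "su_act (u j) z = su_act (gen (kap (j - 1))) (su_act (u (j - 1)) z)"
    using su_act_step[OF u_in[of "j - 1"]] by simp
  then show ?thesis unfolding frame_kap L_def by (simp add: wall_gen_partner)
qed

text \<open>From one copy to the next the side through the vertex turns by pi/6. So \<open>L\<close>
  is a discrete sinusoid: L (j + 1) + L (j - 1) = 2 cos (pi/6) L j, with half period 6.\<close>

lemma frame_recurrence: "L (j + 1) = sqrt 3 * L j - L (j - 1)"
proof -
  have "L (j + 1) = wall (partner (kap j) + 1) (su_act (gen (kap j)) (su_act (u j) z))"
    unfolding L_def kap_Suc u_Suc su_act_step[OF u_in] ..
  also have "\<dots> = wall (kap j - 1) (su_act (u j) z) + sqrt 3 * wall (kap j) (su_act (u j) z)"
    by (rule wall_gen_partner_Suc)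
  finally show ?thesis unfolding frame_wall_pred by (simp add: L_def)
qed

lemma frame_values:
  "L (j + 2) = sqrt 3 * L (j + 1) - L j" "L (j + 3) = 2 * L (j + 1) - sqrt 3 * L j"
  "L (j + 4) = sqrt 3 * L (j + 1) - 2 * L j" "L (j + 5) = L (j + 1) - sqrt 3 * L j" "L (j + 6) = - L j"
proof -
  have s: "sqrt 3 * (sqrt 3 * x) = 3 * x" for x :: real by (simp add: mult.assoc[symmetric])
  show 2: "L (j + 2) = sqrt 3 * L (j + 1) - L j" using frame_recurrence[of "j + 1"] by (simp add: algebra_simps)
  show 3: "L (j + 3) = 2 * L (j + 1) - sqrt 3 * L j"
    using frame_recurrence[of "j + 2"] 2 by (simp add: algebra_simps s)
  show 4: "L (j + 4) = sqrt 3 * L (j + 1) - 2 * L j"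
    using frame_recurrence[of "j + 3"] 2 3 by (simp add: algebra_simps s)
  show 5: "L (j + 5) = L (j + 1) - sqrt 3 * L j"
    using frame_recurrence[of "j + 4"] 3 4 by (simp add: algebra_simps s)
  show 6: "L (j + 6) = - L j"
    using frame_recurrence[of "j + 5"] 4 5 by (simp add: algebra_simps s)
qed

lemma frame_forward: "(\<And>m. m < n \<Longrightarrow> L (i + int m) > 0) \<Longrightarrow> (descent z)\<^sup>*\<^sup>* (u i) (u (i + int n))"
proof (induction n)
  case (Suc n)
  have "descent z (u (i + int n)) (u (i + int n + 1))"
    using Suc.prems[of n] u_Suc[of "i + int n"] by (auto simp: descent_def L_def)
  moreover have "i + int (Suc n) = i + int n + 1" by simp
  ultimately show ?case using Suc by (metis less_Suc_eq rtranclp.simps)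
qed simp

lemma frame_backward: "(\<And>m. m < n \<Longrightarrow> L (i - int m - 1) < 0) \<Longrightarrow> (descent z)\<^sup>*\<^sup>* (u i) (u (i - int n))"
proof (induction n)
  case (Suc n)
  have "descent z (u (i - int n)) (u (i - int n - 1))"
    using Suc.prems[of n] frame_pred[of "i - int n"] frame_wall_pred[of "i - int n"]
    unfolding descent_def by (intro exI[of _ "kap (i - int n) - 1"]) simp
  moreover have "i - int (Suc n) = i - int n - 1" by simp
  ultimately show ?case using Suc by (metis less_Suc_eq rtranclp.simps)
qed simp

lemma less_6_cases: "m < 6 \<Longrightarrow> m = 0 \<or> m = 1 \<or> m = 2 \<or> m = 3 \<or> m = 4 \<or> m = (5::nat)"
  by linarith

text \<open>A sinusoid of half period 6 stays positive for six steps after a sign change. If it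
  starts at a zero \<open>L j\<close>, then \<open>L (j + 6) = - L j\<close> vanishes as well, which
  leaves five.\<close>

lemma frame_positive:
  assumes "L (j + 1) > 0" "L j < 0 \<or> L j = 0 \<and> n \<le> 5" "n \<le> 6" "m < n"
  shows "L (j + 1 + int m) > 0"
proof -
  have "- L j \<ge> 0" using assms by auto
  moreover from this have "sqrt 3 * (- L j) \<ge> 0" by (intro mult_nonneg_nonneg) simp_all
  ultimately have x: "- L j \<ge> 0" "sqrt 3 * L (j + 1) > 0" "sqrt 3 * (- L j) \<ge> 0" using assms by auto
  have y: "m = 5 \<Longrightarrow> L j < 0" using assms by auto
  have v: "L (j + 2) > 0" "L (j + 3) > 0" "L (j + 4) > 0" "L (j + 5) > 0"
    unfolding frame_values using x assms(1) by linarith+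
  have "m < 6" using assms by simp
  then consider "m = 0" | "m = 1" | "m = 2" | "m = 3" | "m = 4" | "m = 5" using less_6_cases by blast
  then show ?thesis
    by cases (use v y assms(1) frame_values(5)[of j] in \<open>simp_all add: add.assoc\<close>)
qed

text \<open>Both neighbours of \<open>u i\<close> are lower. Going around the vertex either way is a
  descent up to the opposite copy, and \<open>u (i + 6)\<close> is \<open>u (i - 6)\<close>.\<close>

lemma frame_confluence:
  assumes "L i > 0" "L (i - 1) < 0"
  shows "(descent z)\<^sup>*\<^sup>* (u (i + 1)) (u (i + 6))" "(descent z)\<^sup>*\<^sup>* (u (i - 1)) (u (i + 6))"
proof -
  have pos: "L (i + int m) > 0" if "m < 6" for m
    using frame_positive[of "i - 1" 6 m] assms that by simp
  have "(descent z)\<^sup>*\<^sup>* (u (i + 1)) (u (i + 1 + int 5))"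
  proof (rule frame_forward)
    fix m :: nat assume "m < 5"
    then show "L (i + 1 + int m) > 0" using pos[of "Suc m"] by (simp add: add.assoc add.commute add.left_commute)
  qed
  then show "(descent z)\<^sup>*\<^sup>* (u (i + 1)) (u (i + 6))" by (simp add: add.assoc)
  have "(descent z)\<^sup>*\<^sup>* (u (i - 1)) (u (i - 1 - int 5))"
  proof (rule frame_backward)
    fix m :: nat assume m: "m < 5"
    have "L (i - 1 - int m - 1) = - L (i - 1 - int m - 1 + 6)" by (simp only: frame_values(5) minus_minus)
    also have "i - 1 - int m - 1 + 6 = i + int (4 - m)" using m by simp
    finally show "L (i - 1 - int m - 1) < 0" using pos[of "4 - m"] by simp
  qed
  moreover have "u (i - 1 - int 5) = u (i + 6)" using mod_add_self2[of "i - 1 - int 5" 12] by (intro u_mod) (simp add: algebra_simps)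
  ultimately show "(descent z)\<^sup>*\<^sup>* (u (i - 1)) (u (i + 6))" by simp
qed

text \<open>The point lies on the wall between \<open>u i\<close> and \<open>u (i + 1)\<close>, so
  both are equally high. Descents around the vertex in opposite directions end at
  \<open>u (i - 5) = u (i + 7)\<close> and \<open>u (i + 6)\<close>, which are again separated by a
  wall through the point, but lower.\<close>

lemma frame_flat:
  assumes "L i = 0" "L (i - 1) < 0"
  shows "(descent z)\<^sup>*\<^sup>* (u (i + 1)) (u (i + 6))" "(descent z)\<^sup>*\<^sup>* (u i) (gen (kap (i + 6)) \<odot> u (i + 6))"
    "L (i + 6) = 0" "tt (su_act (u (i + 6)) z) < tt (su_act (u i) z)"
proof -
  have p1: "L (i + 1) > 0" using frame_recurrence[of i] assms by simp
  have pos: "L (i + 1 + int m) > 0" if "m < 5" for m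
    using frame_positive[of i 5 m] assms that p1 by simp
  have "(descent z)\<^sup>*\<^sup>* (u (i + 1)) (u (i + 1 + int 5))"
    by (rule frame_forward) (rule pos)
  then show *: "(descent z)\<^sup>*\<^sup>* (u (i + 1)) (u (i + 6))" by (simp add: add.assoc)
  have "(descent z)\<^sup>*\<^sup>* (u i) (u (i - int 5))"
  proof (rule frame_backward)
    fix m :: nat assume m: "m < 5"
    have "L (i - int m - 1) = - L (i - int m - 1 + 6)" by (simp only: frame_values(5) minus_minus)
    also have "i - int m - 1 + 6 = i + 1 + int (4 - m)" using m by simp
    finally show "L (i - int m - 1) < 0" using pos[of "4 - m"] by simp
  qed
  moreover have "u (i - int 5) = u (i + 6 + 1)" using mod_add_self2[of "i - int 5" 12] by (intro u_mod) (simp add: algebra_simps)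
  ultimately show "(descent z)\<^sup>*\<^sup>* (u i) (gen (kap (i + 6)) \<odot> u (i + 6))" by (simp only: u_Suc)
  show "L (i + 6) = 0" using frame_values(5)[of i] assms by simp
  have flat: "tt (su_act (u (i + 1)) z) = tt (su_act (u i) z)"
    using assms(1) by (simp add: L_def u_Suc su_act_step[OF u_in] tt_gen)
  have d: "descent z (u (i + 1)) (u (i + 1 + 1))" using p1 unfolding descent_def L_def u_Suc by blast
  have "(descent z)\<^sup>*\<^sup>* (u (i + 1 + 1)) (u (i + 1 + 1 + int 4))"
  proof (rule frame_forward)
    fix m :: nat assume "m < 4"
    then show "L (i + 1 + 1 + int m) > 0" using pos[of "Suc m"] by (simp add: add.assoc add.commute add.left_commute)
  qed
  then have "tt (su_act (u (i + 1 + 1 + int 4)) z) \<le> tt (su_act (u (i + 1 + 1)) z)"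
    using u_in[of "i + 1 + 1"]
  proof (induction rule: rtranclp_induct)
    case (step a b)
    then show ?case using descent_height[OF descents_in] by fastforce
  qed simp
  then show "tt (su_act (u (i + 6)) z) < tt (su_act (u i) z)"
    using descent_height[OF u_in d] flat by (simp add: add.assoc)
qed

end

section \<open>Confluence\<close>

lemma local_confluence_adjacent:
  assumes f: "f \<in> surf_group" and w: "wall j (su_act f z) > 0" "wall k (su_act f z) > 0" and jk: "(j - k) mod 12 = 1"
  shows "\<exists>c\<in>surf_group. (descent z)\<^sup>*\<^sup>* (gen j \<odot> f) c \<and> (descent z)\<^sup>*\<^sup>* (gen k \<odot> f) c"
proof -
  \<comment> \<open>As \<open>kap\<close> is an involution, this is the position of side
    \<open>j\<close> in the vertex cycle; the frame is then centred at the vertex common to sides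
    \<open>k\<close> and \<open>j\<close>.\<close>
  define i where "i = kap j"
  have i: "kap i = j" by (simp add: i_def kap_kap)
  have k: "(kap i - 1) mod 12 = k mod 12" unfolding i using jk by (rule mod_12_diff_1)
  obtain u where u: "u i = f" "\<And>j. u j \<in> surf_group" "\<And>j. u (j + 1) = gen (kap j) \<odot> u j"
    "\<And>j k. j mod 12 = k mod 12 \<Longrightarrow> u j = u k" using vertex_frame[OF f] by blast
  note fr = frame_pred[where u=u, OF u(2,3,4)] frame_wall_pred[where u=u and z=z, OF u(2,3,4)] frame_confluence[where u=u and z=z and i=i, OF u(2,3,4)]
  have 1: "u (i + 1) = gen j \<odot> f" "u (i - 1) = gen k \<odot> f"
    using u(3)[of i] fr(1)[of i] gen_mod[OF k] by (simp_all add: u(1) i)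
  have "wall (kap (i - 1)) (su_act (u (i - 1)) z) < 0"
    using fr(2)[of i] w(2) wall_mod[OF k] by (simp add: u(1))
  then show ?thesis using fr(3,4) w(1) u(2)[of "i + 6"] by (auto simp: u(1) i 1)
qed

lemma local_confluence:
  assumes f: "f \<in> surf_group" and w: "wall j (su_act f z) > 0" "wall k (su_act f z) > 0"
  shows "\<exists>c\<in>surf_group. (descent z)\<^sup>*\<^sup>* (gen j \<odot> f) c \<and> (descent z)\<^sup>*\<^sup>* (gen k \<odot> f) c"
proof -
  have "(j - k) mod 12 \<in> {0, 1, 11}" using w by (intro adjacent_walls[where x="su_act f z"]) auto
  then consider "(j - k) mod 12 = 0" | "(j - k) mod 12 = 1" | "(j - k) mod 12 = 11" by auto
  then show ?thesis
  proof cases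
    case 1
    then have "j mod 12 = k mod 12" by (rule mod_12_diff_0)
    then have "gen j = gen k" by (rule gen_mod)
    then show ?thesis using surf_group_step[OF f] by auto
  next
    case 2
    then show ?thesis using local_confluence_adjacent f w by blast
  next
    case 3
    then have "(k - j) mod 12 = 1" by (rule mod_12_diff_11)
    then show ?thesis using local_confluence_adjacent[OF f w(2,1)] by blast
  qed
qed

text \<open>Newman's argument by induction on \<open>rank\<close>. Landings are compared only up to
  slides, since a point on a side has several representatives in the polygon.\<close>

lemma landing_unique:
  "f \<in> surf_group \<Longrightarrow> g \<in> landing z f \<Longrightarrow> h \<in> landing z f \<Longrightarrow> (slide z)\<^sup>*\<^sup>* g h"
proof (induction "rank z f" arbitrary: f g h rule: less_induct)
  case less
  show ?case
  proof (cases "su_act f z \<in> polygon")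
    case True
    then show ?thesis using less.prems by (simp add: landing_polygon)
  next
    case False
    have "\<exists>k. wall k (su_act f z) > 0 \<and> g \<in> landing z (gen k \<odot> f)" if "g \<in> landing z f" for g
    proof -
      have "(descent z)\<^sup>*\<^sup>* f g" "g \<noteq> f" using that False by (auto simp: landing_def)
      then obtain f1 where "descent z f f1" "(descent z)\<^sup>*\<^sup>* f1 g" by (metis converse_rtranclpE)
      then show ?thesis using that by (auto simp: landing_def descent_def)
    qed
    then obtain j k where j: "wall j (su_act f z) > 0" "g \<in> landing z (gen j \<odot> f)"
      and k: "wall k (su_act f z) > 0" "h \<in> landing z (gen k \<odot> f)" using less.prems by metis
    obtain c where c: "c \<in> surf_group" "(descent z)\<^sup>*\<^sup>* (gen j \<odot> f) c" "(descent z)\<^sup>*\<^sup>* (gen k \<odot> f) c"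
      using local_confluence[OF less.prems(1) j(1) k(1)] by blast
    obtain n where n: "n \<in> landing z c" using landing_nonempty[OF c(1)] by blast
    have d: "descent z f (gen j \<odot> f)" "descent z f (gen k \<odot> f)" using j k by (auto simp: descent_def)
    have "(slide z)\<^sup>*\<^sup>* g n" "(slide z)\<^sup>*\<^sup>* n h"
      using less.hyps[OF descent_rank[OF less.prems(1) d(1)]] less.hyps[OF descent_rank[OF less.prems(1) d(2)]]
        surf_group_step[OF less.prems(1)] n landing_mono[OF c(2)] landing_mono[OF c(3)] j k by blast+
    then show ?thesis by simp
  qed
qed

lemma flat_confluence:
  assumes f: "f \<in> surf_group" and w: "wall k (su_act f z) = 0" "wall j (su_act f z) > 0" and jk: "(k - j) mod 12 = 1"
  shows "\<exists>c\<in>surf_group. \<exists>m. (descent z)\<^sup>*\<^sup>* (gen k \<odot> f) c \<and> (descent z)\<^sup>*\<^sup>* f (gen m \<odot> c) \<and>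
    wall m (su_act c z) = 0 \<and> rank z c < rank z f"
proof -
  define i where "i = kap k"
  have i: "kap i = k" by (simp add: i_def kap_kap)
  have k: "(kap i - 1) mod 12 = j mod 12" unfolding i using jk by (rule mod_12_diff_1)
  obtain u where u: "u i = f" "\<And>j. u j \<in> surf_group" "\<And>j. u (j + 1) = gen (kap j) \<odot> u j"
    "\<And>j k. j mod 12 = k mod 12 \<Longrightarrow> u j = u k" using vertex_frame[OF f] by blast
  have 1: "u (i + 1) = gen k \<odot> f" using u(3)[of i] by (simp add: u(1) i)
  have L: "wall (kap i) (su_act (u i) z) = 0" using w(1) by (simp add: u(1) i)
  have L1: "wall (kap (i - 1)) (su_act (u (i - 1)) z) < 0"
    using frame_wall_pred[where u=u and z=z and j=i, OF u(2,3,4)] w(2) wall_mod[OF k] by (simp add: u(1))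
  note fr = frame_flat[where u=u and z=z and i=i, OF u(2,3,4) L L1]
  show ?thesis
    using fr rank_less[OF u(2) fr(4)] u(2)[of "i + 6"] unfolding u(1) 1 by blast
qed

text \<open>A flat crossing does not change the rank, so the uniqueness of landings says nothing
  about it. Circling the vertex towards a wall that does separate trades it for a flat crossing at
  an element of lower rank.\<close>

lemma landing_flat:
  "f \<in> surf_group \<Longrightarrow> wall k (su_act f z) = 0 \<Longrightarrow> g \<in> landing z f \<Longrightarrow> h \<in> landing z (gen k \<odot> f) \<Longrightarrow>
   (slide z)\<^sup>*\<^sup>* g h"
proof (induction "rank z f" arbitrary: f g h k rule: less_induct)
  case less
  note f = less.prems(1)
  define f2 where "f2 = gen k \<odot> f"
  have f2: "f2 \<in> surf_group" unfolding f2_def by (rule surf_group_step[OF f])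
  have a2: "su_act f2 z = su_act (gen k) (su_act f z)" unfolding f2_def by (rule su_act_step[OF f])
  show ?case
  proof (cases "su_act f z \<in> polygon")
    case True
    then have "su_act f2 z \<in> polygon" unfolding a2 using less.prems(2) by (rule polygon_gen_zero)
    then have "g = f" "h = f2" using less.prems True by (simp_all add: landing_polygon f2_def[symmetric])
    then have "slide z g h" using True less.prems(2) by (auto simp: slide_def f2_def)
    then show ?thesis by simp
  next
    case False
    then obtain j where j: "wall j (su_act f z) > 0" by (auto simp: polygon_def not_le)
    have "(j - k) mod 12 \<in> {0, 1, 11}" using j less.prems(2) by (intro adjacent_walls[where x="su_act f z"]) auto
    moreover have "(j - k) mod 12 \<noteq> 0"
    proof
      assume "(j - k) mod 12 = 0"
      then have "j mod 12 = k mod 12" by (rule mod_12_diff_0)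
      then show False using j less.prems(2) wall_mod[of j k] by simp
    qed
    ultimately consider "(j - k) mod 12 = 11" | "(j - k) mod 12 = 1" by auto
    then show ?thesis
    proof cases
      case 1
      then have "(k - j) mod 12 = 1" by (rule mod_12_diff_11)
      then obtain c m where c: "c \<in> surf_group" "(descent z)\<^sup>*\<^sup>* f2 c" "(descent z)\<^sup>*\<^sup>* f (gen m \<odot> c)"
        "wall m (su_act c z) = 0" "rank z c < rank z f"
        using flat_confluence[OF f less.prems(2) j] unfolding f2_def by blast
      obtain n1 n2 where n: "n1 \<in> landing z c" "n2 \<in> landing z (gen m \<odot> c)"
        using landing_nonempty[OF c(1)] landing_nonempty[OF surf_group_step[OF c(1)]] by blast
      have "(slide z)\<^sup>*\<^sup>* n1 n2" using less.hyps c n by blast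
      moreover have "(descent z)\<^sup>*\<^sup>* c n1" using n(1) by (simp add: landing_def)
      ultimately have "(slide z)\<^sup>*\<^sup>* n2 n1" using slides_sym descents_in[OF _ c(1)] by blast
      moreover have "(slide z)\<^sup>*\<^sup>* g n2" using landing_unique[OF f] less.prems(3) n(2) landing_mono[OF c(3)] by blast
      moreover have "(slide z)\<^sup>*\<^sup>* n1 h"
        using landing_unique[OF f2] less.prems(4) n(1) landing_mono[OF c(2)] unfolding f2_def by blast
      ultimately show ?thesis by simp
    next
      case 2
      \<comment> \<open>Seen from \<open>f2\<close>, the positive wall \<open>j\<close> has index
        \<open>k + partner k - j\<close> and lies on the other side of the flat one. This is the
        first case with the roles of \<open>f\<close> and \<open>f2\<close> exchanged.\<close>
      have w: "wall (partner k) (su_act f2 z) = 0" unfolding a2 by (simp add: wall_gen_partner less.prems(2))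
      have w1: "wall (k + partner k - j) (su_act f2 z) > 0"
        unfolding a2 wall_gen_zero[OF less.prems(2)] using j by simp
      have "(partner k - (k + partner k - j)) mod 12 = 1" using 2 by simp
      from flat_confluence[OF f2 w w1 this]
      obtain c m where c: "c \<in> surf_group" "(descent z)\<^sup>*\<^sup>* f c" "(descent z)\<^sup>*\<^sup>* f2 (gen m \<odot> c)"
        "wall m (su_act c z) = 0" "rank z c < rank z f2"
        unfolding f2_def gen_partner_cancel by blast
      have "rank z f2 = rank z f" by (simp add: rank_def a2 tt_gen less.prems(2))
      then have r: "rank z c < rank z f" using c(5) by simp
      obtain n1 n2 where n: "n1 \<in> landing z c" "n2 \<in> landing z (gen m \<odot> c)"
        using landing_nonempty[OF c(1)] landing_nonempty[OF surf_group_step[OF c(1)]] by blast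
      have "(slide z)\<^sup>*\<^sup>* n1 n2" using less.hyps[OF r] c n by blast
      moreover have "(slide z)\<^sup>*\<^sup>* g n1" using landing_unique[OF f] less.prems(3) n(1) landing_mono[OF c(2)] by blast
      moreover have "(slide z)\<^sup>*\<^sup>* n2 h"
        using landing_unique[OF f2] less.prems(4) n(2) landing_mono[OF c(3)] unfolding f2_def by blast
      ultimately show ?thesis by simp
    qed
  qed
qed

text \<open>Induction over words in the generators. Each new letter is a descent, a flat crossing or
  the reverse of a descent, and none of these changes the class of the landings under
  slides.\<close>

lemma slides_from_one:
  assumes "z \<in> polygon"
  shows "f \<in> surf_group \<Longrightarrow> g \<in> landing z f \<Longrightarrow> (slide z)\<^sup>*\<^sup>* su_one g"
proof (induction arbitrary: g rule: surf_group.induct)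
  case surf_group_one
  then show ?case using assms landing_polygon[of su_one z] by simp
next
  case (surf_group_step f k)
  obtain n where n: "n \<in> landing z f" using landing_nonempty surf_group_step by blast
  have 1: "(slide z)\<^sup>*\<^sup>* su_one n" using surf_group_step n by blast
  have in2: "gen k \<odot> f \<in> surf_group" using surf_group_step by (simp add: surf_group.surf_group_step)
  have a: "su_act (gen k \<odot> f) z = su_act (gen k) (su_act f z)" using surf_group_step su_act_step by blast
  consider "wall k (su_act f z) > 0" | "wall k (su_act f z) = 0" | "wall k (su_act f z) < 0" by linarith
  then show ?case
  proof cases
    case 1
    then have "descent z f (gen k \<odot> f)" by (auto simp: descent_def)
    then have "g \<in> landing z f" using landing_mono[of z f "gen k \<odot> f"] surf_group_step by blast
    then show ?thesis using surf_group_step by blast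
  next
    case 2
    then have "(slide z)\<^sup>*\<^sup>* n g" using landing_flat surf_group_step n by blast
    then show ?thesis using 1 by simp
  next
    case 3
    have "descent z (gen k \<odot> f) f"
      unfolding descent_def a using 3 by (intro exI[of _ "partner k"]) (simp add: wall_gen_partner gen_partner_cancel)
    then have "n \<in> landing z (gen k \<odot> f)" using landing_mono[of z "gen k \<odot> f" f] n by blast
    then have "(slide z)\<^sup>*\<^sup>* n g" using landing_unique[OF in2] surf_group_step by blast
    then show ?thesis using 1 by simp
  qed
qed

lemma polygon_slides:
  assumes "z \<in> polygon" "f \<in> surf_group" "su_act f z \<in> polygon"
  shows "(slide z)\<^sup>*\<^sup>* su_one f"
  using slides_from_one[OF assms(1,2)] landing_polygon[OF assms(3)] by blast

lemma polygon_covers: "\<exists>f\<in>surf_group. su_act f z \<in> polygon"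
proof -
  obtain g where "g \<in> landing z su_one" using landing_nonempty surf_group_one by blast
  then have "(descent z)\<^sup>*\<^sup>* su_one g" "su_act g z \<in> polygon" by (simp_all add: landing_def)
  then show ?thesis using descents_in surf_group_one by blast
qed

section \<open>Freeness of the action\<close>

lemma mod_12_middle:
  fixes d :: int
  assumes "d mod 12 \<in> {0, 1, 11}" "(d - 1) mod 12 \<in> {0, 1, 11}" "(d + 1) mod 12 \<in> {0, 1, 11}"
  shows "d mod 12 = 0"
proof -
  have "d mod 12 = 1 \<Longrightarrow> (d + 1) mod 12 = 2" "d mod 12 = 11 \<Longrightarrow> (d - 1) mod 12 = 10"
    using int_mod_add[of d 12 1 1] int_mod_add[of d 12 11 "-1"] by auto
  with assms show ?thesis by auto
qed

text \<open>Slides join \<open>su_one\<close> to \<open>f\<close>. At a vertex they move along the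
  frame of twelve copies, and the sides through \<open>z\<close> identify the copy. Elsewhere at
  most one side passes through the point, so slides can only cross it and come back.\<close>

lemma free_on_polygon:
  assumes z: "z \<in> polygon" and f: "f \<in> surf_group" and fz: "su_act f z = z"
  shows "f = su_one"
proof -
  have sl: "(slide z)\<^sup>*\<^sup>* su_one f" using polygon_slides z f fz by simp
  show ?thesis
  proof (cases "\<exists>i. wall (kap i) z = 0 \<and> wall (kap i - 1) z = 0")
    case True
    then obtain i where i: "wall (kap i) z = 0" "wall (kap i - 1) z = 0" by blast
    obtain u where u: "u i = su_one" "\<And>j. u j \<in> surf_group" "\<And>j. u (j + 1) = gen (kap j) \<odot> u j"
      "\<And>j k. j mod 12 = k mod 12 \<Longrightarrow> u j = u k" using vertex_frame[OF surf_group_one] by blast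
    define L where "L = (\<lambda>j. wall (kap j) (su_act (u j) z))"
    have wp: "wall (kap j - 1) (su_act (u j) z) = - L (j - 1)" for j
      unfolding L_def by (rule frame_wall_pred[where u=u and z=z and j=j, OF u(2,3,4)])
    have rec: "L (j + 1) = sqrt 3 * L j - L (j - 1)" for j
      unfolding L_def by (rule frame_recurrence[where u=u and z=z and j=j, OF u(2,3,4)])
    have pred: "u (j - 1) = gen (kap j - 1) \<odot> u j" for j
      by (rule frame_pred[where u=u and j=j, OF u(2,3,4)])
    from sl have "\<exists>j. f = u j \<and> L j = 0 \<and> L (j - 1) = 0"
    proof (induction rule: rtranclp_induct)
      case base
      show ?case using i wp[of i] by (intro exI[of _ i]) (simp add: L_def u(1))
    next
      case (step g h)
      then obtain j k where j: "g = u j" "L j = 0" "L (j - 1) = 0"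
        and k: "wall k (su_act (u j) z) = 0" "h = gen k \<odot> u j" by (auto simp: slide_def)
      have "(k - kap j) mod 12 \<in> {0, 1, 11}"
        using k j by (intro adjacent_walls[where x="su_act (u j) z"]) (auto simp: L_def)
      moreover have "(k - (kap j - 1)) mod 12 \<in> {0, 1, 11}"
        using k j wp[of j] by (intro adjacent_walls[where x="su_act (u j) z"]) auto
      ultimately have "(k - kap j) mod 12 = 0 \<or> (k - (kap j - 1)) mod 12 = 0" 
        using int_mod_add[of "k - kap j" 12 1 1] int_mod_add[of "k - kap j" 12 11 1] by (auto simp: algebra_simps)
      then show ?case
      proof
        assume "(k - kap j) mod 12 = 0"
        then have "k mod 12 = kap j mod 12" by (rule mod_12_diff_0)
        then have "gen k = gen (kap j)" by (rule gen_mod)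
        then have "h = u (j + 1)" using k by (simp add: u(3))
        then show ?thesis using rec[of j] j by (intro exI[of _ "j + 1"]) simp
      next
        assume "(k - (kap j - 1)) mod 12 = 0"
        then have "k mod 12 = (kap j - 1) mod 12" by (rule mod_12_diff_0)
        then have "gen k = gen (kap j - 1)" by (rule gen_mod)
        then have "h = u (j - 1)" using k by (simp add: pred)
        then show ?thesis using rec[of "j - 1"] j by (intro exI[of _ "j - 1"]) simp
      qed
    qed
    then obtain j where j: "f = u j" "L j = 0" "L (j - 1) = 0" by blast
    have wj: "wall (kap j) z = 0" "wall (kap j - 1) z = 0" using j wp[of j] fz by (simp_all add: L_def)
    \<comment> \<open>Both pairs of consecutive sides, one from \<open>su_one\<close> and one from
      \<open>f\<close>, pass through \<open>z\<close>. As walls through \<open>z\<close> are at most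
      one index apart, the pairs coincide.\<close>
    have "(kap j - kap i) mod 12 \<in> {0, 1, 11}" "(kap j - 1 - kap i) mod 12 \<in> {0, 1, 11}"
      "(kap j - (kap i - 1)) mod 12 \<in> {0, 1, 11}" 
      by (rule adjacent_walls[where x=z]; simp only: i wj)+
    then have "(kap j - kap i) mod 12 = 0"
      by (intro mod_12_middle) (simp_all only: algebra_simps)
    then have "kap j mod 12 = kap i mod 12" by (rule mod_12_diff_0)
    then have "u j = u i" using kap_mod_iff u(4) by blast
    then show ?thesis using j u(1) by simp
  next
    case False
    have nv: "(j - k) mod 12 = 0" if "wall j z = 0" "wall k z = 0" for j k
    proof -
      have 1: "(j - k) mod 12 \<noteq> 1" if jk: "wall j z = 0" "wall k z = 0" for j k
      proof
        assume "(j - k) mod 12 = 1"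
        then have "(j - 1) mod 12 = k mod 12" by (rule mod_12_diff_1)
        then have "wall (j - 1) z = 0" using jk wall_mod by metis
        then show False using False jk(1) kap_kap by metis
      qed
      have "(j - k) mod 12 \<in> {0, 1, 11}" using that by (intro adjacent_walls[where x=z]) auto
      moreover have "(j - k) mod 12 \<noteq> 11"
      proof
        assume "(j - k) mod 12 = 11"
        then have "(k - j) mod 12 = 1" by (rule mod_12_diff_11)
        then show False using 1 that by blast
      qed
      ultimately show ?thesis using 1 that by auto
    qed
    from sl have "f = su_one \<or> (\<exists>k. wall k z = 0 \<and> f = gen k)"
    proof (induction rule: rtranclp_induct)
      case (step g h)
      then obtain m where m: "wall m (su_act g z) = 0" "h = gen m \<odot> g" by (auto simp: slide_def)
      from step.IH show ?case
      proof
        assume "g = su_one"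
        then show ?thesis using m by auto
      next
        assume "\<exists>k. wall k z = 0 \<and> g = gen k"
        then obtain k where k: "wall k z = 0" "g = gen k" by blast
        have "wall (k + partner k - m) z = 0" using m(1) k by (simp add: wall_gen_zero)
        then have "(k + partner k - m - k) mod 12 = 0" using nv k(1) by blast
        then have "(partner k - m) mod 12 = 0" by (simp add: algebra_simps)
        then have "partner k mod 12 = m mod 12" by (rule mod_12_diff_0)
        then have "gen m = su_inv (gen k)" using gen_mod[of "partner k" m] by (simp add: gen_partner)
        then have "h = su_one" using m(2) k(2) by (simp add: su_inv_left gen_su11)
        then show ?thesis by simp
      qed
    qed simp
    \<comment> \<open>If \<open>gen k\<close> fixed \<open>z\<close>, then \<open>z\<close> would
      also lie on the partner side, whose index differs by 2.\<close>
    moreover have "f \<noteq> gen k" if k: "wall k z = 0" for k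
    proof
      assume "f = gen k"
      then have "wall (partner k) z = 0" using wall_gen_partner[of k z] fz k by simp
      then have "(partner k - k) mod 12 = 0" using nv k by blast
      then show False using sg_cases[of k] by (auto simp: partner_def)
    qed
    ultimately show ?thesis by blast
  qed
qed

lemma surf_group_free:
  assumes f: "f \<in> surf_group" and fz: "su_act f z = z"
  shows "f = su_one"
proof -
  obtain g where g: "g \<in> surf_group" "su_act g z \<in> polygon" using polygon_covers by blast
  note G = surf_group_su11[OF g(1)] surf_group_su11[OF f]
  have "su_act (g \<odot> f \<odot> su_inv g) (su_act g z) = su_act g z"
    by (simp add: su_act_mult su11_inv su_act_inv G fz)
  moreover have "g \<odot> f \<odot> su_inv g \<in> surf_group" by (simp add: surf_group_mult surf_group_inv g f)
  ultimately have "g \<odot> f \<odot> su_inv g = su_one" using free_on_polygon g(2) by blast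
  then have "su_inv g \<odot> (g \<odot> f \<odot> su_inv g) \<odot> g = su_one" by (simp add: su_inv_left G)
  then have "(su_inv g \<odot> g) \<odot> f \<odot> (su_inv g \<odot> g) = su_one" by (simp only: su_mult_assoc)
  then show ?thesis by (simp add: su_inv_left G)
qed


section \<open>From the polygon to the glued disc\<close>

lemma cos_15_sq: "(cos (pi / 12))\<^sup>2 = (2 + sqrt 3) / 4"
proof -
  have "cos (pi / 6) = 2 * (cos (pi / 12))\<^sup>2 - 1"
    using cos_double_cos[of "pi / 12"] by simp
  then show ?thesis by (simp add: cos_30 field_simps)
qed

lemma cos_15_pos: "cos (pi / 12) > 0"
  by (rule cos_gt_zero) (simp_all add: field_simps)

lemma sector_cos:
  assumes "\<bar>\<delta>\<bar> \<le> pi / 12"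
  shows "cos (pi / 12) \<le> cos \<delta>"
    and "d mod 12 \<noteq> 0 \<Longrightarrow> cos (\<delta> + real_of_int d * pi / 6) \<le> cos (pi / 12)"
    and "cos (\<delta> + real_of_int d * pi / 6) \<le> cos \<delta>"
proof -
  have "cos (pi / 12) \<le> cos \<bar>\<delta>\<bar>" using assms by (intro cos_monotone_0_pi_le) auto
  then show 1: "cos (pi / 12) \<le> cos \<delta>" by simp
  show 2: "cos (\<delta> + real_of_int d * pi / 6) \<le> cos (pi / 12)" if "d mod 12 \<noteq> 0" for d
  proof -
    define e where "e = d mod 12"
    have "e \<noteq> 0" "0 \<le> e" "e < 12" using that by (auto simp: e_def)
    then have "1 \<le> real_of_int e" "real_of_int e \<le> 11" by auto
    then have "1 * (pi / 6) \<le> real_of_int e * (pi / 6)" "real_of_int e * (pi / 6) \<le> 11 * (pi / 6)"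
      by (intro mult_right_mono; simp)+
    then have "cos (\<delta> + real_of_int e * pi / 6) \<le> cos (pi / 12)"
      using assms[unfolded abs_le_iff] pi_gt_zero by (intro cos_le_between) linarith+
    then show ?thesis unfolding cos_int_mod_12[of \<delta> d] e_def .
  qed
  show "cos (\<delta> + real_of_int d * pi / 6) \<le> cos \<delta>"
  proof (cases "d mod 12 = 0")
    case True
    then show ?thesis using cos_int_mod_12[of \<delta> d] by simp
  next
    case False
    then show ?thesis using 1 2[of d] by linarith
  qed
qed

lemma Re_sector: "Re (of_real r * om k * cis \<delta> * cnj (om j)) = r * cos (\<delta> + real_of_int (k - j) * pi / 6)"
proof -
  have "of_real r * om k * cis \<delta> * cnj (om j) = of_real r * (cis \<delta> * (om k * cnj (om j)))" by (simp add: mult_ac)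
  then show ?thesis by (simp only: om_mult_cnj cis_mult Re_complex_of_real[symmetric]) simp
qed

lemma in_sector: "\<exists>k \<delta>. \<bar>\<delta>\<bar> \<le> pi / 12 \<and> x = of_real (cmod x) * om k * cis \<delta>"
proof -
  define \<phi> where "\<phi> = Arg x"
  define k where "k = \<lfloor>\<phi> * 6 / pi\<rfloor>"
  define \<delta> where "\<delta> = \<phi> - (2 * real_of_int k + 1) * pi / 12"
  have "real_of_int k \<le> \<phi> * 6 / pi" "\<phi> * 6 / pi < real_of_int k + 1" unfolding k_def by linarith+
  then have "real_of_int k * pi \<le> \<phi> * 6" "\<phi> * 6 < (real_of_int k + 1) * pi" by (simp_all add: field_simps)
  then have "\<bar>\<delta>\<bar> \<le> pi / 12" unfolding \<delta>_def by (simp add: field_simps abs_le_iff)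
  moreover have "om k * cis \<delta> = cis \<phi>" by (simp add: om_def cis_mult \<delta>_def)
  moreover have "x = of_real (cmod x) * cis \<phi>" using rcis_cmod_Arg[of x] by (simp add: rcis_def \<phi>_def)
  ultimately show ?thesis by (metis mult.assoc)
qed

definition arc :: "int \<Rightarrow> complex set" where
  "arc k = {x. cmod x = 1 \<and> cos (pi / 12) \<le> Re (x * cnj (om k))}"

lemma arc_param:
  assumes "x \<in> arc k"
  obtains \<delta> where "\<bar>\<delta>\<bar> \<le> pi / 12" "x = om k * cis \<delta>"
proof -
  define v where "v = x * cnj (om k)"
  have n: "cmod v = 1" using assms by (simp add: v_def arc_def norm_mult)
  define \<delta> where "\<delta> = Arg v"
  have v: "v = cis \<delta>" using rcis_cmod_Arg[of v] n by (simp add: rcis_def \<delta>_def)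
  have "cos (pi / 12) \<le> Re v" using assms by (simp only: arc_def v_def mem_Collect_eq)
  then have "cos (pi / 12) \<le> cos \<bar>\<delta>\<bar>" by (simp add: v)
  moreover have "\<bar>\<delta>\<bar> \<le> pi" using Arg_bounded[of v] unfolding \<delta>_def by linarith
  ultimately have "\<bar>\<delta>\<bar> \<le> pi / 12" by (subst (asm) cos_mono_le_eq) auto
  moreover have "x = om k * v" by (simp add: v_def mult.left_commute)
  ultimately show thesis using v that by blast
qed

lemma arc_cis: "\<bar>\<delta>\<bar> \<le> pi / 12 \<Longrightarrow> om k * cis \<delta> \<in> arc k"
  using Re_sector[of 1 k \<delta> k] sector_cos(1)[of \<delta>] by (simp add: arc_def norm_mult del: times_complex.sel)

lemma in_some_arc: "cmod x = 1 \<Longrightarrow> \<exists>k. x \<in> arc k"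
  using in_sector[of x] arc_cis by (metis mult_1 of_real_1)

text \<open>The Euclidean reflection that exchanges arcs \<open>k\<close> and
  \<open>partner k\<close>. By \<open>act_gen\<close>, \<open>gen k\<close> acts as this map on side
  \<open>k\<close>.\<close>

definition flip :: "int \<Rightarrow> complex \<Rightarrow> complex" where
  "flip k x = om k * om (partner k) * cnj x"

lemma flip_partner: "flip (partner k) (flip k x) = x"
proof -
  have "flip (partner k) (flip k x) = (om k * cnj (om k)) * (om (partner k) * cnj (om (partner k))) * x"
    by (simp add: flip_def mult_ac del: om_cnj)
  then show ?thesis by simp
qed

lemma flip_arc_coord: "flip k x * cnj (om (partner k)) = cnj (x * cnj (om k))"
proof -
  have "flip k x * cnj (om (partner k)) = (om (partner k) * cnj (om (partner k))) * (om k * cnj x)"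
    by (simp add: flip_def mult_ac del: om_cnj)
  then show ?thesis by (simp add: mult.commute)
qed

lemma flip_Re: "Re (flip k x * cnj (om j)) = Re (x * cnj (om (k + partner k - j)))"
proof -
  define i where "i = k + partner k - j"
  have "om k * om (partner k) = om i * om j" by (rule om_mult_cong) (simp add: i_def)
  then have "flip k x * cnj (om j) = om i * cnj x * (om j * cnj (om j))"
    by (simp add: flip_def mult_ac del: om_cnj)
  then have "flip k x * cnj (om j) = cnj (x * cnj (om i))" by simp
  then show ?thesis unfolding i_def[symmetric] by (simp only: cnj.simps)
qed

lemma cmod_flip [simp]: "cmod (flip k x) = cmod x"
  by (simp add: flip_def norm_mult)

lemma flip_arc: "x \<in> arc k \<Longrightarrow> flip k x \<in> arc (partner k)"
  unfolding arc_def mem_Collect_eq flip_arc_coord cmod_flip by (simp only: cnj.simps)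


subsection \<open>The radial homeomorphism from the polygon to the disc\<close>

text \<open>In the coordinate \<open>x\<close> the sides are branches of hyperbolas and not
  segments. So this homogeneous function cuts out the polygon by comparison with \<open>tt x\<close>
  instead of 1.\<close>

definition pgauge :: "complex \<Rightarrow> real" where
  "pgauge x = Max ((\<lambda>k. cosh_r / sinh_r * Re (x * cnj (om k))) ` {0..<12})"

lemma pgauge_ge: "cosh_r / sinh_r * Re (x * cnj (om k)) \<le> pgauge x"
proof -
  have "om k = om (k mod 12)" by (rule om_mod) simp
  then show ?thesis unfolding pgauge_def by (intro Max_ge) auto
qed

lemma pgauge_attained: "\<exists>k. pgauge x = cosh_r / sinh_r * Re (x * cnj (om k))"
proof -
  have "pgauge x \<in> (\<lambda>k. cosh_r / sinh_r * Re (x * cnj (om k))) ` {0..<12}"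
    unfolding pgauge_def by (intro Max_in) auto
  then show ?thesis by blast
qed

lemma pgauge_scale: assumes "r \<ge> 0" shows "pgauge (of_real r * x) = r * pgauge x"
proof (rule antisym)
  have R: "cosh_r / sinh_r * Re (of_real r * x * cnj (om k)) = r * (cosh_r / sinh_r * Re (x * cnj (om k)))" for k
    by (simp add: algebra_simps)
  obtain k where k: "pgauge (of_real r * x) = cosh_r / sinh_r * Re (of_real r * x * cnj (om k))"
    using pgauge_attained by blast
  show "pgauge (of_real r * x) \<le> r * pgauge x"
    unfolding k R using pgauge_ge assms by (rule mult_left_mono)
  obtain k where k: "pgauge x = cosh_r / sinh_r * Re (x * cnj (om k))" using pgauge_attained by blast
  show "r * pgauge x \<le> pgauge (of_real r * x)"
    unfolding k R[symmetric] by (rule pgauge_ge)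
qed

lemma pgauge_flip: "pgauge (flip k x) = pgauge x"
proof -
  have "pgauge (flip k x) \<le> pgauge x" for k x
    using pgauge_attained[of "flip k x"] pgauge_ge unfolding flip_Re by metis
  from this[of k x] this[of "partner k" "flip k x"] show ?thesis by (simp add: flip_partner)
qed

lemma polygon_iff_pgauge: "x \<in> polygon \<longleftrightarrow> pgauge x \<le> tt x"
proof -
  have w: "wall k x \<le> 0 \<longleftrightarrow> cosh_r / sinh_r * Re (x * cnj (om k)) \<le> tt x" for k
    using sinh_r_pos by (simp add: wall_def field_simps)
  show ?thesis
    unfolding polygon_def mem_Collect_eq w using pgauge_attained[of x] pgauge_ge[of x] by (metis order_trans)
qed

lemma wall_zero_iff: "wall k x = 0 \<longleftrightarrow> cosh_r / sinh_r * Re (x * cnj (om k)) = tt x"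
  using sinh_r_pos by (simp add: wall_def field_simps)

definition gauge_const :: real where
  "gauge_const = cosh_r / sinh_r * cos (pi / 12)"

text \<open>It expresses that the vertices are not ideal: as \<open>tt x\<close> grows like |x|, a
  gauge that grows strictly faster makes the polygon compact.\<close>

lemma gauge_const_gt_1: "gauge_const > 1"
proof -
  have "(cosh_r * cos (pi / 12))\<^sup>2 = (26 + 15 * sqrt 3) / 4"
    unfolding power_mult_distrib cosh_r_sq cos_15_sq by (simp add: field_simps)
  moreover have "(26 + 15 * sqrt 3) / 4 > sinh_r\<^sup>2" unfolding sinh_r_sq using sqrt3_bounds by (simp add: field_simps)
  ultimately have "sinh_r\<^sup>2 < (cosh_r * cos (pi / 12))\<^sup>2" by simp
  then have "sinh_r < cosh_r * cos (pi / 12)"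
    by (rule power2_less_imp_less) (use cosh_r_pos cos_15_pos in simp)
  then show ?thesis using sinh_r_pos by (simp add: gauge_const_def field_simps)
qed

lemma some_sector_Re: "\<exists>k. cos (pi / 12) * cmod x \<le> Re (x * cnj (om k))"
proof -
  obtain k \<delta> where k: "\<bar>\<delta>\<bar> \<le> pi / 12" "x = of_real (cmod x) * om k * cis \<delta>" using in_sector by blast
  have "Re (x * cnj (om k)) = cmod x * cos \<delta>"
    by (subst k(2)) (simp only: Re_sector, simp)
  then show ?thesis using sector_cos(1)[OF k(1)] by (metis mult.commute mult_left_mono norm_ge_zero)
qed

lemma pgauge_lower: "gauge_const * cmod x \<le> pgauge x"
proof -
  obtain k where "cos (pi / 12) * cmod x \<le> Re (x * cnj (om k))" using some_sector_Re by blast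
  then have "cosh_r / sinh_r * (cos (pi / 12) * cmod x) \<le> cosh_r / sinh_r * Re (x * cnj (om k))"
    using cosh_r_pos sinh_r_pos by (intro mult_left_mono) auto
  then show ?thesis using pgauge_ge[of x k] by (simp add: gauge_const_def)
qed

lemma pgauge_nonneg: "0 \<le> pgauge x"
  using pgauge_lower[of x] gauge_const_gt_1 by (metis mult_nonneg_nonneg norm_ge_zero order_trans less_imp_le zero_less_one order.strict_trans)

lemma pgauge_pos: "x \<noteq> 0 \<Longrightarrow> 0 < pgauge x"
  using pgauge_lower[of x] gauge_const_gt_1 by (smt (verit, best) mult_pos_pos zero_less_norm_iff)

lemma pgauge_zero [simp]: "pgauge 0 = 0"
  using pgauge_scale[of 0 0] by simp

lemma continuous_on_Max:
  fixes f :: "'i \<Rightarrow> 'a::topological_space \<Rightarrow> real"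
  assumes "finite A" "A \<noteq> {}" "\<And>i. i \<in> A \<Longrightarrow> continuous_on S (f i)"
  shows "continuous_on S (\<lambda>x. Max ((\<lambda>i. f i x) ` A))"
  using assms
proof (induction rule: finite_ne_induct)
  case (insert a A)
  then have "continuous_on S (\<lambda>x. max (f a x) (Max ((\<lambda>i. f i x) ` A)))"
    by (intro continuous_on_max) auto
  then show ?case using insert by simp
qed simp

lemma continuous_on_pgauge: "continuous_on S pgauge"
  unfolding pgauge_def by (intro continuous_on_Max continuous_intros) auto

text \<open>Rays are preserved, and the factor is chosen so that the image has modulus
  \<open>pgauge x / tt x\<close>. The boundary of the polygon thus goes to the unit circle, and the
  symmetries \<open>flip k\<close> are respected.\<close>

definition to_disc :: "complex \<Rightarrow> complex" where
  "to_disc x = of_real (pgauge x / (tt x * cmod x)) * x"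

lemma cmod_to_disc: "cmod (to_disc x) = pgauge x / tt x"
  using pgauge_nonneg[of x] tt_pos[of x] by (cases "x = 0") (auto simp: to_disc_def norm_mult norm_divide)

lemma to_disc_zero [simp]: "to_disc 0 = 0" by (simp add: to_disc_def)

lemma continuous_on_to_disc: "continuous_on S to_disc"
proof -
  have "isCont to_disc x" for x
  proof (cases "x = 0")
    case True
    have "isCont pgauge 0"
      using continuous_on_pgauge[of UNIV] by (simp add: continuous_on_eq_continuous_at)
    then have "(pgauge \<longlongrightarrow> pgauge 0) (at 0)" unfolding isCont_def .
    then have g: "(pgauge \<longlongrightarrow> 0) (at 0)" by simp
    have "(to_disc \<longlongrightarrow> 0) (at 0)"
    proof (rule Lim_null_comparison[OF _ g])
      have "cmod (to_disc y) \<le> pgauge y" for y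
        unfolding cmod_to_disc using divide_left_mono[of 1 "tt y" "pgauge y"] tt_ge_1[of y] pgauge_nonneg[of y] by simp
      then show "\<forall>\<^sub>F y in at 0. cmod (to_disc y) \<le> pgauge y" by simp
    qed
    then show ?thesis using True by (simp add: isCont_def)
  next
    case False
    have "isCont pgauge x" "isCont tt x"
      using continuous_on_pgauge[of UNIV] continuous_on_tt[of UNIV] by (simp_all add: continuous_on_eq_continuous_at)
    then show ?thesis unfolding to_disc_def
      using False tt_pos[of x] by (intro continuous_intros) auto
  qed
  then show ?thesis by (simp add: continuous_at_imp_continuous_on)
qed

lemma to_disc_inj: assumes "to_disc x = to_disc y" shows "x = y"
proof (cases "x = 0 \<or> y = 0")
  case True
  have "x = 0" if "to_disc x = 0" for x
  proof (rule ccontr)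
    assume "x \<noteq> 0"
    then have "pgauge x / tt x > 0" using pgauge_pos tt_pos by simp
    then show False using that cmod_to_disc[of x] by (metis less_irrefl norm_zero)
  qed
  then show ?thesis using True assms by (metis to_disc_zero)
next
  case False
  then have p: "pgauge x > 0" "pgauge y > 0" "cmod x > 0" "cmod y > 0" using pgauge_pos by auto
  define r where "r = (pgauge x / (tt x * cmod x)) / (pgauge y / (tt y * cmod y))"
  have r: "r > 0" using p tt_pos by (simp add: r_def)
  have y: "y = of_real r * x"
    using assms p tt_pos[of x] tt_pos[of y] unfolding to_disc_def r_def of_real_divide
    by (simp add: field_simps)
  have "pgauge x / tt x = pgauge y / tt y" using assms cmod_to_disc by metis
  then have "pgauge x / tt x = r * pgauge x / tt (of_real r * x)" unfolding y using pgauge_scale r by simp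
  then have "tt (of_real r * x) = r * tt x" using p tt_pos[of x] tt_pos[of "of_real r * x"] by (simp add: field_simps)
  then have "(tt (of_real r * x))\<^sup>2 = r\<^sup>2 * (tt x)\<^sup>2" by (simp add: power_mult_distrib)
  then have "r\<^sup>2 = 1" unfolding tt_sq using r by (simp add: norm_mult power_mult_distrib algebra_simps)
  then have "r = 1" using r by (simp add: power2_eq_1_iff)
  then show ?thesis using y by simp
qed

lemma to_disc_flip: "to_disc (flip k x) = flip k (to_disc x)"
proof -
  have t: "tt (flip k x) = tt x" by (simp add: tt_def)
  show ?thesis unfolding to_disc_def pgauge_flip t cmod_flip by (simp add: flip_def mult_ac)
qed

lemma to_disc_polygon: "to_disc ` polygon = cball 0 1"
proof
  show "to_disc ` polygon \<subseteq> cball 0 1"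
    using tt_pos by (auto simp: cmod_to_disc polygon_iff_pgauge divide_le_eq_1)
  show "cball 0 1 \<subseteq> to_disc ` polygon"
  proof
    fix w :: complex assume "w \<in> cball 0 1"
    then have w: "cmod w \<le> 1" by simp
    show "w \<in> to_disc ` polygon"
    proof (cases "w = 0")
      case True
      then show ?thesis by (intro image_eqI[of _ _ 0]) (auto simp: polygon_iff_pgauge)
    next
      case False
      \<comment> \<open>The positive solution of
        \<open>cmod w * tt (of_real r * w) = r * pgauge w\<close>, which says that the image of the
        point \<open>r * w\<close> has modulus |w|.\<close>
      define r where "r = cmod w / sqrt ((pgauge w)\<^sup>2 - (cmod w) ^ 4)"
      have "1 * cmod w < gauge_const * cmod w" using gauge_const_gt_1 False by (intro mult_strict_right_mono) auto
      then have "cmod w < pgauge w" using pgauge_lower[of w] by simp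
      moreover have "(cmod w)\<^sup>2 \<le> cmod w" using w by (simp add: power2_eq_square mult_left_le_one_le)
      ultimately have "(cmod w)\<^sup>2 < pgauge w" by simp
      then have "((cmod w)\<^sup>2)\<^sup>2 < (pgauge w)\<^sup>2" by (intro power_strict_mono) auto
      then have d: "(pgauge w)\<^sup>2 - (cmod w) ^ 4 > 0" by simp
      then have r: "r > 0" using False by (simp add: r_def)
      have r2: "r\<^sup>2 * ((pgauge w)\<^sup>2 - (cmod w) ^ 4) = (cmod w)\<^sup>2" using d by (simp add: r_def power_divide)
      have "(cmod w * tt (of_real r * w))\<^sup>2 = (r * pgauge w)\<^sup>2"
        unfolding power_mult_distrib tt_sq using r2 by (simp add: norm_mult power_mult_distrib algebra_simps power4_eq_xxxx power2_eq_square)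
      then have e: "cmod w * tt (of_real r * w) = r * pgauge w"
        using r pgauge_nonneg[of w] tt_pos[of "of_real r * w"] by (simp add: power2_eq_iff_nonneg)
      have "to_disc (of_real r * w) = of_real (r * pgauge w / (tt (of_real r * w) * (r * cmod w)) * r) * w"
        using r by (simp add: to_disc_def pgauge_scale norm_mult)
      also have "r * pgauge w / (tt (of_real r * w) * (r * cmod w)) * r = 1"
        unfolding e[symmetric] using r False tt_pos[of "of_real r * w"] by simp
      finally have "to_disc (of_real r * w) = w" by simp
      moreover have "of_real r * w \<in> polygon"
      proof -
        have "pgauge (of_real r * w) = cmod w * tt (of_real r * w)" using e r by (simp add: pgauge_scale)
        also have "\<dots> \<le> 1 * tt (of_real r * w)" using w tt_pos[of "of_real r * w"] by (intro mult_right_mono) auto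
        finally show ?thesis by (simp add: polygon_iff_pgauge)
      qed
      ultimately show ?thesis by (metis image_eqI)
    qed
  qed
qed

lemma polygon_bounded: "\<exists>K. \<forall>x\<in>polygon. cmod x \<le> K \<and> tt x \<le> K"
proof -
  define c where "c = gauge_const\<^sup>2 - 1"
  have "gauge_const * gauge_const > 1 * 1" using gauge_const_gt_1 by (intro mult_strict_mono) auto
  then have c: "c > 0" by (simp add: c_def power2_eq_square)
  have "cmod x \<le> 1 + 1 / c \<and> tt x \<le> 2 + 1 / c" if "x \<in> polygon" for x
  proof -
    have "gauge_const * cmod x \<le> tt x" using that pgauge_lower[of x] by (simp add: polygon_iff_pgauge)
    then have "(gauge_const * cmod x)\<^sup>2 \<le> (tt x)\<^sup>2" using gauge_const_gt_1 by (intro power_mono) auto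
    then have "c * (cmod x)\<^sup>2 \<le> 1" unfolding tt_sq c_def by (simp add: power_mult_distrib algebra_simps)
    then have s: "(cmod x)\<^sup>2 \<le> 1 / c" using c by (simp add: field_simps)
    have "2 * cmod x \<le> 1 + (cmod x)\<^sup>2" using zero_le_power2[of "cmod x - 1"] by (simp add: power2_eq_square algebra_simps)
    then have "cmod x \<le> 1 + 1 / c" using s c divide_pos_pos[OF zero_less_one c] by linarith
    then show ?thesis using tt_le[of x] by linarith
  qed
  then show ?thesis by (intro exI[of _ "2 + 1 / c"]) fastforce
qed

lemma compact_polygon: "compact polygon"
proof -
  have "polygon = {x. pgauge x \<le> tt x}" using polygon_iff_pgauge by blast
  then have "closed polygon"
    using closed_Collect_le[OF continuous_on_pgauge continuous_on_tt] by simp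
  moreover have "bounded polygon" using polygon_bounded by (auto simp: bounded_iff)
  ultimately show ?thesis by (simp add: compact_eq_bounded_closed)
qed

text \<open>Sides correspond to arcs because, in the sector of half-width pi/12 around
  \<open>om k\<close>, the maximum that defines \<open>pgauge\<close> is attained at index
  \<open>k\<close>.\<close>

lemma to_disc_arc_iff:
  assumes "x \<in> polygon"
  shows "to_disc x \<in> arc k \<longleftrightarrow> wall k x = 0"
proof
  assume w: "wall k x = 0"
  then have t: "cosh_r / sinh_r * Re (x * cnj (om k)) = tt x" by (simp add: wall_zero_iff)
  then have g: "pgauge x = tt x" using pgauge_ge[of x k] assms by (simp add: polygon_iff_pgauge)
  then have n: "cmod (to_disc x) = 1" using tt_pos[of x] by (simp add: cmod_to_disc)
  then have x0: "x \<noteq> 0" by auto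
  have "gauge_const * cmod x \<le> cosh_r / sinh_r * Re (x * cnj (om k))" using pgauge_lower[of x] g t by simp
  then have "cosh_r / sinh_r * (cos (pi / 12) * cmod x) \<le> cosh_r / sinh_r * Re (x * cnj (om k))"
    by (simp only: gauge_const_def mult.assoc)
  then have "cos (pi / 12) * cmod x \<le> Re (x * cnj (om k))"
    using cosh_r_pos sinh_r_pos by (simp only: mult_le_cancel_left_pos divide_pos_pos)
  moreover have "to_disc x = of_real (1 / cmod x) * x" using g tt_pos[of x] by (simp add: to_disc_def)
  moreover from this have "to_disc x * cnj (om k) = of_real (1 / cmod x) * (x * cnj (om k))" by (simp only: mult.assoc)
  then have "Re (to_disc x * cnj (om k)) = Re (x * cnj (om k)) / cmod x" by (simp only: Re_complex_of_real times_complex.sel Im_complex_of_real) simp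
  ultimately have "cos (pi / 12) \<le> Re (to_disc x * cnj (om k))" using x0 by (simp only: le_divide_eq zero_less_norm_iff if_True simp_thms)
  then show "to_disc x \<in> arc k" using n by (simp add: arc_def)
next
  assume a: "to_disc x \<in> arc k"
  then have n: "cmod (to_disc x) = 1" by (simp add: arc_def)
  then have g: "pgauge x = tt x" using tt_pos[of x] by (simp add: cmod_to_disc)
  then have x: "x = of_real (cmod x) * to_disc x"
    using n tt_pos[of x] by (cases "x = 0") (auto simp: to_disc_def)
  obtain \<delta> where \<delta>: "\<bar>\<delta>\<bar> \<le> pi / 12" "to_disc x = om k * cis \<delta>" using arc_param[OF a] by blast
  have R: "Re (x * cnj (om j)) = cmod x * cos (\<delta> + real_of_int (k - j) * pi / 6)" for j
    using Re_sector[of "cmod x" k \<delta> j] x \<delta>(2) by (metis mult.assoc)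
  obtain j where j: "pgauge x = cosh_r / sinh_r * Re (x * cnj (om j))" using pgauge_attained by blast
  have "Re (x * cnj (om j)) \<le> Re (x * cnj (om k))"
    using mult_left_mono[OF sector_cos(3)[OF \<delta>(1), of "k - j"], of "cmod x"] unfolding R by simp
  then have "pgauge x \<le> cosh_r / sinh_r * Re (x * cnj (om k))"
    unfolding j using cosh_r_pos sinh_r_pos by (intro mult_left_mono) auto
  then have "cosh_r / sinh_r * Re (x * cnj (om k)) = tt x" using g pgauge_ge[of x k] by simp
  then show "wall k x = 0" by (simp add: wall_zero_iff)
qed


subsection \<open>An embedding of the glued disc into a Euclidean space\<close>

definition paired :: "complex \<Rightarrow> complex \<Rightarrow> bool" where
  "paired x y \<longleftrightarrow> (\<exists>k. x \<in> arc k \<and> y = flip k x)"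

lemma paired_sym: "paired x y \<Longrightarrow> paired y x"
  unfolding paired_def using flip_arc flip_partner by metis

lemma polygon_side_cis: "polygon_side 3 k t = om (int k) * cis ((2 * t - 1) * pi / 12)"
  unfolding polygon_side_def om_def cis_mult by (rule arg_cong[where f=cis]) (simp add: field_simps)

lemma polygon_side_arc: "t \<in> {0..1} \<Longrightarrow> polygon_side 3 k t \<in> arc (int k)"
  unfolding polygon_side_cis by (rule arc_cis) (auto simp: abs_le_iff field_simps)

lemma polygon_side_flip:
  assumes "partner (int k) = int m"
  shows "polygon_side 3 m (1 - t) = flip (int k) (polygon_side 3 k t)"
proof -
  have "(2 * (1 - t) - 1) * pi / 12 = - ((2 * t - 1) * pi / 12)" by (simp add: field_simps)
  then have "polygon_side 3 m (1 - t) = om (int m) * cnj (cis ((2 * t - 1) * pi / 12))"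
    by (simp only: polygon_side_cis cis_cnj)
  also have "\<dots> = (om (int k) * cnj (om (int k))) * (om (int m) * cnj (cis ((2 * t - 1) * pi / 12)))" by simp
  also have "\<dots> = flip (int k) (polygon_side 3 k t)"
    unfolding flip_def assms polygon_side_cis by (simp add: mult_ac del: om_cnj)
  finally show ?thesis .
qed

lemma partner_side: "partner (int (4 * i)) = int (4 * i + 2)" "partner (int (4 * i + 1)) = int (4 * i + 3)"
proof -
  have "int (4 * i) mod 4 < 2" "int (4 * i + 1) mod 4 < 2"
    using int_mod_add[of "4 * int i" 4 0 1] by simp_all
  then have "sg (int (4 * i)) = 1" "sg (int (4 * i + 1)) = 1" using sg_eq_1 by blast+
  then show "partner (int (4 * i)) = int (4 * i + 2)" "partner (int (4 * i + 1)) = int (4 * i + 3)"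
    by (simp_all add: partner_def)
qed

lemma side_gluing_paired: "side_gluing 3 x y \<Longrightarrow> paired x y"
  unfolding side_gluing_def paired_def
  using polygon_side_arc polygon_side_flip partner_side by metis

lemma paired_side_gluing:
  assumes "x \<in> arc k" "sg k = 1"
  shows "side_gluing 3 x (flip k x)"
proof -
  define n where "n = nat (k mod 12)"
  have n: "int n = k mod 12" "n < 12" unfolding n_def by (auto simp: nat_less_iff)
  have nk: "int n mod 12 = k mod 12" using n by simp
  have "sg (int n) = 1" using sg_mod[OF nk] assms(2) by simp
  then have "int n mod 4 < 2" using sg_eq_minus_1[of "int n"] by fastforce
  then have "int (n mod 4) < 2" by (simp only: zmod_int of_nat_numeral)
  then have n4: "n = 4 * (n div 4) \<or> n = 4 * (n div 4) + 1" using mult_div_mod_eq[of 4 n] by linarith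
  have i: "n div 4 < 3" using n(2) by simp
  obtain \<delta> where \<delta>: "\<bar>\<delta>\<bar> \<le> pi / 12" "x = om k * cis \<delta>" using arc_param[OF assms(1)] by blast
  define w where "w = \<delta> * 12 / pi"
  define t where "t = (w + 1) / 2"
  have "\<bar>w\<bar> \<le> 1" using \<delta>(1) by (simp add: w_def abs_mult field_simps)
  then have t: "t \<in> {0..1}" by (auto simp: t_def abs_le_iff)
  have "(2 * t - 1) * pi / 12 = \<delta>" by (simp add: t_def w_def field_simps)
  then have x: "x = polygon_side 3 n t" using \<delta>(2) om_mod[OF nk] by (simp add: polygon_side_cis)
  have f: "flip k = flip (int n)"
    using om_mod[OF nk] om_mod[OF partner_mod[OF nk]] by (simp add: flip_def fun_eq_iff)
  show ?thesis
    unfolding side_gluing_def f x using n4 i t polygon_side_flip partner_side by metis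
qed

lemma paired_imp_side_gluing: assumes "paired x y" shows "side_gluing 3 x y \<or> side_gluing 3 y x"
proof -
  obtain k where k: "x \<in> arc k" "y = flip k x" using assms by (auto simp: paired_def)
  show ?thesis
  proof (cases "sg k = 1")
    case True
    then show ?thesis using paired_side_gluing k by blast
  next
    case False
    then have "sg (partner k) = 1" using sg_cases[of k] sg_partner[of k] by auto
    then have "side_gluing 3 y (flip (partner k) y)" using paired_side_gluing[OF flip_arc] k by blast
    then show ?thesis using k flip_partner by simp
  qed
qed

lemma equivclp_side_gluing: "equivclp (side_gluing 3) = paired\<^sup>*\<^sup>*"
proof -
  have "symclp (side_gluing 3) = paired"
    using side_gluing_paired paired_sym paired_imp_side_gluing unfolding symclp_def fun_eq_iff by blast
  then show ?thesis by (simp add: equivclp_def)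
qed

definition bump :: "int \<Rightarrow> complex \<Rightarrow> real" where
  "bump k x = max 0 (Re (x * cnj (om k)) - cos (pi / 12) * cmod x)"

definition label :: "int \<Rightarrow> real" where
  "label k = of_int (if sg k = 1 then k mod 12 else partner k mod 12)"

text \<open>At most one \<open>bump\<close> is nonzero at a boundary point. The three sums therefore determine its distance to the ends of
  its arc, the pair of sides that contains the arc, and the position on the arc up to the reflection pairing them.\<close>

definition embed :: "complex \<Rightarrow> real \<times> real \<times> real \<times> complex \<times> real" where
  "embed x = (\<Sum>k\<in>{0..<12}. bump k x, \<Sum>k\<in>{0..<12}. label k * bump k x,
     \<Sum>k\<in>{0..<12}. of_int (sg k) * Im (x * cnj (om k)) * bump k x, (1 - cmod x) *\<^sub>R x, cmod x)"

lemma continuous_on_embed: "continuous_on S embed"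
  unfolding embed_def bump_def by (intro continuous_intros)

lemma label_partner: "label (partner k) = label k"
  using sg_cases[of k] sg_partner[of k] by (auto simp: label_def)

lemma label_eq: assumes "label j = label k" shows "j mod 12 = k mod 12 \<or> j mod 12 = partner k mod 12"
proof -
  have "(if sg j = 1 then j mod 12 else partner j mod 12) = (if sg k = 1 then k mod 12 else partner k mod 12)"
    using assms unfolding label_def of_int_eq_iff .
  moreover have "partner j mod 12 = partner k mod 12 \<Longrightarrow> j mod 12 = k mod 12"
    "partner j mod 12 = k mod 12 \<Longrightarrow> j mod 12 = partner k mod 12"
    using partner_mod[of "partner j" "partner k"] partner_mod[of "partner j" k] by simp_all
  ultimately show ?thesis by (auto split: if_splits)
qed

lemma label_mod: "j mod 12 = k mod 12 \<Longrightarrow> label j = label k"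
  using sg_mod[of j k] partner_mod[of j k] by (simp add: label_def)

lemma embed_arc:
  assumes "x \<in> arc k"
  defines "b \<equiv> Re (x * cnj (om k)) - cos (pi / 12)"
  shows "embed x = (b, label k * b, of_int (sg k) * Im (x * cnj (om k)) * b, 0, 1)"
proof -
  define m where "m = k mod 12"
  have mk: "m mod 12 = k mod 12" by (simp add: m_def)
  have m: "m \<in> {0..<12}" by (simp add: m_def)
  obtain \<delta> where \<delta>: "\<bar>\<delta>\<bar> \<le> pi / 12" "x = om k * cis \<delta>" using arc_param[OF assms(1)] by blast
  have n: "cmod x = 1" using assms by (simp add: arc_def)
  have z: "bump j x = 0" if "j \<in> {0..<12} - {m}" for j
  proof -
    have "(k - j) mod 12 \<noteq> 0"
    proof
      assume "(k - j) mod 12 = 0"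
      then have "k mod 12 = j mod 12" by (rule mod_12_diff_0)
      then show False using that by (auto simp: m_def)
    qed
    then have "Re (x * cnj (om j)) \<le> cos (pi / 12)"
      using Re_sector[of 1 k \<delta> j] sector_cos(2)[OF \<delta>(1), of "k - j"] \<delta>(2) by simp
    then show ?thesis by (simp add: bump_def n)
  qed
  have om: "om m = om k" by (rule om_mod[OF mk])
  have bm: "bump m x = b" using assms n by (simp add: bump_def om b_def arc_def)
  have sum: "(\<Sum>j\<in>{0..<12}. f j * bump j x) = f m * b" for f
  proof -
    have "(\<Sum>j\<in>{0..<12}. f j * bump j x) = f m * bump m x + (\<Sum>j\<in>{0..<12} - {m}. f j * bump j x)"
      using m by (intro sum.remove) auto
    then show ?thesis using z by (simp add: bm)
  qed
  show ?thesis
    using sum[of "\<lambda>_. 1"] sum[of label] sum[of "\<lambda>j. of_int (sg j) * Im (x * cnj (om j))"]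
    unfolding embed_def om sg_mod[OF mk] label_mod[OF mk] by (simp add: n)
qed

lemma embed_paired: assumes "paired x y" shows "embed x = embed y"
proof -
  obtain k where k: "x \<in> arc k" "y = flip k x" using assms by (auto simp: paired_def)
  show ?thesis
    unfolding k(2) embed_arc[OF k(1)] embed_arc[OF flip_arc[OF k(1)]] flip_arc_coord label_partner sg_partner
    by (simp only: cnj.simps of_int_minus mult_minus_left mult_minus_right minus_minus)
qed

definition vtx :: "int \<Rightarrow> complex" where
  "vtx k = cis (real_of_int k * pi / 6)"

lemma vtx_om: "vtx k = om k * cis (- (pi / 12))" "vtx (k + 1) = om k * cis (pi / 12)"
  unfolding vtx_def om_def cis_mult by (rule arg_cong[where f=cis]; simp add: field_simps)+

lemma paired_vtx: "paired (vtx (kap i)) (vtx (kap (i + 1)))"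
proof -
  define k where "k = kap i"
  have "vtx k \<in> arc k" unfolding vtx_om(1) by (rule arc_cis) simp
  moreover have "vtx (partner k + 1) = flip k (vtx k)"
  proof -
    have "flip k (vtx k) = (om k * cnj (om k)) * (om (partner k) * cis (pi / 12))"
      unfolding flip_def vtx_om(1)[of k] by (simp add: cis_cnj mult_ac del: om_cnj)
    then show ?thesis unfolding vtx_om(2) by simp
  qed
  ultimately show ?thesis unfolding paired_def kap_Suc k_def by blast
qed

text \<open>All corners form one class, since \<open>kap\<close> runs through them in the order of
  the vertex cycle. This matches \<open>embed\<close>, whose bumps all vanish at the
  corners.\<close>

lemma paired_vtxs: "paired\<^sup>*\<^sup>* (vtx j) (vtx k)"
proof -
  have up: "paired\<^sup>*\<^sup>* (vtx (kap i)) (vtx (kap (i + int n)))" for i n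
  proof (induction n)
    case (Suc n)
    have "paired (vtx (kap (i + int n))) (vtx (kap (i + int (Suc n))))"
      using paired_vtx[of "i + int n"] by (simp add: algebra_simps)
    with Suc show ?case by simp
  qed simp
  have sym: "symp paired\<^sup>*\<^sup>*" using paired_sym by (intro symp_rtranclp) (auto simp: symp_def)
  have le: "paired\<^sup>*\<^sup>* (vtx (kap i)) (vtx (kap l))" if "i \<le> l" for i l
    using up[of i "nat (l - i)"] that by simp
  have "paired\<^sup>*\<^sup>* (vtx (kap i)) (vtx (kap l))" for i l
    using le[of i l] le[of l i] sym by (meson linear sympD)
  then show ?thesis using kap_kap by metis
qed

lemma arc_end:
  assumes "x \<in> arc k" "Re (x * cnj (om k)) = cos (pi / 12)"
  shows "\<exists>j. x = vtx j"
proof -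
  obtain \<delta> where \<delta>: "\<bar>\<delta>\<bar> \<le> pi / 12" "x = om k * cis \<delta>" using arc_param[OF assms(1)] by blast
  have "cos \<bar>\<delta>\<bar> = cos (pi / 12)" using assms(2) Re_sector[of 1 k \<delta> k] \<delta>(2) by simp
  then have "\<bar>\<delta>\<bar> = pi / 12" using \<delta>(1) pi_gt_zero by - (rule cos_inj_pi, simp_all)
  then have "\<delta> = pi / 12 \<or> \<delta> = - (pi / 12)" by linarith
  then show ?thesis using \<delta>(2) vtx_om by metis
qed

lemma embed_eq_imp_paired:
  assumes "cmod x \<le> 1" "embed x = embed y"
  shows "paired\<^sup>*\<^sup>* x y"
proof -
  have e: "(1 - cmod x) *\<^sub>R x = (1 - cmod y) *\<^sub>R y" "cmod x = cmod y"
    using assms(2) unfolding embed_def prod.inject by blast+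
  show ?thesis
  \<comment> \<open>Off the unit circle the last two components alone recover the point.\<close>
  proof (cases "cmod x = 1")
    case False
    then have "x = y" using e by simp
    then show ?thesis by simp
  next
    case True
    obtain j k where k: "x \<in> arc k" and j: "y \<in> arc j" using in_some_arc True e(2) by metis
    define b where "b = Re (x * cnj (om k)) - cos (pi / 12)"
    have E: "Re (y * cnj (om j)) - cos (pi / 12) = b" "label j * b = label k * b"
      "of_int (sg j) * Im (y * cnj (om j)) * b = of_int (sg k) * Im (x * cnj (om k)) * b"
      using assms(2) unfolding embed_arc[OF k] embed_arc[OF j] prod.inject b_def by metis+
    show ?thesis
    \<comment> \<open>A zero bump means a corner. Otherwise \<open>b\<close> can be cancelled from
      the other two sums, which reveals the label and the signed position on the arc.\<close>
    proof (cases "b = 0")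
      case True
      have "\<exists>i. x = vtx i" using True by (intro arc_end[OF k]) (simp add: b_def)
      moreover have "\<exists>i. y = vtx i" using True E(1) by (intro arc_end[OF j]) simp
      ultimately show ?thesis using paired_vtxs by blast
    next
      case False
      then have l: "label j = label k" and im: "of_int (sg j) * Im (y * cnj (om j)) = of_int (sg k) * Im (x * cnj (om k))"
        using E by simp_all
      have re: "Re (y * cnj (om j)) = Re (x * cnj (om k))" using E(1) unfolding b_def by linarith
      have sg0: "real_of_int (sg k) \<noteq> 0" using sg_cases[of k] by auto
      from label_eq[OF l] show ?thesis
      proof
        assume jk: "j mod 12 = k mod 12"
        then have "Im (y * cnj (om k)) = Im (x * cnj (om k))" "Re (y * cnj (om k)) = Re (x * cnj (om k))"
          using im re sg0 sg_mod[OF jk] om_mod[OF jk] by (simp_all del: times_complex.sel)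
        then have "y * cnj (om k) = x * cnj (om k)" by (rule complex_eqI[rotated])
        then have "y * cnj (om k) * om k = x * cnj (om k) * om k" by simp
        then have "x = y" by (simp add: mult.assoc mult.commute[of "cnj (om k)"])
        then show ?thesis by simp
      next
        assume jk: "j mod 12 = partner k mod 12"
        define o' where "o' = om (partner k)"
        have oj: "om j = o'" unfolding o'_def by (rule om_mod[OF jk])
        have "Im (y * cnj o') = - Im (x * cnj (om k))" "Re (y * cnj o') = Re (x * cnj (om k))"
          using im re sg_cases[of k] sg_mod[OF jk] oj by (auto simp: sg_partner simp del: times_complex.sel)
        then have "y * cnj o' = cnj (x * cnj (om k))"
          by (intro complex_eqI) (simp_all only: cnj.simps)
        then have "y * cnj o' * o' = flip k x * cnj o' * o'" by (simp only: flip_arc_coord o'_def)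
        then have "y = flip k x" by (simp add: o'_def mult.assoc mult.commute[of "cnj (om (partner k))"])
        then show ?thesis using k paired_def by blast
      qed
    qed
  qed
qed

lemma embed_eq_iff: "cmod x \<le> 1 \<Longrightarrow> embed x = embed y \<longleftrightarrow> paired\<^sup>*\<^sup>* x y"
proof
  show "paired\<^sup>*\<^sup>* x y \<Longrightarrow> embed x = embed y"
    by (induction rule: rtranclp_induct) (simp_all add: embed_paired)
qed (rule embed_eq_imp_paired)

lemma gluing_class_eq_iff:
  assumes "x \<in> cball 0 1" "y \<in> cball 0 1"
  shows "gluing_class 3 x = gluing_class 3 y \<longleftrightarrow> embed x = embed y"
proof -
  have "gluing_class 3 x = gluing_class 3 y \<longleftrightarrow> equivclp (side_gluing 3) x y"
    using assms unfolding gluing_class_def by (auto intro: equivclp_sym equivclp_trans)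
  then show ?thesis using assms embed_eq_iff by (simp add: equivclp_side_gluing)
qed


section \<open>The covering of the glued disc by the hyperbolic plane\<close>

definition glued_disc :: "(real \<times> real \<times> real \<times> complex \<times> real) set" where
  "glued_disc = embed ` cball 0 1"

definition proj :: "complex \<Rightarrow> real \<times> real \<times> real \<times> complex \<times> real" where
  "proj z = embed (to_disc (su_act (SOME f. f \<in> surf_group \<and> su_act f z \<in> polygon) z))"

text \<open>Two representatives in the polygon are joined by slides. In the disc a slide is a flip
  of an arc, which \<open>embed\<close> does not see; so \<open>proj\<close> does not depend on the
  choice in its definition.\<close>

lemma embed_to_disc_polygon:
  assumes "z \<in> polygon" "f \<in> surf_group" "su_act f z \<in> polygon"
  shows "embed (to_disc (su_act f z)) = embed (to_disc z)"
  using polygon_slides[OF assms]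
proof (induction rule: rtranclp_induct)
  case (step g h)
  have g: "g \<in> surf_group" using slides_in[OF step.hyps(1) surf_group_one] .
  obtain k where k: "su_act g z \<in> polygon" "wall k (su_act g z) = 0" "h = gen k \<odot> g"
    using step.hyps(2) by (auto simp: slide_def)
  have "su_act h z = flip k (su_act g z)"
    unfolding k(3) su_act_step[OF g] act_gen by (simp add: k(2) flip_def)
  then have "to_disc (su_act h z) = flip k (to_disc (su_act g z))" by (simp only: to_disc_flip)
  moreover have "to_disc (su_act g z) \<in> arc k" using to_disc_arc_iff[OF k(1)] k(2) by simp
  ultimately have "paired (to_disc (su_act g z)) (to_disc (su_act h z))" by (auto simp: paired_def)
  then show ?case using step.IH embed_paired by simp
qed simp

lemma proj_eqI:
  assumes f: "f \<in> surf_group" "su_act f z \<in> polygon"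
  shows "proj z = embed (to_disc (su_act f z))"
proof -
  define g where "g = (SOME f. f \<in> surf_group \<and> su_act f z \<in> polygon)"
  have g: "g \<in> surf_group" "su_act g z \<in> polygon"
    using someI_ex[of "\<lambda>f. f \<in> surf_group \<and> su_act f z \<in> polygon"] polygon_covers[of z] unfolding g_def by blast+
  have *: "su_act (f \<odot> su_inv g) (su_act g z) = su_act f z"
    using surf_group_su11[OF g(1)] by (simp add: su_act_mult su11_inv su_act_inv)
  have "f \<odot> su_inv g \<in> surf_group" using f g by (simp add: surf_group_mult surf_group_inv)
  then have "embed (to_disc (su_act f z)) = embed (to_disc (su_act g z))"
    using embed_to_disc_polygon[OF g(2), of "f \<odot> su_inv g"] f(2) unfolding * by blast
  then show ?thesis by (simp add: proj_def g_def)
qed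

lemma proj_polygon: "z \<in> polygon \<Longrightarrow> proj z = embed (to_disc z)"
  using proj_eqI[OF surf_group_one, of z] by simp

lemma proj_act: assumes f: "f \<in> surf_group" shows "proj (su_act f z) = proj z"
proof -
  obtain h where h: "h \<in> surf_group" "su_act h (su_act f z) \<in> polygon" using polygon_covers by blast
  have "su_act (h \<odot> f) z = su_act h (su_act f z)" by (rule su_act_mult[OF surf_group_su11[OF f]])
  then show ?thesis using proj_eqI[OF h] proj_eqI[of "h \<odot> f" z] surf_group_mult[OF h(1) f] h(2) by simp
qed

lemma paired_to_disc_orbit:
  assumes "z \<in> polygon" "paired\<^sup>*\<^sup>* (to_disc z) y"
  shows "\<exists>f\<in>surf_group. su_act f z \<in> polygon \<and> to_disc (su_act f z) = y"
  using assms(2)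
proof (induction rule: rtranclp_induct)
  case base
  show ?case using assms(1) surf_group_one by (intro bexI[of _ su_one]) simp_all
next
  case (step x y)
  then obtain f where f: "f \<in> surf_group" "su_act f z \<in> polygon" "to_disc (su_act f z) = x" by blast
  obtain k where k: "x \<in> arc k" "y = flip k x" using step.hyps(2) by (auto simp: paired_def)
  have w: "wall k (su_act f z) = 0" using to_disc_arc_iff[OF f(2)] k(1) f(3) by blast
  have a: "su_act (gen k \<odot> f) z = su_act (gen k) (su_act f z)" by (rule su_act_step[OF f(1)])
  then have "su_act (gen k \<odot> f) z = flip k (su_act f z)"
    unfolding a act_gen by (simp add: w flip_def)
  then have "to_disc (su_act (gen k \<odot> f) z) = y" by (simp only: to_disc_flip f(3) k(2))
  moreover have "su_act (gen k \<odot> f) z \<in> polygon" unfolding a using f(2) w by (rule polygon_gen_zero)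
  ultimately show ?case using surf_group_step[OF f(1)] by blast
qed

text \<open>The converse direction: an identification of boundary points of the disc is realised by
  a generator, so each fibre is a single orbit.\<close>

lemma proj_eq_imp: assumes "proj z = proj w" shows "\<exists>f\<in>surf_group. w = su_act f z"
proof -
  obtain g where g: "g \<in> surf_group" "su_act g z \<in> polygon" using polygon_covers by blast
  obtain h where h: "h \<in> surf_group" "su_act h w \<in> polygon" using polygon_covers by blast
  have e: "embed (to_disc (su_act g z)) = embed (to_disc (su_act h w))"
    using assms proj_eqI[OF g] proj_eqI[OF h] by simp
  have "to_disc (su_act g z) \<in> cball 0 1" using to_disc_polygon g(2) by blast
  then have "paired\<^sup>*\<^sup>* (to_disc (su_act g z)) (to_disc (su_act h w))"
    using e by (intro embed_eq_imp_paired) simp_all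
  then obtain f where f: "f \<in> surf_group" "to_disc (su_act f (su_act g z)) = to_disc (su_act h w)"
    using paired_to_disc_orbit[OF g(2)] by blast
  then have "su_act h w = su_act f (su_act g z)" using to_disc_inj by metis
  then have "w = su_act (su_inv h) (su_act f (su_act g z))"
    using su_act_inv[OF surf_group_su11[OF h(1)], of w] by simp
  also have "\<dots> = su_act (su_inv h \<odot> (f \<odot> g)) z"
    using surf_group_su11 g(1) f(1) surf_group_mult by (simp add: su_act_mult)
  finally show ?thesis using surf_group_mult surf_group_inv g(1) h(1) f(1) by blast
qed

lemma proj_image_polygon: "proj ` polygon = glued_disc"
proof -
  have "proj ` polygon = (\<lambda>z. embed (to_disc z)) ` polygon" using proj_polygon by (intro image_cong) auto
  also have "\<dots> = embed ` (to_disc ` polygon)" by (simp add: image_image)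
  finally show ?thesis by (simp add: to_disc_polygon glued_disc_def)
qed

lemma proj_image: "proj ` UNIV = glued_disc"
proof -
  have "proj z \<in> proj ` polygon" for z
  proof -
    obtain f where "f \<in> surf_group" "su_act f z \<in> polygon" using polygon_covers by blast
    then show ?thesis using proj_act by (metis imageI)
  qed
  then show ?thesis using proj_image_polygon by blast
qed

section \<open>The projection as a covering map\<close>

lemma continuous_on_finite_closed_Union:
  assumes "finite I" "\<And>i. i \<in> I \<Longrightarrow> closed (A i)" "\<And>i. i \<in> I \<Longrightarrow> continuous_on (A i) f"
  shows "continuous_on (\<Union>i\<in>I. A i) f"
  using assms
proof (induction rule: finite_induct)
  case (insert i I)
  then have "continuous_on (A i \<union> (\<Union>i\<in>I. A i)) f"
    by (intro continuous_on_closed_Un closed_UN) auto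
  then show ?case by simp
qed simp

lemma continuous_on_proj: "continuous_on S proj"
proof -
  have "isCont proj z" for z
  proof -
    obtain K where K: "\<And>x. x \<in> polygon \<Longrightarrow> tt x \<le> K" using polygon_bounded by blast
    \<comment> \<open>The finitely many copies of the polygon that can meet the unit ball about
      \<open>z\<close>. They cut it into closed pieces on which \<open>proj\<close> is given by a
      single group element, and continuity follows by pasting.\<close>
    define I where "I = {f \<in> surf_group. \<exists>w. cmod w \<le> cmod z + 1 \<and> tt (su_act f w) \<le> K}"
    define A where "A = (\<lambda>f. cball z 1 \<inter> su_act f -` polygon)"
    have fin: "finite I" unfolding I_def by (rule finite_surf_group_meets)
    have cl: "closed (A f)" for f
      unfolding A_def using compact_imp_closed[OF compact_polygon]
      by (intro closed_Int closed_cball continuous_closed_vimage)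
        (auto intro: continuous_on_interior[OF continuous_on_su_act[of UNIV]])
    have "continuous_on (A f) proj" if "f \<in> I" for f
    proof (rule continuous_on_eq)
      show "continuous_on (A f) (\<lambda>w. embed (to_disc (su_act f w)))"
        by (rule continuous_on_compose2[OF continuous_on_embed[of UNIV]
              continuous_on_compose2[OF continuous_on_to_disc[of UNIV] continuous_on_su_act]]) simp_all
      show "embed (to_disc (su_act f w)) = proj w" if "w \<in> A f" for w
        using that \<open>f \<in> I\<close> proj_eqI[of f w] by (simp add: A_def I_def)
    qed
    then have "continuous_on (\<Union>f\<in>I. A f) proj"
      using fin cl by (intro continuous_on_finite_closed_Union) auto
    moreover have "cball z 1 \<subseteq> (\<Union>f\<in>I. A f)"
    proof
      fix w assume w: "w \<in> cball z 1"
      obtain f where f: "f \<in> surf_group" "su_act f w \<in> polygon" using polygon_covers by blast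
      have "cmod w \<le> cmod z + 1"
        using w norm_triangle_ineq2[of w z] by (simp add: dist_norm norm_minus_commute)
      then have "f \<in> I" using f K by (auto simp: I_def)
      then show "w \<in> (\<Union>f\<in>I. A f)" using f w by (auto simp: A_def)
    qed
    ultimately have "continuous_on (cball z 1) proj" by (rule continuous_on_subset)
    then show ?thesis by (rule continuous_on_interior) simp
  qed
  then show ?thesis by (simp add: continuous_at_imp_continuous_on)
qed

lemma open_su_act_image:
  assumes f: "f \<in> surf_group" and U: "open U"
  shows "open (su_act f ` U)"
proof -
  note F = surf_group_su11[OF f]
  have "su_act f ` U = su_act (su_inv f) -` U"
  proof
    show "su_act f ` U \<subseteq> su_act (su_inv f) -` U" using su_act_inv[OF F] by auto
    show "su_act (su_inv f) -` U \<subseteq> su_act f ` U"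
      using su_act_inv'[OF F] by (metis imageI subsetI vimageE)
  qed
  moreover have "open (su_act (su_inv f) -` U)"
    using U by (intro continuous_open_vimage) (auto intro: continuous_on_interior[OF continuous_on_su_act[of UNIV]])
  ultimately show ?thesis by simp
qed

text \<open>The complement of the image is the image of the compact set of polygon points outside
  the orbit of \<open>U\<close>, hence closed.\<close>

lemma proj_open_map: assumes U: "open U" shows "openin (top_of_set glued_disc) (proj ` U)"
proof -
  define V where "V = (\<Union>f\<in>surf_group. su_act f ` U)"
  have V: "open V" unfolding V_def using open_su_act_image[OF _ U] by blast
  have pV: "proj w \<in> proj ` U \<longleftrightarrow> w \<in> V" for w
  proof
    assume "proj w \<in> proj ` U"
    then obtain u where "u \<in> U" "proj u = proj w" by (metis imageE)
    then show "w \<in> V" unfolding V_def using proj_eq_imp by blast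
  qed (auto simp: V_def proj_act)
  have "glued_disc - proj ` U = proj ` (polygon - V)"
  proof
    show "glued_disc - proj ` U \<subseteq> proj ` (polygon - V)"
    proof
      fix x assume x: "x \<in> glued_disc - proj ` U"
      then obtain w where w: "w \<in> polygon" "x = proj w" unfolding proj_image_polygon[symmetric] by blast
      then have "w \<notin> V" using x pV[of w] by simp
      then show "x \<in> proj ` (polygon - V)" using w by blast
    qed
    show "proj ` (polygon - V) \<subseteq> glued_disc - proj ` U"
    proof
      fix x assume "x \<in> proj ` (polygon - V)"
      then obtain w where w: "w \<in> polygon" "w \<notin> V" "x = proj w" by blast
      then show "x \<in> glued_disc - proj ` U" using pV[of w] proj_image by (simp only: Diff_iff) blast
    qed
  qed
  moreover have "compact (polygon - V)" using compact_polygon V by (rule compact_diff)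
  then have "closed (proj ` (polygon - V))"
    by (intro compact_imp_closed compact_continuous_image continuous_on_proj)
  ultimately have "closedin (top_of_set glued_disc) (glued_disc - proj ` U)"
    by (intro closed_subset) auto
  moreover have "proj ` U \<subseteq> glued_disc" using proj_image by blast
  ultimately show ?thesis by (simp add: openin_closedin)
qed

text \<open>By proper discontinuity only finitely many elements can return a point of the unit ball
  about \<open>z\<close> to that ball. Each of these moves \<open>z\<close> by freeness, so the
  smallest of finitely many radii works.\<close>

lemma displaced_ball:
  "\<exists>e>0. \<forall>f\<in>surf_group. f \<noteq> su_one \<longrightarrow> su_act f ` ball z e \<inter> ball z e = {}"
proof -
  define I where "I = {f \<in> surf_group. \<exists>w. cmod w \<le> cmod z + 1 \<and> tt (su_act f w) \<le> cmod z + 2} - {su_one}"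
  have fin: "finite I" unfolding I_def using finite_surf_group_meets by (rule finite_Diff)
  have "\<exists>e>0. su_act f ` ball z e \<inter> ball z e = {}" if f: "f \<in> I" for f
  proof -
    have "su_act f z \<noteq> z" using surf_group_free[of f z] f by (auto simp: I_def)
    then obtain A B where AB: "open A" "open B" "su_act f z \<in> A" "z \<in> B" "A \<inter> B = {}"
      using separation_t2 by metis
    have "open (su_act f -` A)"
      using AB(1) by (intro continuous_open_vimage) (auto intro: continuous_on_interior[OF continuous_on_su_act[of UNIV]])
    then have "open (su_act f -` A \<inter> B)" using AB(2) by blast
    moreover have "z \<in> su_act f -` A \<inter> B" using AB by simp
    ultimately obtain e where "e > 0" "ball z e \<subseteq> su_act f -` A \<inter> B" using open_contains_ball by blast
    then show ?thesis using AB(5) by blast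
  qed
  then obtain e where e: "\<And>f. f \<in> I \<Longrightarrow> e f > 0 \<and> su_act f ` ball z (e f) \<inter> ball z (e f) = {}" by metis
  define d where "d = Min (insert 1 (e ` I))"
  have d: "d > 0" "d \<le> 1" "\<And>f. f \<in> I \<Longrightarrow> d \<le> e f" unfolding d_def using fin e by auto
  have "su_act f ` ball z d \<inter> ball z d = {}" if f: "f \<in> surf_group" "f \<noteq> su_one" for f
  proof (cases "f \<in> I")
    case True
    have "ball z d \<subseteq> ball z (e f)" using d(3)[OF True] by (rule subset_ball)
    then show ?thesis using e[OF True] by blast
  next
    case False
    have b: "cmod w \<le> cmod z + 1" if "w \<in> ball z d" for w
      using that d(2) norm_triangle_ineq2[of w z] by (simp add: dist_norm norm_minus_commute)
    show ?thesis
    proof (rule ccontr)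
      assume "su_act f ` ball z d \<inter> ball z d \<noteq> {}"
      then obtain w where w: "w \<in> ball z d" "su_act f w \<in> ball z d" by blast
      have "tt (su_act f w) \<le> cmod z + 2" using b[OF w(2)] tt_le[of "su_act f w"] by linarith
      then show False using False f b[OF w(1)] by (auto simp: I_def)
    qed
  qed
  then show ?thesis using d(1) by blast
qed

lemma covering_space_proj: "covering_space UNIV proj glued_disc"
proof
  show "continuous_on UNIV proj" by (rule continuous_on_proj)
  show "proj ` UNIV = glued_disc" by (rule proj_image)
  fix x assume "x \<in> glued_disc"
  then obtain z where z: "x = proj z" using proj_image by blast
  obtain e where "e > 0 \<and> (\<forall>f\<in>surf_group. f \<noteq> su_one \<longrightarrow> su_act f ` ball z e \<inter> ball z e = {})"
    using displaced_ball[of z] ..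
  then have e: "e > 0" and disj: "\<And>f. f \<in> surf_group \<Longrightarrow> f \<noteq> su_one \<Longrightarrow> su_act f ` ball z e \<inter> ball z e = {}"
    by simp_all
  define U where "U = ball z e"
  \<comment> \<open>The sheets over the image of \<open>U\<close> are its translates, pairwise
    disjoint by the choice of the radius.\<close>
  define v where "v = (\<lambda>f. su_act f ` U) ` surf_group"
  have disj': "f = g" if fg: "f \<in> surf_group" "g \<in> surf_group" "a \<in> U" "b \<in> U" "su_act f a = su_act g b" for f g a b
  proof -
    note F = surf_group_su11[OF fg(1)] and G = surf_group_su11[OF fg(2)]
    have "su_act (su_inv g \<odot> f) a = b" using fg(5) su_act_mult[OF F] su_act_inv[OF G] by simp
    moreover have "su_inv g \<odot> f \<in> surf_group" using fg by (simp add: surf_group_mult surf_group_inv)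
    ultimately have "su_inv g \<odot> f = su_one" using disj fg(3,4) unfolding U_def by blast
    then have "g \<odot> (su_inv g \<odot> f) = g" by simp
    then show ?thesis by (simp add: su_mult_assoc[symmetric] su_inv_right[OF G])
  qed
  have h: "\<exists>q. homeomorphism u (proj ` U) proj q" if u: "u \<in> v" for u
  proof -
    obtain f where f: "f \<in> surf_group" "u = su_act f ` U" using u unfolding v_def by blast
    have ou: "open u" using open_su_act_image f by (simp add: U_def)
    show ?thesis
    proof (rule homeomorphism_injective_open_map[of u proj "proj ` U"])
      show "continuous_on u proj" by (rule continuous_on_proj)
      show pu: "proj ` u = proj ` U" using f proj_act by (auto simp: image_image)
      show "inj_on proj u"
      proof (rule inj_onI)
        fix a b assume ab: "a \<in> u" "b \<in> u" "proj a = proj b"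
        then obtain k where k: "k \<in> surf_group" "b = su_act k a" using proj_eq_imp by blast
        obtain a' b' where a': "a' \<in> U" "a = su_act f a'" and b': "b' \<in> U" "b = su_act f b'" using ab f by blast
        have "su_act (k \<odot> f) a' = su_act f b'" using k(2) a' b' su_act_mult[OF surf_group_su11[OF f(1)]] by simp
        then have "k \<odot> f = f" using disj' surf_group_mult k(1) f(1) a' b' by blast
        then have "k \<odot> f \<odot> su_inv f = f \<odot> su_inv f" by simp
        then have "k = su_one" by (simp add: su_mult_assoc su_inv_right[OF surf_group_su11[OF f(1)]])
        then show "a = b" using k(2) by simp
      qed
      fix W assume "openin (top_of_set u) W"
      then have "open W" using ou openin_open_eq by blast
      then have "openin (top_of_set glued_disc) (proj ` W)" by (rule proj_open_map)
      moreover have "W \<subseteq> u" using \<open>openin (top_of_set u) W\<close> openin_imp_subset by blast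
      then have "proj ` W \<subseteq> proj ` U" using pu by blast
      moreover have "proj ` U \<subseteq> glued_disc" using proj_image by blast
      ultimately show "openin (top_of_set (proj ` U)) (proj ` W)"
        by (rule openin_subset_trans)
    qed blast
  qed
  show "\<exists>T. x \<in> T \<and> openin (top_of_set glued_disc) T \<and> (\<exists>v. \<Union> v = UNIV \<inter> proj -` T \<and>
      (\<forall>u\<in>v. openin (top_of_set UNIV) u) \<and> pairwise disjnt v \<and> (\<forall>u\<in>v. \<exists>q. homeomorphism u T proj q))"
  proof (intro exI[of _ "proj ` U"] exI[of _ v] conjI ballI)
    show "x \<in> proj ` U" using z e by (simp add: U_def)
    show "openin (top_of_set glued_disc) (proj ` U)" by (rule proj_open_map) (simp add: U_def)
    show "\<Union> v = UNIV \<inter> proj -` proj ` U"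
    proof
      show "\<Union> v \<subseteq> UNIV \<inter> proj -` proj ` U" using proj_act by (auto simp: v_def)
      show "UNIV \<inter> proj -` proj ` U \<subseteq> \<Union> v"
      proof
        fix w assume "w \<in> UNIV \<inter> proj -` proj ` U"
        then obtain a where "a \<in> U" "proj a = proj w" by (metis IntD2 imageE vimageE)
        then show "w \<in> \<Union> v" using proj_eq_imp[of a w] unfolding v_def by blast
      qed
    qed
    show "openin (top_of_set UNIV) u" if u: "u \<in> v" for u
    proof -
      obtain f where "f \<in> surf_group" "u = su_act f ` U" using u unfolding v_def by blast
      then have "open u" using open_su_act_image[of f U] by (simp add: U_def)
      then show ?thesis by simp
    qed
    show "pairwise disjnt v"
    proof (rule pairwiseI)
      fix u u' assume uu: "u \<in> v" "u' \<in> v" "u \<noteq> u'"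
      then obtain f g where fg: "f \<in> surf_group" "g \<in> surf_group" "u = su_act f ` U" "u' = su_act g ` U"
        unfolding v_def by blast
      then have "f \<noteq> g" using uu(3) by blast
      then show "disjnt u u'" unfolding disjnt_def fg(3,4) using disj'[OF fg(1,2)] by blast
    qed
    show "\<exists>q. homeomorphism u (proj ` U) proj q" if "u \<in> v" for u using that by (rule h)
  qed
qed


section \<open>The fundamental group of the surface\<close>

abbreviation genus3 :: "complex set topology" where
  "genus3 \<equiv> closed_orientable_surface 3"

abbreviation basepoint :: "complex set" where
  "basepoint \<equiv> gluing_class 3 0"

definition model :: "complex set \<Rightarrow> real \<times> real \<times> real \<times> complex \<times> real" where
  "model A = embed (SOME x. x \<in> cball 0 1 \<and> gluing_class 3 x = A)"

lemma model_gluing_class: assumes "x \<in> cball 0 1" shows "model (gluing_class 3 x) = embed x"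
proof -
  define y where "y = (SOME y. y \<in> cball 0 1 \<and> gluing_class 3 y = gluing_class 3 x)"
  have "y \<in> cball 0 1 \<and> gluing_class 3 y = gluing_class 3 x"
    unfolding y_def by (rule someI[of _ x]) (use assms in simp)
  then show ?thesis using gluing_class_eq_iff[of y x] assms by (simp add: model_def y_def)
qed

text \<open>A continuous bijection from a compact space to a Hausdorff space; both properties are
  inherited, one from the disc and one from the ambient Euclidean space.\<close>

lemma model_homeomorphic: "homeomorphic_map genus3 (top_of_set glued_disc) model"
proof (rule continuous_imp_homeomorphic_map)
  have q: "quotient_map (top_of_set (cball 0 1)) genus3 (gluing_class 3)"
    by (rule quotient_map_closed_orientable_surface)
  have "continuous_map (top_of_set (cball 0 1)) (top_of_set glued_disc) embed"
    by (auto simp: continuous_on_embed glued_disc_def)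
  then have "continuous_map (top_of_set (cball 0 1)) (top_of_set glued_disc) (model \<circ> gluing_class 3)"
    by (rule continuous_map_eq) (simp add: model_gluing_class)
  then show "continuous_map genus3 (top_of_set glued_disc) model"
    by (rule continuous_compose_quotient_map[OF q])
  have "compact_space (top_of_set (cball (0::complex) 1))"
    using compact_cball by (simp add: compact_space_subtopology)
  then have "compactin genus3 (gluing_class 3 ` topspace (top_of_set (cball 0 1)))"
    unfolding compact_space_def by (rule image_compactin) (rule quotient_imp_continuous_map[OF q])
  then show "compact_space genus3"
    by (simp add: compact_space_def topspace_closed_orientable_surface)
  show "Hausdorff_space (top_of_set glued_disc)" by (simp add: Hausdorff_space_subtopology)
  show "model ` topspace genus3 = topspace (top_of_set glued_disc)"
    unfolding topspace_closed_orientable_surface glued_disc_def image_image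
    using model_gluing_class by (auto simp: image_iff)
  show "inj_on model (topspace genus3)"
    unfolding topspace_closed_orientable_surface inj_on_def
    using model_gluing_class gluing_class_eq_iff by auto
qed


section \<open>Loops in the surface and paths in its Euclidean model\<close>

lemma zero_in_polygon: "0 \<in> polygon"
  by (simp add: polygon_iff_pgauge)

lemma model_basepoint: "model basepoint = proj 0"
  by (simp add: model_gluing_class proj_polygon[OF zero_in_polygon])

lemma basepoint_topspace: "basepoint \<in> topspace genus3"
  unfolding topspace_closed_orientable_surface by simp

lemma loops_atD:
  assumes "p \<in> loops_at genus3 basepoint"
  shows "path (model \<circ> p)" "path_image (model \<circ> p) \<subseteq> glued_disc"
    "pathstart (model \<circ> p) = proj 0" "pathfinish (model \<circ> p) = proj 0" "\<And>t. t \<in> {0..1} \<Longrightarrow> p t \<in> topspace genus3"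
proof -
  have p: "pathin genus3 p" "p 0 = basepoint" "p 1 = basepoint" using assms by (auto simp: loops_at_def)
  have "pathin (top_of_set glued_disc) (model \<circ> p)"
    using p(1) homeomorphic_imp_continuous_map[OF model_homeomorphic] by (rule pathin_compose)
  then show "path (model \<circ> p)" "path_image (model \<circ> p) \<subseteq> glued_disc"
    by (auto simp: pathin_def path_def path_image_def)
  show "pathstart (model \<circ> p) = proj 0" "pathfinish (model \<circ> p) = proj 0"
    by (simp_all add: pathstart_def pathfinish_def p model_basepoint)
  show "p t \<in> topspace genus3" if "t \<in> {0..1}" for t
    using p(1) that by (auto simp: pathin_def continuous_map_def)
qed

definition unmodel :: "real \<times> real \<times> real \<times> complex \<times> real \<Rightarrow> complex set" where
  "unmodel = (SOME g. homeomorphic_maps genus3 (top_of_set glued_disc) model g)"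

lemma model_unmodel: "homeomorphic_maps genus3 (top_of_set glued_disc) model unmodel"
  unfolding unmodel_def using model_homeomorphic homeomorphic_map_maps by (metis someI_ex)

lemma unmodel_model: "A \<in> topspace genus3 \<Longrightarrow> unmodel (model A) = A"
  and model_unmodel_eq: "x \<in> glued_disc \<Longrightarrow> model (unmodel x) = x"
  and continuous_unmodel: "continuous_map (top_of_set glued_disc) genus3 unmodel"
  and continuous_model: "continuous_map genus3 (top_of_set glued_disc) model"
  using model_unmodel by (auto simp: homeomorphic_maps_def)

lemma unmodel_proj_0: "unmodel (proj 0) = basepoint"
  using unmodel_model[OF basepoint_topspace] by (simp add: model_basepoint)

lemma loops_at_unmodel:
  assumes "path g" "path_image g \<subseteq> glued_disc" "pathstart g = proj 0" "pathfinish g = proj 0"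
  shows "unmodel \<circ> g \<in> loops_at genus3 basepoint"
proof -
  have "pathin (top_of_set glued_disc) g" using assms by (auto simp: pathin_def path_def path_image_def)
  then have "pathin genus3 (unmodel \<circ> g)" using continuous_unmodel by (rule pathin_compose)
  then show ?thesis using assms unmodel_proj_0 by (simp add: loops_at_def pathstart_def pathfinish_def)
qed

lemma loops_atI:
  assumes "path (model \<circ> p)" "path_image (model \<circ> p) \<subseteq> glued_disc" "p 0 = basepoint" "p 1 = basepoint"
    "\<And>t. t \<in> {0..1} \<Longrightarrow> p t \<in> topspace genus3"
  shows "p \<in> loops_at genus3 basepoint"
proof -
  have "unmodel \<circ> (model \<circ> p) \<in> loops_at genus3 basepoint"
    using assms model_basepoint by (intro loops_at_unmodel) (simp_all add: pathstart_def pathfinish_def)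
  then have "pathin genus3 (unmodel \<circ> (model \<circ> p))" by (simp add: loops_at_def)
  then have "pathin genus3 p"
    unfolding pathin_def by (rule continuous_map_eq) (simp add: assms(5) unmodel_model)
  then show ?thesis using assms by (simp add: loops_at_def)
qed

lemma loop_homotopy_iff:
  assumes p: "p \<in> loops_at genus3 basepoint" and q: "q \<in> loops_at genus3 basepoint"
  shows "(p, q) \<in> loop_homotopy genus3 basepoint \<longleftrightarrow> homotopic_paths glued_disc (model \<circ> p) (model \<circ> q)"
proof
  let ?P = "\<lambda>r. r 0 = basepoint \<and> r 1 = basepoint"
  let ?Q = "\<lambda>r. pathstart r = pathstart (model \<circ> p) \<and> pathfinish r = pathfinish (model \<circ> p)"
  assume "(p, q) \<in> loop_homotopy genus3 basepoint"
  then have "homotopic_with ?P (top_of_set {0..1}) genus3 p q" by (simp add: loop_homotopy_def)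
  then have "homotopic_with ?Q (top_of_set {0..1}) (top_of_set glued_disc) (model \<circ> p) (model \<circ> q)"
    using continuous_model
    by (rule homotopic_with_compose_continuous_map_left)
      (simp only: loops_atD[OF p], simp add: pathstart_def pathfinish_def model_basepoint)
  then show "homotopic_paths glued_disc (model \<circ> p) (model \<circ> q)" by (simp add: homotopic_paths_def)
next
  let ?P = "\<lambda>r. r 0 = basepoint \<and> r 1 = basepoint"
  assume "homotopic_paths glued_disc (model \<circ> p) (model \<circ> q)"
  then have "homotopic_with (\<lambda>r. r 0 = proj 0 \<and> r 1 = proj 0) (top_of_set {0..1}) (top_of_set glued_disc) (model \<circ> p) (model \<circ> q)"
    unfolding homotopic_paths_def loops_atD(3,4)[OF p] by (simp add: pathstart_def pathfinish_def)
  then have "homotopic_with ?P (top_of_set {0..1}) genus3 (unmodel \<circ> (model \<circ> p)) (unmodel \<circ> (model \<circ> q))"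
    using continuous_unmodel
    by (rule homotopic_with_compose_continuous_map_left) (simp add: unmodel_proj_0)
  then have "homotopic_with ?P (top_of_set {0..1}) genus3 p q"
  proof (rule homotopic_with_eq)
    show "p t = (unmodel \<circ> (model \<circ> p)) t" if "t \<in> topspace (top_of_set {0..1})" for t
      using that loops_atD(5)[OF p] by (simp add: unmodel_model)
    show "q t = (unmodel \<circ> (model \<circ> q)) t" if "t \<in> topspace (top_of_set {0..1})" for t
      using that loops_atD(5)[OF q] by (simp add: unmodel_model)
  qed auto
  then show "(p, q) \<in> loop_homotopy genus3 basepoint" using p q by (simp add: loop_homotopy_def)
qed

lemma loop_class_eq_iff:
  assumes p: "p \<in> loops_at genus3 basepoint" and q: "q \<in> loops_at genus3 basepoint"
  shows "loop_homotopy genus3 basepoint `` {p} = loop_homotopy genus3 basepoint `` {q}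
    \<longleftrightarrow> homotopic_paths glued_disc (model \<circ> p) (model \<circ> q)"
proof -
  let ?R = "loop_homotopy genus3 basepoint"
  have R: "?R \<subseteq> loops_at genus3 basepoint \<times> loops_at genus3 basepoint" by (auto simp: loop_homotopy_def)
  have "q \<in> ?R `` {q}" using loop_homotopy_iff[OF q q] loops_atD[OF q] by simp
  show ?thesis
  proof
    assume "?R `` {p} = ?R `` {q}"
    then have "(p, q) \<in> ?R" using \<open>q \<in> ?R `` {q}\<close> by blast
    then show "homotopic_paths glued_disc (model \<circ> p) (model \<circ> q)" using loop_homotopy_iff[OF p q] by simp
  next
    assume h: "homotopic_paths glued_disc (model \<circ> p) (model \<circ> q)"
    have "(p, r) \<in> ?R \<longleftrightarrow> (q, r) \<in> ?R" for r
    proof (cases "r \<in> loops_at genus3 basepoint")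
      case True
      show ?thesis unfolding loop_homotopy_iff[OF p True] loop_homotopy_iff[OF q True]
        using h homotopic_paths_sym homotopic_paths_trans by metis
    next
      case False
      then show ?thesis using R by blast
    qed
    then show "?R `` {p} = ?R `` {q}" by blast
  qed
qed

section \<open>Group elements as homotopy classes of loops\<close>

definition deck_loop :: "complex \<times> complex \<Rightarrow> real \<Rightarrow> complex set" where
  "deck_loop f = unmodel \<circ> (proj \<circ> linepath 0 (su_act f 0))"

lemma deck_path:
  assumes "f \<in> surf_group"
  shows "path (proj \<circ> linepath 0 (su_act f 0))" "path_image (proj \<circ> linepath 0 (su_act f 0)) \<subseteq> glued_disc"
    "pathstart (proj \<circ> linepath 0 (su_act f 0)) = proj 0" "pathfinish (proj \<circ> linepath 0 (su_act f 0)) = proj 0"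
  using proj_image proj_act[OF assms]
  by (auto intro!: path_continuous_image continuous_on_proj simp: path_image_compose pathstart_compose pathfinish_compose)

lemma deck_loop_loops_at: "f \<in> surf_group \<Longrightarrow> deck_loop f \<in> loops_at genus3 basepoint"
  unfolding deck_loop_def using deck_path by (intro loops_at_unmodel)

lemma model_deck_loop:
  assumes "f \<in> surf_group"
  shows "model \<circ> deck_loop f = proj \<circ> linepath 0 (su_act f 0)"
  using proj_image by (auto simp: deck_loop_def fun_eq_iff intro!: model_unmodel_eq)

text \<open>The coordinate plane is convex, so upstairs only the end points of a path
  matter.\<close>

lemma homotopic_paths_plane:
  fixes g h :: "real \<Rightarrow> complex"
  assumes "path g" "path h" "pathstart g = pathstart h" "pathfinish g = pathfinish h"
  shows "homotopic_paths glued_disc (proj \<circ> g) (proj \<circ> h)"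
proof (rule homotopic_paths_continuous_image)
  show "homotopic_paths UNIV g h" using assms by (intro homotopic_paths_linear) auto
  show "continuous_on UNIV proj" by (rule continuous_on_proj)
  show "proj \<in> UNIV \<rightarrow> glued_disc" using proj_image by blast
qed

definition deck_class :: "complex \<times> complex \<Rightarrow> (real \<Rightarrow> complex set) set" where
  "deck_class f = loop_homotopy genus3 basepoint `` {deck_loop f}"

text \<open>By monodromy, lifts from 0 of homotopic loops end at the same point, and by freeness
  that point of the orbit of 0 determines the group element.\<close>

lemma deck_class_inj: "inj_on deck_class surf_group"
proof (rule inj_onI)
  fix f g assume f: "f \<in> surf_group" and g: "g \<in> surf_group" and "deck_class f = deck_class g"
  then have h: "homotopic_paths glued_disc (proj \<circ> linepath 0 (su_act f 0)) (proj \<circ> linepath 0 (su_act g 0))"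
    using loop_class_eq_iff[OF deck_loop_loops_at[OF f] deck_loop_loops_at[OF g]]
    by (simp add: deck_class_def model_deck_loop f g)
  have "pathfinish (linepath 0 (su_act f 0)) = pathfinish (linepath 0 (su_act g 0))"
    by (rule covering_space_monodromy[OF covering_space_proj deck_path(1,2)[OF f] deck_path(1,2)[OF g] h]) auto
  then have "su_act f 0 = su_act g 0" by simp
  then have "su_act (su_inv g \<odot> f) 0 = 0"
    using surf_group_su11[OF f] su_act_inv[OF surf_group_su11[OF g]] by (simp add: su_act_mult)
  then have "su_inv g \<odot> f = su_one" using surf_group_free surf_group_mult surf_group_inv f g by blast
  then have "g \<odot> (su_inv g \<odot> f) = g" by simp
  then show "f = g" by (simp add: su_mult_assoc[symmetric] su_inv_right[OF surf_group_su11[OF g]])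
qed

text \<open>The lift of a loop from 0 ends in the orbit of 0, and there it can be replaced by the
  straight segment.\<close>

lemma deck_class_surj: "deck_class ` surf_group = carrier (fundamental_group genus3 basepoint)"
proof
  show "deck_class ` surf_group \<subseteq> carrier (fundamental_group genus3 basepoint)"
    using deck_loop_loops_at by (auto simp: fundamental_group_def deck_class_def quotient_def)
  show "carrier (fundamental_group genus3 basepoint) \<subseteq> deck_class ` surf_group"
  proof
    fix A assume "A \<in> carrier (fundamental_group genus3 basepoint)"
    then obtain p where p: "p \<in> loops_at genus3 basepoint" "A = loop_homotopy genus3 basepoint `` {p}"
      by (auto simp: fundamental_group_def quotient_def)
    have "\<exists>h. path h \<and> pathstart h = 0 \<and> (\<forall>t\<in>{0..1}. proj (h t) = (model \<circ> p) t)"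
    proof (rule covering_space_lift_path_strong[OF covering_space_proj UNIV_I loops_atD(1,2,3)[OF p(1)]])
      fix h assume h: "path h" "pathstart h = 0" "\<And>t. t \<in> {0..1} \<Longrightarrow> proj (h t) = (model \<circ> p) t"
      show ?thesis by (intro exI[of _ h] conjI ballI h)
    qed
    then obtain h where h: "path h" "pathstart h = 0" "\<forall>t\<in>{0..1}. proj (h t) = (model \<circ> p) t" by blast
    have "proj (pathfinish h) = proj 0"
      using h(3) loops_atD(4)[OF p(1)] by (simp add: pathfinish_def)
    then obtain f where f: "f \<in> surf_group" "pathfinish h = su_act f 0" using proj_eq_imp by metis
    have "homotopic_paths glued_disc (model \<circ> p) (proj \<circ> h)"
      using h(3) by (intro homotopic_paths_eq loops_atD[OF p(1)]) simp
    moreover have "homotopic_paths glued_disc (proj \<circ> h) (proj \<circ> linepath 0 (su_act f 0))"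
      using h f by (intro homotopic_paths_plane) simp_all
    ultimately have "homotopic_paths glued_disc (model \<circ> p) (model \<circ> deck_loop f)"
      unfolding model_deck_loop[OF f(1)] by (rule homotopic_paths_trans)
    then have "A = deck_class f"
      using loop_class_eq_iff[OF p(1) deck_loop_loops_at[OF f(1)]] p(2) by (simp add: deck_class_def)
    then show "A \<in> deck_class ` surf_group" using f(1) by blast
  qed
qed

lemma model_concat: "model \<circ> concat_paths p q = (model \<circ> p) +++ (model \<circ> q)"
  by (auto simp: concat_paths_def joinpaths_def fun_eq_iff)

lemma concat_loops_at:
  assumes p: "p \<in> loops_at genus3 basepoint" and q: "q \<in> loops_at genus3 basepoint"
  shows "concat_paths p q \<in> loops_at genus3 basepoint"
proof (rule loops_atI)
  show "path (model \<circ> concat_paths p q)" "path_image (model \<circ> concat_paths p q) \<subseteq> glued_disc"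
    unfolding model_concat using loops_atD[OF p] loops_atD[OF q] by (auto simp: path_image_join)
  show "concat_paths p q 0 = basepoint" "concat_paths p q 1 = basepoint"
    using p q by (simp_all add: concat_paths_def loops_at_def)
  show "concat_paths p q t \<in> topspace genus3" if "t \<in> {0..1}" for t
    using that loops_atD(5)[OF p, of "2 * t"] loops_atD(5)[OF q, of "2 * t - 1"] by (auto simp: concat_paths_def)
qed

lemma deck_class_mult:
  assumes f: "f \<in> surf_group" and g: "g \<in> surf_group"
  shows "deck_class (f \<odot> g) = deck_class f \<otimes>\<^bsub>fundamental_group genus3 basepoint\<^esub> deck_class g"
proof -
  let ?R = "loop_homotopy genus3 basepoint"
  note fg = surf_group_mult[OF f g]
  have cls: "?R `` {concat_paths p q} = deck_class (f \<odot> g)" if pq: "p \<in> deck_class f" "q \<in> deck_class g" for p q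
  proof -
    have pl: "p \<in> loops_at genus3 basepoint" and ql: "q \<in> loops_at genus3 basepoint"
      and "(deck_loop f, p) \<in> ?R" "(deck_loop g, q) \<in> ?R"
      using pq by (auto simp: deck_class_def loop_homotopy_def)
    then have h: "homotopic_paths glued_disc (proj \<circ> linepath 0 (su_act f 0)) (model \<circ> p)"
      "homotopic_paths glued_disc (proj \<circ> linepath 0 (su_act g 0)) (model \<circ> q)"
      using loop_homotopy_iff[OF deck_loop_loops_at[OF f] pl] loop_homotopy_iff[OF deck_loop_loops_at[OF g] ql]
      by (simp_all add: model_deck_loop f g)
    \<comment> \<open>Translating the second segment by \<open>f\<close> does not change its
      projection, but makes it start where the first one ends. The concatenation then runs from 0 to
      the image of 0 under \<open>f \<odot> g\<close>.\<close>
    have "proj \<circ> linepath 0 (su_act g 0) = proj \<circ> (su_act f \<circ> linepath 0 (su_act g 0))"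
      using proj_act[OF f] by (simp add: fun_eq_iff)
    then have "homotopic_paths glued_disc (proj \<circ> (linepath 0 (su_act f 0) +++ (su_act f \<circ> linepath 0 (su_act g 0))))
        (model \<circ> concat_paths p q)"
      unfolding model_concat path_compose_join
      using h deck_path[OF f] deck_path[OF g] by (intro homotopic_paths_join) simp_all
    moreover have "homotopic_paths glued_disc (proj \<circ> linepath 0 (su_act (f \<odot> g) 0))
        (proj \<circ> (linepath 0 (su_act f 0) +++ (su_act f \<circ> linepath 0 (su_act g 0))))"
    proof (rule homotopic_paths_plane)
      have "path (su_act f \<circ> linepath 0 (su_act g 0))"
        by (intro path_continuous_image continuous_on_su_act) simp
      then show "path (linepath 0 (su_act f 0) +++ (su_act f \<circ> linepath 0 (su_act g 0)))"
        by (intro path_join_imp) (simp_all add: pathstart_compose)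
    qed (simp_all add: pathfinish_compose su_act_mult[OF surf_group_su11[OF g]])
    ultimately have "homotopic_paths glued_disc (model \<circ> deck_loop (f \<odot> g)) (model \<circ> concat_paths p q)"
      unfolding model_deck_loop[OF fg] using homotopic_paths_trans by blast
    then show ?thesis
      using loop_class_eq_iff[OF deck_loop_loops_at[OF fg] concat_loops_at[OF pl ql]] by (simp add: deck_class_def)
  qed
  have ne: "deck_loop f \<in> deck_class f" if f: "f \<in> surf_group" for f
    using loop_homotopy_iff[OF deck_loop_loops_at[OF f] deck_loop_loops_at[OF f]] loops_atD[OF deck_loop_loops_at[OF f]]
    by (simp add: deck_class_def)
  have "deck_class f \<otimes>\<^bsub>fundamental_group genus3 basepoint\<^esub> deck_class g
      = (\<Union>p\<in>deck_class f. \<Union>q\<in>deck_class g. ?R `` {concat_paths p q})"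
    by (simp add: fundamental_group_def)
  also have "\<dots> = (\<Union>p\<in>deck_class f. \<Union>q\<in>deck_class g. deck_class (f \<odot> g))" using cls by simp
  also have "\<dots> = deck_class (f \<odot> g)" using ne[OF f] ne[OF g] by blast
  finally show ?thesis by simp
qed


section \<open>Linear algebra in the hermitian space\<close>

lemma UNIV_type3: "(UNIV :: 3 set) = {0, 1, 2}"
proof -
  have "(3 :: 3) = 0" by simp
  then show ?thesis using UNIV_3 by auto
qed

lemma type3_cases: "i = 0 \<or> i = 1 \<or> i = (2 :: 3)"
  using UNIV_type3 UNIV_I[of i] by blast

definition fam3 :: "'b \<Rightarrow> 'b \<Rightarrow> 'b \<Rightarrow> 3 \<Rightarrow> 'b" where
  "fam3 x y z i = (if i = 0 then x else if i = 1 then y else z)"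

lemma fam3_simps [simp]: "fam3 x y z 0 = x" "fam3 x y z 1 = y" "fam3 x y z 2 = z"
  by (simp_all add: fam3_def)

lemma range_fam3: "range (fam3 x y z) = {x, y, z}"
  unfolding UNIV_type3 by (simp add: image_insert)

context vector_space
begin

lemma independent_fam3:
  assumes zero: "\<And>c d e. scale c x + scale d y + scale e z = 0 \<Longrightarrow> c = 0 \<and> d = 0 \<and> e = 0"
  shows "inj (fam3 x y z)" "independent {x, y, z}"
proof -
  have d: "x \<noteq> y" "x \<noteq> z" "y \<noteq> z"
    using zero[of 1 "-1" 0] zero[of 1 0 "-1"] zero[of 0 1 "-1"] by auto
  show "inj (fam3 x y z)"
  proof (rule injI)
    fix i j assume "fam3 x y z i = fam3 x y z j"
    then show "i = j" using d type3_cases[of i] type3_cases[of j] by auto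
  qed
  show "independent {x, y, z}"
  proof (rule independent_if_scalars_zero)
    fix f v assume "(\<Sum>v\<in>{x, y, z}. scale (f v) v) = 0" and v: "v \<in> {x, y, z}"
    then have "scale (f x) x + scale (f y) y + scale (f z) z = 0" using d by (simp add: add.assoc)
    from zero[OF this] v show "f v = 0" by auto
  qed simp
qed

lemma is_basis_fam3:
  assumes zero: "\<And>c d e. scale c x + scale d y + scale e z = 0 \<Longrightarrow> c = 0 \<and> d = 0 \<and> e = 0"
    and gen: "\<And>v. \<exists>c d e. v = scale c x + scale d y + scale e z"
  shows "is_basis (fam3 x y z)"
proof -
  have "v \<in> span {x, y, z}" for v
  proof -
    obtain c d e where v: "v = scale c x + scale d y + scale e z" using gen by blast
    show ?thesis unfolding v by (intro span_add span_scale span_base) auto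
  qed
  then show ?thesis using independent_fam3[OF zero] unfolding is_basis_def range_fam3 by blast
qed

text \<open>Rows refer to the target basis \<open>e\<close> and columns to the source basis
  \<open>e'\<close>. For \<open>f = id\<close> this is the matrix of a change of basis.\<close>

definition matrix_between :: "('n::finite \<Rightarrow> 'b) \<Rightarrow> ('n \<Rightarrow> 'b) \<Rightarrow> ('b \<Rightarrow> 'b) \<Rightarrow> 'a ^ 'n ^ 'n" where
  "matrix_between e e' f = (\<chi> i j. representation (range e) (f (e' j)) (e i))"

end

context vector_space
begin

lemma matrix_of_between: "matrix_of e f = matrix_between e e f"
  by (simp add: matrix_of_def matrix_between_def)

lemma basis_expansion:
  assumes "is_basis (e :: 'n::finite \<Rightarrow> 'b)"
  shows "v = (\<Sum>k\<in>UNIV. scale (representation (range e) v (e k)) (e k))"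
proof -
  have e: "inj e" "independent (range e)" "span (range e) = UNIV" using assms by (auto simp: is_basis_def)
  have "v = (\<Sum>b\<in>range e. scale (representation (range e) v b) b)"
    by (rule sum_representation_eq[symmetric]) (use e in auto)
  also have "\<dots> = (\<Sum>k\<in>UNIV. scale (representation (range e) v (e k)) (e k))"
    by (subst sum.reindex[OF e(1)]) simp
  finally show ?thesis .
qed

lemma matrix_between_comp:
  fixes e e' e'' :: "'n::finite \<Rightarrow> 'b"
  assumes e: "is_basis e" "is_basis e'" and f: "Vector_Spaces.linear scale scale f"
  shows "matrix_between e e'' (f \<circ> g) = matrix_between e e' f ** matrix_between e' e'' g"
proof -
  have sp: "independent (range e)" "\<And>v. v \<in> span (range e)" using e by (auto simp: is_basis_def)
  interpret f: Vector_Spaces.linear scale scale f by (rule f)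
  have *: "representation (range e) (f v) (e i)
      = (\<Sum>k\<in>UNIV. representation (range e) (f (e' k)) (e i) * representation (range e') v (e' k))" for v i
  proof -
    have "f v = (\<Sum>k\<in>UNIV. scale (representation (range e') v (e' k)) (f (e' k)))"
      by (subst basis_expansion[OF e(2), of v]) (simp add: f.sum f.scale)
    then have "representation (range e) (f v)
       = (\<lambda>b. \<Sum>k\<in>UNIV. representation (range e) (scale (representation (range e') v (e' k)) (f (e' k))) b)"
      using sp by (simp add: representation_sum)
    then show ?thesis using sp by (simp add: representation_scale mult.commute)
  qed
  show ?thesis
    unfolding matrix_between_def matrix_matrix_mult_def by (simp only: vec_eq_iff vec_lambda_beta o_apply) (intro allI *)
qed

lemma matrix_between_id:
  assumes "is_basis e"
  shows "matrix_between e e id = mat 1"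
proof -
  have "inj e" "independent (range e)" using assms by (auto simp: is_basis_def)
  then show ?thesis
    by (auto simp: matrix_between_def mat_def vec_eq_iff representation_basis inj_eq)
qed

lemma matrix_of_change_basis:
  fixes e e' :: "'n::finite \<Rightarrow> 'b"
  assumes "is_basis e" "is_basis e'" "Vector_Spaces.linear scale scale f"
  shows "matrix_of e' f = matrix_between e' e id ** matrix_of e f ** matrix_between e e' id"
proof -
  have "matrix_between e' e' (id \<circ> (f \<circ> id)) = matrix_between e' e id ** (matrix_between e e f ** matrix_between e e' id)"
    using assms linear_id by (simp only: matrix_between_comp)
  then show ?thesis by (simp add: matrix_of_between matrix_mul_assoc)
qed

lemma matrix_between_inverse:
  fixes e e' :: "'n::finite \<Rightarrow> 'b"
  assumes "is_basis e" "is_basis e'"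
  shows "matrix_between e' e id ** matrix_between e e' id = mat 1"
  using matrix_between_comp[OF assms(2,1) linear_id, of e' id] matrix_between_id[OF assms(2)] by simp

text \<open>\<open>determinant\<close> refers to an arbitrarily chosen basis, so it becomes
  computable only through this invariance.\<close>

lemma det_matrix_of_change_basis:
  fixes e e' :: "'n::finite \<Rightarrow> 'b"
  assumes "is_basis e" "is_basis e'" "Vector_Spaces.linear scale scale f"
  shows "det (matrix_of e' f) = det (matrix_of e f)"
proof -
  have "det (matrix_between e' e id) * det (matrix_between e e' id) = 1"
    using matrix_between_inverse[OF assms(1,2)] by (metis det_I det_mul)
  then show ?thesis
    unfolding matrix_of_change_basis[OF assms] det_mul by (simp add: mult.commute mult.left_commute)
qed

lemma matrix_of_eigenbasis:
  assumes "is_basis e" "\<And>j. f (e j) = scale (m j) (e j)"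
  shows "matrix_of e f = (\<chi> i j. if i = j then m j else 0)"
proof -
  have e: "inj e" "independent (range e)" "\<And>v. v \<in> span (range e)" using assms by (auto simp: is_basis_def)
  then show ?thesis
    by (auto simp: matrix_of_def vec_eq_iff assms(2) representation_scale representation_basis inj_eq)
qed

end

lemma diag3_eq: "(\<chi> i j. if i = j then fam3 a b c j else 0) = diag3 a b c"
  by (auto simp: diag3_def fam3_def vec_eq_iff)

lemma det_diag3: "det (diag3 a b c) = a * b * c"
proof -
  have "det (diag3 a b c) = (\<Prod>i\<in>UNIV. diag3 a b c $ i $ i)"
    by (rule det_diagonal) (simp add: diag3_def)
  then show ?thesis unfolding UNIV_type3 by (simp add: diag3_def mult.assoc)
qed

section \<open>Orthonormal frames and the representation of SU(1,1)\<close>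

context hermitian_space
begin

lemma form_add_right: "form z (x + y) = form z x + form z y"
  by (metis complex_cnj_add form_add form_cnj)

lemma form_scale_right: "form z (a *\<^sub>C x) = cnj a * form z x"
  by (metis complex_cnj_mult form_cnj form_scale)

lemma form_zero [simp]: "form 0 z = 0" "form z 0 = 0"
  using form_scale[of 0 0 z] form_scale_right[of z 0 0] by simp_all

lemma form_self_real: "form x x = of_real (Re (form x x))"
  using form_cnj[of x x] by (simp add: complex_eq_iff)

lemma form_eq_0_sym: "form x y = 0 \<Longrightarrow> form y x = 0"
  using form_cnj[of y x] by simp

end

text \<open>The form is diagonal with entries 1, 1, -1. The expansion in terms of
  \<open>form\<close> replaces the abstract coordinates of a basis, and the minus sign at
  \<open>b2\<close> comes from \<open>form b2 b2 = -1\<close>.\<close>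

locale framed_space = hermitian_space scale form
  for scale :: "complex \<Rightarrow> 'v::ab_group_add \<Rightarrow> 'v" (infixr \<open>*\<^sub>C\<close> 75) and form +
  fixes b0 b1 b2 :: 'v
  assumes form_b: "form b0 b0 = 1" "form b1 b1 = 1" "form b2 b2 = -1" "form b0 b1 = 0" "form b0 b2 = 0" "form b1 b2 = 0"
    and frame_expansion: "v = form v b0 *\<^sub>C b0 + form v b1 *\<^sub>C b1 + (- form v b2) *\<^sub>C b2"
begin

definition vec :: "complex \<Rightarrow> complex \<Rightarrow> complex \<Rightarrow> 'v" where
  "vec c u w = c *\<^sub>C b0 + u *\<^sub>C b1 + w *\<^sub>C b2"

lemma form_vec: "form (vec c u w) (vec c' u' w') = c * cnj c' + u * cnj u' - w * cnj w'"
  using form_b form_eq_0_sym[OF form_b(4)] form_eq_0_sym[OF form_b(5)] form_eq_0_sym[OF form_b(6)]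
  by (simp add: vec_def form_add form_scale form_add_right form_scale_right)

lemma vec_coords: "v = vec (form v b0) (form v b1) (- form v b2)"
  using frame_expansion unfolding vec_def .

lemma vec_b: "vec 1 0 0 = b0" "vec 0 1 0 = b1" "vec 0 0 1 = b2"
  by (simp_all add: vec_def)

lemma scale_b0: "c *\<^sub>C b0 = vec c 0 0"
  by (simp add: vec_def)

lemma form_vec_b: "form (vec c u w) b0 = c" "form (vec c u w) b1 = u" "form (vec c u w) b2 = - w"
  using form_vec[of c u w 1 0 0] form_vec[of c u w 0 1 0] form_vec[of c u w 0 0 1] by (simp_all add: vec_b)

lemma form_b0_vec: "form b0 (vec c u w) = cnj c"
  using form_vec[of 1 0 0 c u w] by (simp add: vec_b)

lemma vec_eq: "vec c u w = vec c' u' w' \<longleftrightarrow> c = c' \<and> u = u' \<and> w = w'"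
  by (metis form_vec_b neg_equal_iff_equal)

lemma vec_eq_0: "vec c u w = 0 \<longleftrightarrow> c = 0 \<and> u = 0 \<and> w = 0"
  using vec_eq[of c u w 0 0 0] by (simp add: vec_def)

lemma vec_add: "vec c u w + vec c' u' w' = vec (c + c') (u + u') (w + w')"
  by (simp add: vec_def scale_left_distrib algebra_simps)

lemma vec_scale: "a *\<^sub>C vec c u w = vec (a * c) (a * u) (a * w)"
  by (simp add: vec_def scale_right_distrib)

lemma vec_cases: obtains c u w where "v = vec c u w"
  using vec_coords by blast

lemma basis_vec:
  assumes D: "u1 * w2 - u2 * w1 \<noteq> 0"
  shows "is_basis (fam3 b0 (vec 0 u1 w1) (vec 0 u2 w2))"
proof (rule is_basis_fam3)
  have lc: "c *\<^sub>C b0 + d *\<^sub>C vec 0 u1 w1 + e *\<^sub>C vec 0 u2 w2 = vec c (d * u1 + e * u2) (d * w1 + e * w2)" for c d e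
    unfolding scale_b0 vec_scale vec_add by simp
  fix c d e assume "c *\<^sub>C b0 + d *\<^sub>C vec 0 u1 w1 + e *\<^sub>C vec 0 u2 w2 = 0"
  then have c: "c = 0" "d * u1 + e * u2 = 0" "d * w1 + e * w2 = 0" unfolding lc vec_eq_0 by simp_all
  then have "d * (u1 * w2 - u2 * w1) = 0" "e * (u1 * w2 - u2 * w1) = 0" by algebra+
  then show "c = 0 \<and> d = 0 \<and> e = 0" using c(1) D by simp
next
  have lc: "c *\<^sub>C b0 + d *\<^sub>C vec 0 u1 w1 + e *\<^sub>C vec 0 u2 w2 = vec c (d * u1 + e * u2) (d * w1 + e * w2)" for c d e
    unfolding scale_b0 vec_scale vec_add by simp
  fix v
  obtain c u w where v: "v = vec c u w" using vec_cases by blast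
  define d e where "d = (u * w2 - u2 * w) / (u1 * w2 - u2 * w1)" and "e = (u1 * w - u * w1) / (u1 * w2 - u2 * w1)"
  have "d * u1 + e * u2 = u" "d * w1 + e * w2 = w"
    using D by (simp_all add: d_def e_def divide_simps) (algebra+)
  then have "v = c *\<^sub>C b0 + d *\<^sub>C vec 0 u1 w1 + e *\<^sub>C vec 0 u2 w2" unfolding lc v by simp
  then show "\<exists>c d e. v = c *\<^sub>C b0 + d *\<^sub>C vec 0 u1 w1 + e *\<^sub>C vec 0 u2 w2" by blast
qed

lemma basis_frame: "is_basis (fam3 b0 b1 b2)"
  using basis_vec[of 1 1 0 0] unfolding vec_b by simp

abbreviation some_basis :: "3 \<Rightarrow> 'v" where
  "some_basis \<equiv> SOME e. is_basis e"

lemma some_basis: "is_basis some_basis"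
  using basis_frame by (rule someI[of is_basis])

text \<open>The block matrix with entry 1 on \<open>b0\<close> and the matrix of \<open>f\<close> on
  \<open>b1, b2\<close>. The signs arise because the coordinate along \<open>b2\<close> is
  \<open>- form v b2\<close>.\<close>

definition rep :: "complex \<times> complex \<Rightarrow> 'v \<Rightarrow> 'v" where
  "rep f v = vec (form v b0) (fst f * form v b1 - snd f * form v b2) (cnj (snd f) * form v b1 - cnj (fst f) * form v b2)"

lemma rep_vec: "rep f (vec c u w) = vec c (fst f * u + snd f * w) (cnj (snd f) * u + cnj (fst f) * w)"
  by (simp add: rep_def form_vec_b)

lemma rep_b0: "rep f b0 = b0"
  using rep_vec[of f 1 0 0] by (simp add: vec_b)

lemma rep_mult: "rep (f \<odot> g) = rep f \<circ> rep g"
proof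
  fix v
  obtain c u w where v: "v = vec c u w" using vec_cases by blast
  show "rep (f \<odot> g) v = (rep f \<circ> rep g) v"
    by (simp add: v rep_vec vec_eq su_mult_def algebra_simps)
qed

lemma rep_one: "rep su_one = id"
proof
  fix v
  obtain c u w where v: "v = vec c u w" using vec_cases by blast
  show "rep su_one v = id v" by (simp add: v rep_vec su_one_def)
qed

lemma rep_linear: "Vector_Spaces.linear scale scale (rep f)"
  unfolding Vector_Spaces.linear_iff
proof (intro conjI allI)
  fix x y c
  obtain c1 u1 w1 c2 u2 w2 where v: "x = vec c1 u1 w1" "y = vec c2 u2 w2" using vec_cases by metis
  show "rep f (x + y) = rep f x + rep f y" by (simp add: v vec_add rep_vec vec_eq algebra_simps)
  show "rep f (c *\<^sub>C x) = c *\<^sub>C rep f x" by (simp add: v vec_scale rep_vec vec_eq algebra_simps)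
qed (rule vector_space_axioms)+

lemma rep_add: "rep f (x + y) = rep f x + rep f y" and rep_scale: "rep f (c *\<^sub>C x) = c *\<^sub>C rep f x"
  using rep_linear[of f] unfolding Vector_Spaces.linear_iff by blast+

lemma rep_inv: "f \<in> su11 \<Longrightarrow> rep (su_inv f) (rep f x) = x" "f \<in> su11 \<Longrightarrow> rep f (rep (su_inv f) x) = x"
  using rep_mult[of "su_inv f" f] rep_mult[of f "su_inv f"]
  by (simp_all add: su_inv_left su_inv_right rep_one fun_eq_iff)

lemma rep_bij: "f \<in> su11 \<Longrightarrow> bij (rep f)"
  by (rule o_bij[of "rep (su_inv f)"]) (simp_all add: fun_eq_iff rep_inv)

lemma rep_form: assumes "f \<in> su11" shows "form (rep f x) (rep f y) = form x y"
proof -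
  obtain c1 u1 w1 c2 u2 w2 where v: "x = vec c1 u1 w1" "y = vec c2 u2 w2" using vec_cases by metis
  have "fst f * cnj (fst f) = snd f * cnj (snd f) + 1" using assms by (simp add: su11_def)
  then show ?thesis
    unfolding v rep_vec form_vec complex_cnj_add complex_cnj_mult complex_cnj_cnj by algebra
qed

lemma rep_inj: "rep f = rep g \<Longrightarrow> f = g"
proof -
  assume "rep f = rep g"
  then have "rep f (vec 0 1 0) = rep g (vec 0 1 0)" by simp
  then show "f = g" by (simp add: rep_vec vec_eq prod_eq_iff)
qed

text \<open>It recovers the first entry of \<open>f\<close> from a matrix coefficient, which carries
  finiteness over from SU(1,1) to matrices of \<open>SU\<close>.\<close>

lemma rep_entry: "matrix_of (fam3 b0 b1 b2) (rep f) $ 1 $ 1 = fst f"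
proof -
  let ?B = "range (fam3 b0 b1 b2)"
  have ind: "independent ?B" and sp: "\<And>v. v \<in> span ?B" and inj: "inj (fam3 b0 b1 b2)"
    using basis_frame by (auto simp: is_basis_def)
  have "b0 \<noteq> b1" "b2 \<noteq> b1" using vec_eq[of 1 0 0 0 1 0] vec_eq[of 0 0 1 0 1 0] by (auto simp: vec_b)
  moreover have "representation ?B b0 = (\<lambda>v. if v = b0 then 1 else 0)"
    "representation ?B b1 = (\<lambda>v. if v = b1 then 1 else 0)" "representation ?B b2 = (\<lambda>v. if v = b2 then 1 else 0)"
    using ind by (intro representation_basis; simp add: range_fam3)+
  ultimately have "representation ?B (vec 0 u w) b1 = u" for u w
    unfolding vec_def using ind sp by (simp add: representation_add representation_scale)
  moreover have "rep f b1 = vec 0 (fst f) (cnj (snd f))" using rep_vec[of f 0 1 0] by (simp add: vec_b)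
  ultimately show ?thesis by (simp add: matrix_of_def)
qed

end


subsection \<open>Elements of the surface group are hyperbolic\<close>

text \<open>Otherwise \<open>f\<close> would have a fixed point in the plane: arithmetic reduces
  trace \<plusminus>2 to \<plusminus>1, which fixes 0, and a smaller trace means a rotation.\<close>

lemma surf_group_trace:
  assumes f: "f \<in> surf_group" "f \<noteq> su_one"
  shows "\<bar>Re (fst f)\<bar> > 1"
proof (rule ccontr)
  assume "\<not> ?thesis"
  then have le: "\<bar>Re (fst f)\<bar> \<le> 1" by simp
  note F = surf_group_su11[OF f(1)]
  have ne: "su_act f z \<noteq> z" for z using surf_group_free f by blast
  show False
  proof (cases "\<bar>Re (fst f)\<bar> = 1")
    case True
    have "f = (of_real (Re (fst f)), 0)" using surf_group_not_parabolic f(1) True .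
    moreover have "Re (fst f) * Re (fst f) = 1" using True by (metis abs_mult_self_eq mult_1)
    ultimately have "su_act f 0 = 0" by (metis complex_cnj_zero_iff fst_conv mult_zero_right power_zero_numeral snd_conv su_act_def add_0 mult_zero_left)
    then show False using ne by blast
  next
    case False
    define x y b where "x = Re (fst f)" and "y = Im (fst f)" and "b = snd f"
    have x: "x\<^sup>2 < 1" using le False by (simp add: x_def abs_square_less_1)
    have n: "x\<^sup>2 + y\<^sup>2 = (cmod b)\<^sup>2 + 1" using F unfolding su11_cmod x_def y_def b_def cmod_power2 .
    have y: "y \<noteq> 0" using n x zero_le_power2[of "cmod b"] by auto
    text \<open>The fixed point is spanned by the imaginary part of the matrix \<open>f\<close>, a timelike element of the Lie algebra.\<close>
    define l where "l = sgn y / sqrt (1 - x\<^sup>2)"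
    have l2: "l\<^sup>2 * (1 - x\<^sup>2) = 1" using x y by (simp add: l_def power_divide sgn_real_def)
    have ly: "l * y > 0" using y x by (simp add: l_def sgn_real_def)
    have "1 + (cmod (of_real l * \<i> * b))\<^sup>2 = (l * y)\<^sup>2"
    proof -
      have "(cmod (of_real l * \<i> * b))\<^sup>2 = l\<^sup>2 * (cmod b)\<^sup>2" by (simp add: norm_mult power_mult_distrib)
      also have "(cmod b)\<^sup>2 = y\<^sup>2 - (1 - x\<^sup>2)" using n by simp
      finally show ?thesis using l2 by (simp add: algebra_simps power_mult_distrib)
    qed
    then have t: "tt (of_real l * \<i> * b) = l * y" unfolding tt_def using ly by simp
    have a: "fst f = of_real x + \<i> * of_real y" by (simp add: x_def y_def complex_eq_iff)
    have nc: "(of_real x + \<i> * of_real y) * (of_real x - \<i> * of_real y) = b * cnj b + (1::complex)"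
    proof -
      have ca: "cnj (fst f) = of_real x - \<i> * of_real y" by (simp add: x_def y_def complex_eq_iff)
      have "fst f * cnj (fst f) = b * cnj b + 1" using F by (simp add: su11_def b_def)
      then show ?thesis unfolding ca unfolding a .
    qed
    have "su_act f (of_real l * \<i> * b) = of_real l * \<i> * b"
      unfolding su_act_def t b_def[symmetric] a using nc i_squared
      by (simp only: complex_cnj_mult complex_cnj_complex_of_real complex_cnj_i of_real_mult) algebra
    then show False using ne by blast
  qed
qed

definition eig_sign :: "complex \<times> complex \<Rightarrow> real" where
  "eig_sign f = sgn (Re (fst f))"

text \<open>The larger modulus of the two roots of m^2 - 2 Re (fst f) m + 1. Their product is 1, so
  with s = \<open>eig_sign f\<close> the roots are s times this number and s divided by it.\<close>

definition eig_abs :: "complex \<times> complex \<Rightarrow> real" where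
  "eig_abs f = \<bar>Re (fst f)\<bar> + sqrt ((Re (fst f))\<^sup>2 - 1)"

lemma eig_facts:
  assumes "\<bar>Re (fst f)\<bar> > 1"
  shows "eig_abs f > 1" "eig_sign f = 1 \<or> eig_sign f = -1" "eig_sign f * eig_sign f = 1"
    "eig_abs f + 1 / eig_abs f = 2 * \<bar>Re (fst f)\<bar>" "eig_sign f * \<bar>Re (fst f)\<bar> = Re (fst f)"
proof -
  define x s where "x = \<bar>Re (fst f)\<bar>" and "s = sqrt (x\<^sup>2 - 1)"
  have x: "x > 1" using assms by (simp add: x_def)
  then have "x * x > 1 * 1" by (intro mult_strict_mono) auto
  then have s: "s > 0" "s\<^sup>2 = x\<^sup>2 - 1" by (simp_all add: s_def power2_eq_square)
  have e: "eig_abs f = x + s" by (simp add: eig_abs_def x_def s_def)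
  show "eig_abs f > 1" using e x s by simp
  have "(x + s) * (x - s) = 1" using s(2) by (simp add: power2_eq_square algebra_simps)
  then have "1 / (x + s) = x - s" using x s by (simp add: field_simps)
  then show "eig_abs f + 1 / eig_abs f = 2 * \<bar>Re (fst f)\<bar>" by (simp add: e x_def)
  show "eig_sign f = 1 \<or> eig_sign f = -1" "eig_sign f * eig_sign f = 1" "eig_sign f * \<bar>Re (fst f)\<bar> = Re (fst f)"
    using assms by (auto simp: eig_sign_def sgn_real_def)
qed

lemma eigenvalue_equation:
  assumes "\<bar>Re (fst f)\<bar> > 1" and "m = eig_sign f * eig_abs f \<or> m = eig_sign f / eig_abs f"
  shows "m * m = 2 * Re (fst f) * m - 1"
proof -
  note e = eig_facts[OF assms(1)]
  define r s x where "r = eig_abs f" and "s = eig_sign f" and "x = \<bar>Re (fst f)\<bar>"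
  have r: "r > 1" and s: "s * s = 1" and rx: "r * r + 1 = 2 * x * r" and X: "Re (fst f) = s * x"
    using e by (simp_all add: r_def s_def x_def field_simps)
  from assms(2) show ?thesis
  proof
    assume "m = eig_sign f * eig_abs f"
    then have m: "m = s * r" by (simp add: r_def s_def)
    show ?thesis unfolding m X using s rx by algebra
  next
    assume "m = eig_sign f / eig_abs f"
    then have m: "m * r = s" using r by (simp add: r_def s_def)
    have "r * r * (m * m) = (m * r) * (m * r)" by (simp only: mult_ac)
    also have "\<dots> = 1" unfolding m by (rule s)
    also have "1 = 2 * x * r * (s * s) - r * r" using s rx by simp
    also have "\<dots> = r * r * (2 * (s * x) * m - 1)" by (subst (2) m[symmetric]) (simp only: algebra_simps)
    finally show ?thesis using r X by simp
  qed
qed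

context framed_space
begin

text \<open>For entries \<open>(a, b)\<close>, the vector \<open>(b, m - a)\<close> solves the first
  row of the eigenvalue equation. The second row, and isotropy as well, reduce to the characteristic
  equation of \<open>m\<close>.\<close>

definition eigvec :: "complex \<times> complex \<Rightarrow> real \<Rightarrow> 'v" where
  "eigvec f m = vec 0 (snd f) (of_real m - fst f)"

lemma rep_eigvec:
  assumes "f \<in> su11" "m * m = 2 * Re (fst f) * m - 1"
  shows "rep f (eigvec f m) = of_real m *\<^sub>C eigvec f m" "form (eigvec f m) (eigvec f m) = 0"
proof -
  have n: "fst f * cnj (fst f) = snd f * cnj (snd f) + 1" using assms by (simp add: su11_def)
  have "complex_of_real (m * m) = of_real (2 * Re (fst f)) * of_real m - 1" using assms(2) by simp
  then have m: "complex_of_real m * of_real m = (fst f + cnj (fst f)) * of_real m - 1"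
    by (simp add: complex_add_cnj)
  show "rep f (eigvec f m) = of_real m *\<^sub>C eigvec f m"
    unfolding eigvec_def rep_vec vec_scale vec_eq using n m by algebra
  show "form (eigvec f m) (eigvec f m) = 0"
    unfolding eigvec_def form_vec complex_cnj_diff complex_cnj_complex_of_real using n m by algebra
qed

definition eigframe :: "complex \<times> complex \<Rightarrow> 3 \<Rightarrow> 'v" where
  "eigframe f = fam3 b0 (eigvec f (eig_sign f / eig_abs f)) (eigvec f (eig_sign f * eig_abs f))"

lemma eigframe:
  assumes f: "f \<in> su11" "\<bar>Re (fst f)\<bar> > 1"
  shows "loxodromic_basis (eigframe f)"
    and "\<And>j. rep f (eigframe f j) = fam3 1 (of_real (eig_sign f / eig_abs f)) (of_real (eig_sign f * eig_abs f)) j *\<^sub>C eigframe f j"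
proof -
  note e = eig_facts[OF f(2)]
  define m1 m2 where "m1 = eig_sign f / eig_abs f" and "m2 = eig_sign f * eig_abs f"
  have q: "m1 * m1 = 2 * Re (fst f) * m1 - 1" "m2 * m2 = 2 * Re (fst f) * m2 - 1"
    unfolding m1_def m2_def using eigenvalue_equation[OF f(2)] by blast+
  have p: "m1 * m2 = 1" using e(1,3) by (simp add: m1_def m2_def)
  have sum: "m1 + m2 = 2 * Re (fst f)"
  proof -
    have "m1 + m2 = eig_sign f * (eig_abs f + 1 / eig_abs f)" by (simp add: m1_def m2_def algebra_simps)
    then show ?thesis unfolding e(4) using e(5) by simp
  qed
  have "m1 \<noteq> m2"
  proof
    assume "m1 = m2"
    then have "Re (fst f) * Re (fst f) = 1" using p sum by simp
    then show False using f(2) by (metis abs_mult_self_eq abs_1 abs_square_eq_1 less_irrefl power2_eq_square)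
  qed
  have "(cmod (snd f))\<^sup>2 > 0"
  proof -
    have "(cmod (snd f))\<^sup>2 = (Re (fst f))\<^sup>2 + (Im (fst f))\<^sup>2 - 1" using f(1) by (simp add: su11_cmod cmod_power2)
    moreover have "1 < \<bar>Re (fst f)\<bar>\<^sup>2" using f(2) by (intro one_less_power) auto
    then have "(Re (fst f))\<^sup>2 > 1" by simp
    ultimately show ?thesis using zero_le_power2[of "Im (fst f)"] by linarith
  qed
  then have b: "snd f \<noteq> 0" by auto
  have "snd f * (of_real m2 - fst f) - snd f * (of_real m1 - fst f) = snd f * (of_real (m2 - m1))"
    by (simp add: algebra_simps)
  then have D: "snd f * (of_real m2 - fst f) - snd f * (of_real m1 - fst f) \<noteq> 0"
    using b \<open>m1 \<noteq> m2\<close> by simp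
  have basis: "is_basis (eigframe f)"
    unfolding eigframe_def eigvec_def m1_def[symmetric] m2_def[symmetric] by (rule basis_vec[OF D])
  have n: "fst f * cnj (fst f) = snd f * cnj (snd f) + 1" using f by (simp add: su11_def)
  have "form (eigvec f m1) (eigvec f m2) = snd f * cnj (snd f) - (of_real m1 - fst f) * (of_real m2 - cnj (fst f))"
    unfolding eigvec_def form_vec by simp
  also have "\<dots> = of_real m1 * cnj (fst f) + of_real m2 * fst f - 2"
  proof -
    have "complex_of_real m1 * of_real m2 = 1" using p by (metis of_real_1 of_real_mult)
    then show ?thesis using n by algebra
  qed
  finally have "Re (form (eigvec f m1) (eigvec f m2)) = Re (of_real m1 * cnj (fst f) + of_real m2 * fst f - 2)"
    by (rule arg_cong)
  then have "Re (form (eigvec f m1) (eigvec f m2)) = (m1 + m2) * Re (fst f) - 2" by (simp add: algebra_simps)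
  also have "\<dots> = 2 * ((Re (fst f))\<^sup>2 - 1)" unfolding sum by (simp add: power2_eq_square)
  finally have "form (eigvec f m1) (eigvec f m2) \<noteq> 0"
    using f(2) by (auto simp: abs_square_eq_1 power2_eq_1_iff)
  then show "loxodromic_basis (eigframe f)"
    unfolding loxodromic_basis_def using basis rep_eigvec(2)[OF f(1)] q
    by (simp add: eigframe_def m1_def[symmetric] m2_def[symmetric] form_b) (simp add: eigvec_def form_b0_vec)
  show "rep f (eigframe f j) = fam3 1 (of_real (eig_sign f / eig_abs f)) (of_real (eig_sign f * eig_abs f)) j *\<^sub>C eigframe f j" for j
    using type3_cases[of j] rep_eigvec(1)[OF f(1)] q
    unfolding eigframe_def m1_def[symmetric] m2_def[symmetric]
    by (auto simp: rep_b0)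
qed

lemma matrix_of_fam3:
  assumes "is_basis e" "\<And>j. f (e j) = fam3 x y z j *\<^sub>C e j"
  shows "matrix_of e f = diag3 x y z"
  using matrix_of_eigenbasis[of e f "fam3 x y z"] assms diag3_eq by metis

text \<open>The eigenbasis makes the determinant visible as 1 * (s/r) * (s r) = s^2. The identity,
  which has no such basis, is treated separately.\<close>

lemma determinant_rep:
  assumes "f \<in> surf_group"
  shows "determinant (rep f) = 1"
proof (cases "f = su_one")
  case True
  have "matrix_of some_basis (rep f) = mat 1"
    using matrix_between_id[OF some_basis] by (simp add: True rep_one matrix_of_between)
  then show ?thesis by (simp add: determinant_def)
next
  case False
  note F = surf_group_su11[OF assms] surf_group_trace[OF assms False]
  note e = eigframe[OF F] eig_facts[OF F(2)]
  have b: "is_basis (eigframe f)" using e(1) by (simp add: loxodromic_basis_def)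
  have "determinant (rep f) = det (matrix_of (eigframe f) (rep f))"
    unfolding determinant_def by (rule det_matrix_of_change_basis[OF b some_basis rep_linear])
  also have "\<dots> = of_real (eig_sign f / eig_abs f) * of_real (eig_sign f * eig_abs f)"
    unfolding matrix_of_fam3[OF b e(2)] det_diag3 by simp
  also have "\<dots> = of_real (eig_sign f * eig_sign f)" using e(3) by (simp del: of_real_mult of_real_divide add: of_real_mult[symmetric])
  finally show ?thesis using e(5) by simp
qed

end


section \<open>The surface group in \<open>SU\<close>\<close>

context vector_space
begin

lemma is_basis_fam3_independent:
  assumes "is_basis (fam3 x y z)" "scale c x + scale d y + scale e z = 0"
  shows "c = 0 \<and> d = 0 \<and> e = 0"
proof -
  have inj: "inj (fam3 x y z)" and ind: "independent {x, y, z}"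
    using assms(1) by (simp_all add: is_basis_def range_fam3)
  have d: "x \<noteq> y" "x \<noteq> z" "y \<noteq> z"
    using inj_eq[OF inj, of 0 1] inj_eq[OF inj, of 0 2] inj_eq[OF inj, of 1 2] by simp_all
  define f where "f v = (if v = x then c else if v = y then d else e)" for v
  have "(\<Sum>v\<in>{x, y, z}. scale (f v) v) = 0" using assms(2) d by (simp add: f_def add.assoc)
  then have "f v = 0" if "v \<in> {x, y, z}" for v
    using independentD[OF ind, of "{x, y, z}" f v] that by auto
  from this[of x] this[of y] this[of z] show ?thesis using d by (auto simp: f_def)
qed

lemma is_basis_fam3_expansion:
  assumes "is_basis (fam3 x y z)"
  obtains c d e where "v = scale c x + scale d y + scale e z"
proof
  show "v = scale (representation (range (fam3 x y z)) v x) x + scale (representation (range (fam3 x y z)) v y) y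
      + scale (representation (range (fam3 x y z)) v z) z"
    using basis_expansion[OF assms, of v] unfolding UNIV_type3 by (simp add: add.assoc)
qed

lemma span_singleton_eq: "span {x} = {y. \<exists>k. y = scale k x}"
  by (auto simp: span_singleton)

lemma linear_image_span_singleton:
  assumes "Vector_Spaces.linear scale scale f"
  shows "f ` span {x} = span {f x}"
proof -
  have "f (scale k x) = scale k (f x)" for k using assms by (simp add: Vector_Spaces.linear_iff)
  then show ?thesis by (simp add: span_singleton image_image)
qed

end

context framed_space
begin

definition surf_image :: "('v \<Rightarrow> 'v) set" where
  "surf_image = rep ` surf_group"

lemma rep_carrier: "f \<in> surf_group \<Longrightarrow> rep f \<in> carrier SU"
  using surf_group_su11[of f] by (simp add: SU_def rep_linear rep_bij rep_form determinant_rep)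

lemma subgroup_surf_image: "subgroup surf_image SU"
proof (rule subgroup.intro)
  show "surf_image \<subseteq> carrier SU" using rep_carrier by (auto simp: surf_image_def)
  show "x \<otimes>\<^bsub>SU\<^esub> y \<in> surf_image" if xy: "x \<in> surf_image" "y \<in> surf_image" for x y
  proof -
    obtain f g where fg: "f \<in> surf_group" "g \<in> surf_group" "x = rep f" "y = rep g"
      using xy unfolding surf_image_def by blast
    have "x \<otimes>\<^bsub>SU\<^esub> y = rep (f \<odot> g)" by (simp add: SU_def fg rep_mult)
    then show ?thesis using surf_group_mult[OF fg(1,2)] by (simp add: surf_image_def)
  qed
  show "\<one>\<^bsub>SU\<^esub> \<in> surf_image"
    using rep_one surf_group_one by (simp add: SU_def surf_image_def image_iff) metis
  show "inv\<^bsub>SU\<^esub> x \<in> surf_image" if x: "x \<in> surf_image" for x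
  proof -
    obtain f where f: "f \<in> surf_group" "x = rep f" using x unfolding surf_image_def by blast
    note F = surf_group_su11[OF f(1)]
    have g: "su_inv f \<in> surf_group" by (rule surf_group_inv[OF f(1)])
    have "inv\<^bsub>SU\<^esub> x = rep (su_inv f)"
      unfolding m_inv_def
    proof (rule the_equality)
      show "rep (su_inv f) \<in> carrier SU \<and> x \<otimes>\<^bsub>SU\<^esub> rep (su_inv f) = \<one>\<^bsub>SU\<^esub> \<and> rep (su_inv f) \<otimes>\<^bsub>SU\<^esub> x = \<one>\<^bsub>SU\<^esub>"
        using rep_carrier[OF g] F by (simp add: f SU_def rep_inv fun_eq_iff)
      fix y assume "y \<in> carrier SU \<and> x \<otimes>\<^bsub>SU\<^esub> y = \<one>\<^bsub>SU\<^esub> \<and> y \<otimes>\<^bsub>SU\<^esub> x = \<one>\<^bsub>SU\<^esub>"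
      then have "rep f \<circ> y = id" by (simp add: SU_def f)
      then have "rep f (y v) = v" for v by (metis comp_apply id_apply)
      then show "y = rep (su_inv f)" using rep_inv(1)[OF F] by (metis ext)
    qed
    then show ?thesis using g by (simp add: surf_image_def)
  qed
qed

text \<open>After a change to the frame, the entry \<open>fst f\<close> is a continuous function of
  the matrix. Each ball thus contains only finitely many matrices of the group, and removing these
  isolates any one of them.\<close>

lemma discrete_surf_image: "discrete (matrix_of some_basis ` surf_image)"
proof -
  define A where "A = matrix_of some_basis ` surf_image"
  define Q Q' where "Q = matrix_between (fam3 b0 b1 b2) some_basis id" and "Q' = matrix_between some_basis (fam3 b0 b1 b2) id"
  define h where "h M = (Q ** M ** Q') $ 1 $ 1" for M
  have h: "h (matrix_of some_basis (rep f)) = fst f" for f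
    unfolding h_def Q_def Q'_def matrix_of_change_basis[OF some_basis basis_frame rep_linear, symmetric] rep_entry ..
  have cont: "continuous_on S h" for S
    unfolding h_def matrix_matrix_mult_def by (simp, intro continuous_intros)
  have fin: "finite (A \<inter> cball 0 K)" for K
  proof -
    have "bounded (h ` cball 0 K)"
      by (intro compact_imp_bounded compact_continuous_image cont compact_cball)
    then obtain C where C: "\<forall>M\<in>cball 0 K. cmod (h M) \<le> C" by (auto simp: bounded_iff)
    have "A \<inter> cball 0 K \<subseteq> (\<lambda>f. matrix_of some_basis (rep f)) ` {f \<in> surf_group. cmod (fst f) \<le> C}"
    proof
      fix M assume M: "M \<in> A \<inter> cball 0 K"
      then obtain f where f: "f \<in> surf_group" "M = matrix_of some_basis (rep f)"
        unfolding A_def surf_image_def by blast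
      have "cmod (h M) \<le> C" using C M by blast
      then have "cmod (fst f) \<le> C" unfolding f(2) h .
      then show "M \<in> (\<lambda>f. matrix_of some_basis (rep f)) ` {f \<in> surf_group. cmod (fst f) \<le> C}" using f by blast
    qed
    then show ?thesis using finite_surf_group_bounded finite_surj by blast
  qed
  have "discrete A"
  proof (rule discreteI)
    fix M assume M: "M \<in> A"
    define T where "T = ball 0 (norm M + 1) - (A \<inter> cball 0 (norm M + 1) - {M})"
    have "open T" unfolding T_def using fin by (intro open_Diff finite_imp_closed finite_Diff open_ball)
    moreover have "T \<inter> A = {M}" using M by (auto simp: T_def)
    ultimately show "M isolated_in A" unfolding isolated_in_def using M by blast
  qed
  then show ?thesis by (simp add: A_def)
qed

lemma discrete_subgroup_surf_image: "discrete_subgroup surf_image"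
  unfolding discrete_subgroup_def using subgroup_surf_image discrete_surf_image by blast

lemma surf_image_iso: "SU\<lparr>carrier := surf_image\<rparr> \<cong> fundamental_group genus3 basepoint"
proof -
  define h where "h = deck_class \<circ> inv_into surf_group rep"
  have inj: "inj_on rep surf_group" by (auto intro: inj_onI rep_inj)
  have h: "h (rep f) = deck_class f" if "f \<in> surf_group" for f
    using inv_into_f_f[OF inj that] by (simp add: h_def)
  have "h \<in> iso (SU\<lparr>carrier := surf_image\<rparr>) (fundamental_group genus3 basepoint)"
  proof (rule isoI)
    show "h \<in> hom (SU\<lparr>carrier := surf_image\<rparr>) (fundamental_group genus3 basepoint)"
    proof (rule homI)
      fix x assume "x \<in> carrier (SU\<lparr>carrier := surf_image\<rparr>)"
      then obtain f where "f \<in> surf_group" "x = rep f" by (auto simp: surf_image_def)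
      then show "h x \<in> carrier (fundamental_group genus3 basepoint)" using h deck_class_surj by auto
    next
      fix x y assume "x \<in> carrier (SU\<lparr>carrier := surf_image\<rparr>)" "y \<in> carrier (SU\<lparr>carrier := surf_image\<rparr>)"
      then have "x \<in> rep ` surf_group" "y \<in> rep ` surf_group" by (simp_all add: surf_image_def)
      then obtain f g where fg: "f \<in> surf_group" "x = rep f" "g \<in> surf_group" "y = rep g" by blast
      have "x \<otimes>\<^bsub>SU\<lparr>carrier := surf_image\<rparr>\<^esub> y = rep (f \<odot> g)" by (simp add: SU_def fg rep_mult)
      then show "h (x \<otimes>\<^bsub>SU\<lparr>carrier := surf_image\<rparr>\<^esub> y) = h x \<otimes>\<^bsub>fundamental_group genus3 basepoint\<^esub> h y"
        using fg by (simp add: h surf_group_mult deck_class_mult)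
    qed
    have "bij_betw (inv_into surf_group rep) surf_image surf_group"
      unfolding surf_image_def by (intro bij_betw_inv_into inj_on_imp_bij_betw inj)
    moreover have "bij_betw deck_class surf_group (carrier (fundamental_group genus3 basepoint))"
      using deck_class_inj deck_class_surj by (simp add: bij_betw_def)
    ultimately show "bij_betw h (carrier (SU\<lparr>carrier := surf_image\<rparr>)) (carrier (fundamental_group genus3 basepoint))"
      unfolding h_def by (simp add: bij_betw_trans)
  qed
  then show ?thesis by (auto simp: is_iso_def)
qed


subsection \<open>The invariant complex geodesic\<close>

definition geod_subspace :: "'v set" where
  "geod_subspace = {v. form v b0 = 0}"

definition geod :: "'v set set" where
  "geod = projectivization geod_subspace"

lemma geod_subspace_vec: "v \<in> geod_subspace \<longleftrightarrow> (\<exists>u w. v = vec 0 u w)"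
  by (metis (mono_tags, lifting) form_vec_b(1) geod_subspace_def mem_Collect_eq vec_cases)

lemma subspace_geod: "subspace geod_subspace"
  by (auto simp: subspace_def geod_subspace_def form_add form_scale)

lemma complex_geodesic_geod: "complex_geodesic geod"
proof -
  have "independent {b0, b1, b2}" using basis_frame by (simp add: is_basis_def range_fam3)
  then have "independent {b1, b2}" by (rule independent_mono) auto
  moreover have "b1 \<noteq> b2" using form_b by force
  moreover have "span {b1, b2} = geod_subspace"
  proof
    show "span {b1, b2} \<subseteq> geod_subspace"
      using form_eq_0_sym[OF form_b(4)] form_eq_0_sym[OF form_b(5)]
      by (intro span_minimal subspace_geod) (auto simp: geod_subspace_def)
    show "geod_subspace \<subseteq> span {b1, b2}"
    proof
      fix v assume "v \<in> geod_subspace"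
      then obtain u w where v: "v = vec 0 u w" using geod_subspace_vec by blast
      have "v = u *\<^sub>C b1 + w *\<^sub>C b2" by (simp add: v vec_def)
      then show "v \<in> span {b1, b2}" by (auto intro!: span_add span_scale intro: span_base)
    qed
  qed
  ultimately have "dim geod_subspace = 2" using dim_span_eq_card_independent[of "{b1, b2}"] by simp
  moreover have "b1 \<in> geod_subspace" "b2 \<in> geod_subspace"
    using form_eq_0_sym[OF form_b(4)] form_eq_0_sym[OF form_b(5)] by (auto simp: geod_subspace_def)
  ultimately have "geodesic_subspace geod_subspace"
    unfolding geodesic_subspace_def using subspace_geod form_b
    by (intro conjI bexI[of _ b1] bexI[of _ b2]) simp_all
  then show ?thesis by (auto simp: complex_geodesic_def geod_def)
qed

lemma Union_geod: "\<Union>geod = geod_subspace"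
proof
  show "\<Union>geod \<subseteq> geod_subspace"
    using subspace_geod by (auto simp: geod_def projectivization_def span_singleton subspace_def)
  show "geod_subspace \<subseteq> \<Union>geod"
  proof
    fix v assume v: "v \<in> geod_subspace"
    have b: "b1 \<in> geod_subspace" "b1 \<noteq> 0"
      using form_eq_0_sym[OF form_b(4)] form_b(2) by (auto simp: geod_subspace_def)
    show "v \<in> \<Union>geod"
    proof (cases "v = 0")
      case True
      then show ?thesis using b span_zero[of "{b1}"] unfolding geod_def projectivization_def by blast
    next
      case False
      then show ?thesis using v span_base[of v "{v}"] unfolding geod_def projectivization_def by blast
    qed
  qed
qed

lemma polar_point_geod: "polar_point geod = span {b0}"
proof
  show "polar_point geod \<subseteq> span {b0}"
  proof
    fix x assume "x \<in> polar_point geod"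
    then have x: "\<And>v. v \<in> geod_subspace \<Longrightarrow> form x v = 0" by (simp only: polar_point_def Union_geod mem_Collect_eq)
    have "form x b1 = 0" "form x b2 = 0"
      using form_eq_0_sym[OF form_b(4)] form_eq_0_sym[OF form_b(5)] by (auto intro!: x simp: geod_subspace_def)
    then have "x = vec (form x b0) 0 0" using vec_coords[of x] by simp
    then have "x = form x b0 *\<^sub>C b0" unfolding scale_b0 .
    then show "x \<in> span {b0}" by (auto simp: span_singleton_eq)
  qed
  show "span {b0} \<subseteq> polar_point geod"
    by (auto simp: polar_point_def Union_geod span_singleton_eq form_scale geod_subspace_vec form_b0_vec)
qed

lemma rep_geod_subspace: "rep f v \<in> geod_subspace \<longleftrightarrow> v \<in> geod_subspace"
  using vec_cases[of v] by (metis form_vec_b(1) geod_subspace_def mem_Collect_eq rep_vec)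

lemma leaves_invariant_geod: "leaves_invariant surf_image geod"
  unfolding leaves_invariant_def
proof
  fix F assume "F \<in> surf_image"
  then obtain f where f: "f \<in> surf_group" "F = rep f" unfolding surf_image_def by blast
  have sub: "(\<lambda>p. rep f ` p) ` geod \<subseteq> geod" if "f \<in> surf_group" for f
  proof
    fix q assume "q \<in> (\<lambda>p. rep f ` p) ` geod"
    then obtain v where v: "v \<in> geod_subspace" "v \<noteq> 0" "q = rep f ` span {v}"
      unfolding geod_def projectivization_def by blast
    have "rep f v \<noteq> 0" using v(2) rep_bij[OF surf_group_su11[OF that]] rep_scale[of f 0 0]
      by (metis bij_is_inj injD scale_zero_left)
    then show "q \<in> geod"
      using v rep_geod_subspace[of f v] linear_image_span_singleton[OF rep_linear, of f v]
      unfolding geod_def projectivization_def by blast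
  qed
  show "(\<lambda>p. F ` p) ` geod = geod"
  proof
    show "(\<lambda>p. F ` p) ` geod \<subseteq> geod" using sub f by simp
    show "geod \<subseteq> (\<lambda>p. F ` p) ` geod"
    proof
      fix q assume "q \<in> geod"
      then have "rep (su_inv f) ` q \<in> geod" using sub[OF surf_group_inv[OF f(1)]] by blast
      moreover have "q = rep f ` rep (su_inv f) ` q"
        using rep_inv(2)[OF surf_group_su11[OF f(1)]] by (simp add: image_image)
      ultimately show "q \<in> (\<lambda>p. F ` p) ` geod" using f(2) by blast
    qed
  qed
qed

lemma eigframe_matrix:
  assumes f: "f \<in> su11" "\<bar>Re (fst f)\<bar> > 1"
  shows "matrix_of (eigframe f) (rep f) =
    diag3 1 (inverse (of_real (eig_abs f)) * of_real (eig_sign f)) (of_real (eig_abs f) * of_real (eig_sign f))"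
proof -
  have b: "is_basis (eigframe f)" using eigframe(1)[OF f] by (simp add: loxodromic_basis_def)
  show ?thesis unfolding matrix_of_fam3[OF b eigframe(2)[OF f]]
    by (simp add: divide_inverse mult.commute)
qed

lemma isotropic_in_geod:
  assumes "v = vec 0 u w" "v \<noteq> 0" "form v v = 0"
  shows "span {v} \<in> geod \<inter> isotropic_points"
  using assms geod_subspace_vec unfolding geod_def projectivization_def isotropic_points_def by blast

lemma surf_image_normal_form:
  assumes "I \<in> surf_image"
  shows "\<exists>(e :: 3 \<Rightarrow> 'v) (r :: real) (\<alpha> :: complex).
    is_basis e \<and> r > 0 \<and> (\<alpha> = 1 \<or> \<alpha> = - 1) \<and>
    matrix_of e I = diag3 1 (inverse (of_real r) * \<alpha>) (of_real r * \<alpha>) \<and>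
    span {e 1} \<in> geod \<inter> isotropic_points \<and> span {e 2} \<in> geod \<inter> isotropic_points \<and>
    span {e 0} = polar_point geod"
proof -
  obtain f where f: "f \<in> surf_group" "I = rep f" using assms unfolding surf_image_def by blast
  show ?thesis
  proof (cases "f = su_one")
    case True
    \<comment> \<open>For the identity any two independent isotropic vectors of the geodesic will
      do, with r = 1 and \<alpha> = 1.\<close>
    define e where "e = fam3 b0 (vec 0 1 1) (vec 0 1 (- 1))"
    have b: "is_basis e" unfolding e_def by (rule basis_vec) simp
    have m: "matrix_of e I = diag3 1 1 1"
      by (rule matrix_of_fam3[OF b]) (simp add: f True rep_one fam3_def)
    have "span {e 1} \<in> geod \<inter> isotropic_points" "span {e 2} \<in> geod \<inter> isotropic_points"
      unfolding e_def fam3_simps by (rule isotropic_in_geod[OF refl]; simp add: vec_eq_0 form_vec)+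
    then show ?thesis using b m polar_point_geod
      by (intro exI[of _ e] exI[of _ 1]) (simp add: e_def)
  next
    case False
    note F = surf_group_su11[OF f(1)] surf_group_trace[OF f(1) False]
    note L = eigframe(1)[OF F, unfolded loxodromic_basis_def]
    have n: "eigframe f 1 \<noteq> 0" "eigframe f 2 \<noteq> 0" using L by auto
    have "span {eigframe f 1} \<in> geod \<inter> isotropic_points" "span {eigframe f 2} \<in> geod \<inter> isotropic_points"
      unfolding eigframe_def fam3_simps
      by (rule isotropic_in_geod[OF eigvec_def]; use n L in \<open>simp add: eigframe_def\<close>)+
    moreover have "span {eigframe f 0} = polar_point geod" by (simp add: eigframe_def polar_point_geod)
    moreover have "eig_abs f > 0" "complex_of_real (eig_sign f) = 1 \<or> complex_of_real (eig_sign f) = - 1"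
      using eig_facts(1,2)[OF F(2)] by auto
    ultimately show ?thesis using L eigframe_matrix[OF F] unfolding f(2) by blast
  qed
qed

text \<open>As \<alpha> = \<plusminus>1 is real, \<open>rep (\<alpha>, 0)\<close> multiplies the
  whole orthogonal complement of \<open>b0\<close> by \<alpha> and is diagonal in the eigenbasis.
  Since \<alpha>^2 = 1, the cubic root of unity can be taken to be 1.\<close>

lemma is_elliptic_part_rep:
  assumes f: "f \<in> surf_group" "f \<noteq> su_one"
  shows "is_elliptic_part (rep f) (transformation (rep (of_real (eig_sign f), 0)))"
proof -
  note F = surf_group_su11[OF f(1)] surf_group_trace[OF f]
  note ev = eig_facts[OF F(2)]
  define \<alpha> :: complex where "\<alpha> = of_real (eig_sign f)"
  have a: "\<alpha> = 1 \<or> \<alpha> = -1" using ev(2) by (auto simp: \<alpha>_def)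
  have b: "is_basis (eigframe f)" using eigframe(1)[OF F] by (simp add: loxodromic_basis_def)
  have "matrix_of (eigframe f) (rep (\<alpha>, 0)) = diag3 1 \<alpha> \<alpha>"
  proof (rule matrix_of_fam3[OF b])
    fix j
    show "rep (\<alpha>, 0) (eigframe f j) = fam3 1 \<alpha> \<alpha> j *\<^sub>C eigframe f j"
      using type3_cases[of j] a by (auto simp: eigframe_def rep_b0 eigvec_def rep_vec vec_scale vec_eq)
  qed
  moreover have "matrix_of (eigframe f) (rep f) = diag3 (1 * inverse (\<alpha>\<^sup>2)) (1 * (\<alpha> / of_real (eig_abs f))) (1 * (of_real (eig_abs f) * \<alpha>))"
    using eigframe_matrix[OF F] a by (auto simp: \<alpha>_def[symmetric] divide_inverse mult.commute)
  ultimately show ?thesis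
    unfolding is_elliptic_part_def \<alpha>_def[symmetric]
    by (intro exI[of _ "eigframe f"] exI[of _ 1] exI[of _ \<alpha>] exI[of _ "eig_abs f"] exI[of _ "rep (\<alpha>, 0)"])
      (use eigframe(1)[OF F] ev(1) a rep_linear in auto)
qed

lemma hyperbolic_plane_rep:
  assumes "f \<in> su11" "p \<in> hyperbolic_plane"
  shows "rep f ` p \<in> hyperbolic_plane"
proof -
  obtain v where v: "p = span {v}" "Re (form v v) < 0" using assms(2) by (auto simp: hyperbolic_plane_def)
  have "rep f ` p = span {rep f v}" unfolding v(1) by (rule linear_image_span_singleton[OF rep_linear])
  then show ?thesis using v(2) rep_form[OF assms(1), of v v] unfolding hyperbolic_plane_def by auto
qed

lemma surf_image_loxodromic:
  assumes "I \<in> surf_image" "loxodromic I"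
  shows "hyperbolic I \<or> elliptic_part_of_order_2 I"
proof -
  obtain f where f: "f \<in> surf_group" "I = rep f" using assms(1) unfolding surf_image_def by blast
  have "f \<noteq> su_one"
  proof
    assume "f = su_one"
    then obtain c v where v: "v \<noteq> 0" "v = c *\<^sub>C v" "cmod c \<noteq> 1" using assms(2) by (auto simp: loxodromic_def f(2) rep_one)
    then have "(c - 1) *\<^sub>C v = 0" by (simp add: scale_left_diff_distrib)
    then show False using v by simp
  qed
  note f1 = f(1) this
  note ep = is_elliptic_part_rep[OF f1]
  have "eig_sign f = 1 \<or> eig_sign f = -1" using eig_facts(2)[OF surf_group_trace[OF f1]] .
  then show ?thesis
  proof
    assume s: "eig_sign f = 1"
    have "rep (1, 0) = id" using rep_one by (simp add: su_one_def)
    then have "transformation (rep (of_real (eig_sign f), 0)) = (\<lambda>p\<in>hyperbolic_plane. p)"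
      by (simp add: s transformation_def)
    then show ?thesis using ep assms(2) by (simp add: hyperbolic_def f(2))
  next
    assume s: "eig_sign f = -1"
    define E where "E = rep (- 1, 0)"
    have E11: "(- 1, 0) \<in> su11" by (simp add: su11_def)
    have EE: "E ` E ` p = p" for p
    proof -
      have "(- 1, 0) \<odot> (- 1, 0) = su_one" by (simp add: su_mult_def su_one_def)
      then have "E \<circ> E = id" unfolding E_def rep_mult[symmetric] rep_one[symmetric] by simp
      then show ?thesis by (metis image_comp image_id id_apply)
    qed
    \<comment> \<open>A negative point outside \<open>geod\<close>. On the geodesic itself the
      elliptic part -1 acts trivially, so nontriviality must be tested off it.\<close>
    define q where "q = span {vec 1 0 2}"
    have q: "q \<in> hyperbolic_plane" unfolding hyperbolic_plane_def q_def mem_Collect_eq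
      by (intro exI[of _ "vec 1 0 2"]) (simp add: form_vec)
    have "E ` q \<noteq> q"
    proof
      assume "E ` q = q"
      moreover have "vec 1 0 2 \<in> q" unfolding q_def by (simp add: span_base)
      ultimately have "E (vec 1 0 2) \<in> q" by blast
      then obtain k where "vec 1 0 (- 2) = k *\<^sub>C vec 1 0 2" unfolding q_def span_singleton_eq E_def rep_vec by auto
      then show False unfolding vec_scale vec_eq by auto
    qed
    then have "transformation E \<noteq> (\<lambda>p\<in>hyperbolic_plane. p)"
      using q unfolding transformation_def by (metis restrict_apply')
    moreover have "compose hyperbolic_plane (transformation E) (transformation E) = (\<lambda>p\<in>hyperbolic_plane. p)"
      using hyperbolic_plane_rep[OF E11] EE by (auto simp: compose_def transformation_def E_def fun_eq_iff)
    moreover have "is_elliptic_part I (transformation E)" using ep by (simp add: s E_def f(2))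
    ultimately show ?thesis using assms(2) unfolding elliptic_part_of_order_2_def by blast
  qed
qed


subsection \<open>The group is not elementary\<close>

lemma eigframe_expansion:
  assumes "f \<in> su11" "\<bar>Re (fst f)\<bar> > 1"
  obtains c d e where
    "v = c *\<^sub>C b0 + d *\<^sub>C eigvec f (eig_sign f / eig_abs f) + e *\<^sub>C eigvec f (eig_sign f * eig_abs f)"
proof -
  have "is_basis (eigframe f)" using eigframe(1)[OF assms] by (simp add: loxodromic_basis_def)
  then show thesis unfolding eigframe_def using is_basis_fam3_expansion that by metis
qed

text \<open>The eigenvalues 1, m1^k and m2^k of the power have distinct moduli. An eigenvector of
  the power is therefore a multiple of a single member of the eigenframe.\<close>

lemma loxodromic_eigenvector:
  assumes f: "f \<in> su11" "\<bar>Re (fst f)\<bar> > 1" and v: "v \<noteq> 0" and k: "k > 0" and eq: "(rep f ^^ k) v = c *\<^sub>C v"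
  shows "(\<exists>a. v = a *\<^sub>C b0) \<or>
    (\<exists>m. m * m = 2 * Re (fst f) * m - 1 \<and> m * m \<noteq> 1 \<and> rep f v = of_real m *\<^sub>C v \<and> form v b0 = 0)"
proof -
  define m1 m2 where "m1 = eig_sign f / eig_abs f" and "m2 = eig_sign f * eig_abs f"
  note ev = eig_facts[OF f(2)]
  have q: "m1 * m1 = 2 * Re (fst f) * m1 - 1" "m2 * m2 = 2 * Re (fst f) * m2 - 1"
    unfolding m1_def m2_def using eigenvalue_equation[OF f(2)] by blast+
  have b: "is_basis (fam3 b0 (eigvec f m1) (eigvec f m2))"
    using eigframe(1)[OF f] by (simp add: loxodromic_basis_def eigframe_def m1_def m2_def)
  have abs: "\<bar>m1\<bar> < 1" "\<bar>m2\<bar> > 1" using ev(1,2) by (auto simp: m1_def m2_def abs_mult)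
  have sq: "m1 * m1 \<noteq> 1" "m2 * m2 \<noteq> 1" using abs by (auto simp: square_eq_1_iff)
  obtain x y z where xyz: "v = x *\<^sub>C b0 + y *\<^sub>C eigvec f m1 + z *\<^sub>C eigvec f m2"
    unfolding m1_def m2_def by (rule eigframe_expansion[OF f])
  have pw: "(rep f ^^ n) v = x *\<^sub>C b0 + (of_real m1 ^ n * y) *\<^sub>C eigvec f m1 + (of_real m2 ^ n * z) *\<^sub>C eigvec f m2" for n
  proof (induction n)
    case 0
    then show ?case by (simp add: xyz)
  next
    case (Suc n)
    then show ?case by (simp add: rep_add rep_scale rep_b0 rep_eigvec(1)[OF f(1) q(1)] rep_eigvec(1)[OF f(1) q(2)] mult_ac)
  qed
  have "(x - c * x) *\<^sub>C b0 + (of_real m1 ^ k * y - c * y) *\<^sub>C eigvec f m1 + (of_real m2 ^ k * z - c * z) *\<^sub>C eigvec f m2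
      = (rep f ^^ k) v - c *\<^sub>C v"
    unfolding pw by (simp add: xyz scale_left_diff_distrib scale_right_distrib)
  also have "\<dots> = 0" using eq by simp
  finally have z0: "x - c * x = 0 \<and> of_real m1 ^ k * y - c * y = 0 \<and> of_real m2 ^ k * z - c * z = 0"
    by (rule is_basis_fam3_independent[OF b])
  have n1: "cmod (of_real m1 ^ k) < 1"
    using abs(1) k by (simp add: norm_power power_less_one_iff)
  have n2: "cmod (of_real m2 ^ k) > 1"
    using abs(2) k by (simp add: norm_power one_less_power)
  have x: "x = 0 \<or> c = 1" and y: "y = 0 \<or> c = of_real m1 ^ k" and z: "z = 0 \<or> c = of_real m2 ^ k"
    using z0 by (simp_all flip: left_diff_distrib) (auto simp: algebra_simps)
  show ?thesis
  proof (cases "c = 1")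
    case True
    then have "y = 0" "z = 0" using y z n1 n2 by auto
    then show ?thesis using xyz by auto
  next
    case False
    then have x0: "x = 0" using x by simp
    have f0: "form (eigvec f m) b0 = 0" for m by (simp add: eigvec_def form_vec_b)
    have "y = 0 \<or> z = 0" using y z n1 n2 by auto
    then show ?thesis
    proof
      assume "y = 0"
      then have "v = z *\<^sub>C eigvec f m2" using xyz x0 by simp
      then have "rep f v = of_real m2 *\<^sub>C v \<and> form v b0 = 0"
        by (simp add: rep_scale rep_eigvec(1)[OF f(1) q(2)] form_scale f0 mult.commute)
      then show ?thesis using q(2) sq(2) by blast
    next
      assume "z = 0"
      then have "v = y *\<^sub>C eigvec f m1" using xyz x0 by simp
      then have "rep f v = of_real m1 *\<^sub>C v \<and> form v b0 = 0"
        by (simp add: rep_scale rep_eigvec(1)[OF f(1) q(1)] form_scale f0 mult.commute)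
      then show ?thesis using q(1) sq(1) by blast
    qed
  qed
qed

lemma rep_funpow: "f \<in> surf_group \<Longrightarrow> rep f ^^ n \<in> surf_image"
proof (induction n)
  case 0
  show ?case unfolding funpow.simps(1) surf_image_def using surf_group_one rep_one by (metis imageI)
next
  case (Suc n)
  then obtain g where "g \<in> surf_group" "rep f ^^ n = rep g" unfolding surf_image_def by blast
  then have "rep f ^^ Suc n = rep (f \<odot> g)" by (simp add: rep_mult)
  then show ?case using surf_group_mult[OF Suc.prems \<open>g \<in> surf_group\<close>] by (simp add: surf_image_def)
qed

lemma finite_orbit_power:
  assumes fin: "finite ((\<lambda>f. f ` p) ` surf_image)" and f: "f \<in> surf_group"
  shows "\<exists>k>0. (rep f ^^ k) ` p = p"
proof -
  have "range (\<lambda>n. (rep f ^^ n) ` p) \<subseteq> (\<lambda>f. f ` p) ` surf_image" using rep_funpow[OF f] by blast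
  then have "finite (range (\<lambda>n. (rep f ^^ n) ` p))" using fin by (rule finite_subset)
  then have "\<not> inj (\<lambda>n. (rep f ^^ n) ` p)" using finite_imageD infinite_UNIV_nat by blast
  then obtain m n where mn: "m \<noteq> n" "(rep f ^^ m) ` p = (rep f ^^ n) ` p" by (auto simp: inj_def)
  have "\<exists>k>0. (rep f ^^ k) ` p = p" if "m < n" "(rep f ^^ m) ` p = (rep f ^^ n) ` p" for m n
  proof -
    have "(rep f ^^ n) ` p = (rep f ^^ m) ` (rep f ^^ (n - m)) ` p"
      using that(1) by (simp add: image_comp funpow_add[symmetric])
    moreover have "inj (rep f ^^ m)"
      using rep_bij[OF surf_group_su11[OF f]] by (simp add: bij_is_inj inj_fn)
    ultimately have "(rep f ^^ (n - m)) ` p = p" using that(2) by (metis inj_image_eq_iff)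
    then show ?thesis using that(1) by (intro exI[of _ "n - m"]) simp
  qed
  then show ?thesis using mn by (metis linorder_neqE_nat)
qed

lemma gen_trace: "k \<in> {0, 1} \<Longrightarrow> Re (fst (gen k)) = cosh_r / 2"
proof -
  assume "k \<in> {0, 1}"
  then have "sg k = 1" by (auto simp: sg_def)
  then show ?thesis by (simp add: gen_def cos_60)
qed

lemma gen_loxodromic: "k \<in> {0, 1} \<Longrightarrow> \<bar>Re (fst (gen k))\<bar> > 1"
  unfolding gen_trace using sqrt3_bounds by (simp add: cosh_r_def)

text \<open>An eigenvector with m^2 different from 1 is isotropic, so |u| = |w|. As
  \<open>gen 0\<close> and \<open>gen 1\<close> have the same first entry, subtracting the two
  equations gives (m - m')^2 = 2 sqrt 3. But distinct roots of X^2 - cosh_r X + 1 satisfy (m - m')^2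
  = cosh_r^2 - 4 = 3 + 4 sqrt 3.\<close>

lemma no_common_eigenvector:
  assumes m: "m * m = cosh_r * m - 1" "m' * m' = cosh_r * m' - 1" "m * m \<noteq> 1"
    and v: "v \<noteq> 0" "form v b0 = 0" "rep (gen 0) v = of_real m *\<^sub>C v" "rep (gen 1) v = of_real m' *\<^sub>C v"
  shows False
proof -
  obtain c u w where vec: "v = vec c u w" using vec_cases by blast
  have c: "c = 0" using v(2) by (simp add: vec form_vec_b)
  have "form v v = of_real (m * m) * form v v"
    using rep_form[OF gen_su11, of 0 v v] unfolding v(3) by (simp add: form_scale form_scale_right mult.assoc)
  then have "of_real (1 - m * m) * form v v = 0" by (simp add: algebra_simps)
  then have "form v v = 0" using m(3) by (metis eq_iff_diff_eq_0 mult_eq_0_iff of_real_eq_0_iff)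
  then have "complex_of_real ((cmod u)\<^sup>2) = of_real ((cmod w)\<^sup>2)"
    unfolding vec c form_vec complex_norm_square by simp
  then have "(cmod u)\<^sup>2 = (cmod w)\<^sup>2" unfolding of_real_eq_iff .
  then have uw: "cmod u = cmod w" by (simp add: power2_eq_iff_nonneg)
  have w: "w \<noteq> 0" using v(1) uw by (auto simp: vec c vec_eq_0)
  have sg: "sg 0 = 1" "sg 1 = 1" by (simp_all add: sg_def)
  define a where "a = complex_of_real cosh_r * cis (- (pi / 3))"
  have "a * u + of_real sinh_r * om 4 * w = of_real m * u" "a * u + of_real sinh_r * om 5 * w = of_real m' * u"
    using v(3,4) unfolding vec c rep_vec vec_scale vec_eq by (simp_all add: gen_def sg a_def)
  then have "of_real sinh_r * (om 4 - om 5) * w = of_real (m - m') * u"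
    unfolding of_real_diff by algebra
  then have "cmod (of_real sinh_r * (om 4 - om 5) * w) = cmod (of_real (m - m') * u)" by simp
  then have "sinh_r * cmod (om 4 - om 5) = \<bar>m - m'\<bar>"
    using w uw sinh_r_pos by (simp add: norm_mult del: of_real_diff)
  then have "sinh_r\<^sup>2 * (cmod (om 4 - om 5))\<^sup>2 = (m - m')\<^sup>2" by (metis power2_abs power_mult_distrib)
  moreover have "(cmod (om 4 - om 5))\<^sup>2 = 2 - sqrt 3"
  proof -
    have "(cmod (om 4 - om 5))\<^sup>2 = (cmod (om 4))\<^sup>2 + (cmod (om 5))\<^sup>2 - 2 * Re (om 4 * cnj (om 5))"
      unfolding cmod_power2 by (simp add: power2_eq_square algebra_simps)
    then show ?thesis unfolding om_Re_unfold by (simp add: cos_30)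
  qed
  moreover have "(6 + 4 * sqrt 3) * (2 - sqrt 3) = 2 * sqrt 3" by (simp add: algebra_simps)
  ultimately have d: "(m - m')\<^sup>2 = 2 * sqrt 3" by (simp add: sinh_r_sq)
  have "(m - m') * (m + m' - cosh_r) = 0" using m(1,2) by (simp add: algebra_simps)
  then have s: "m + m' = cosh_r" using d by auto
  then have "m * m = (m + m') * m - 1" using m(1) by simp
  then have "m * m' = 1" by (simp add: algebra_simps)
  then have "(m - m')\<^sup>2 = cosh_r\<^sup>2 - 4" unfolding s[symmetric] by (simp add: power2_eq_square algebra_simps)
  then show False using d cosh_r_sq sqrt3_bounds by simp
qed

text \<open>A finite orbit of \<open>p\<close> makes powers of \<open>gen 0\<close> and of
  \<open>gen 1\<close> fix \<open>p\<close>. A vector spanning \<open>p\<close> is not positive, so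
  it is no multiple of \<open>b0\<close> and would be a common eigenvector of the two
  generators.\<close>

lemma non_elementary_surf_image: "non_elementary surf_image"
  unfolding non_elementary_def
proof (intro ballI notI)
  fix p assume p: "p \<in> hyperbolic_plane \<union> isotropic_points" and fin: "finite ((\<lambda>f. f ` p) ` surf_image)"
  obtain v where v: "p = span {v}" "v \<noteq> 0" "Re (form v v) \<le> 0"
    using p by (force simp: hyperbolic_plane_def isotropic_points_def)
  have "\<exists>m. m * m = cosh_r * m - 1 \<and> m * m \<noteq> 1 \<and> rep (gen k) v = of_real m *\<^sub>C v \<and> form v b0 = 0"
    if k: "k \<in> {0, 1}" for k
  proof -
    obtain n where n: "n > 0" "(rep (gen k) ^^ n) ` p = p" using finite_orbit_power[OF fin gen_in_surf_group] by blast
    have "v \<in> p" unfolding v(1) by (simp add: span_base)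
    then have "(rep (gen k) ^^ n) v \<in> p" using n(2) by blast
    then obtain c where c: "(rep (gen k) ^^ n) v = c *\<^sub>C v" unfolding v(1) span_singleton_eq by blast
    have "\<not> (\<exists>a. v = a *\<^sub>C b0)"
    proof
      assume "\<exists>a. v = a *\<^sub>C b0"
      then obtain a where a: "v = a *\<^sub>C b0" by blast
      have "form v v = of_real ((cmod a)\<^sup>2)"
        unfolding a complex_norm_square by (simp add: form_scale form_scale_right form_b)
      then have "cmod a = 0" using v(3) by simp
      then show False using v(2) a by simp
    qed
    then show ?thesis
      using loxodromic_eigenvector[OF gen_su11 gen_loxodromic[OF k] v(2) n(1) c] gen_trace[OF k] by simp
  qed
  from this[of 0] this[of 1] show False
    using no_common_eigenvector v(2) by (metis insert_iff)
qed

end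


subsection \<open>The group is not R-Fuchsian\<close>

context framed_space
begin

lemma orthogonal_frame_basis:
  assumes o: "form p q = 0" "form p n = 0" "form q n = 0"
    and d: "form p p \<noteq> 0" "form q q \<noteq> 0" "form n n \<noteq> 0"
  shows "x = (form x p / form p p) *\<^sub>C p + (form x q / form q q) *\<^sub>C q + (form x n / form n n) *\<^sub>C n"
proof -
  note o' = o o[THEN form_eq_0_sym]
  have co: "form (a *\<^sub>C p + b *\<^sub>C q + c *\<^sub>C n) p = a * form p p"
    "form (a *\<^sub>C p + b *\<^sub>C q + c *\<^sub>C n) q = b * form q q"
    "form (a *\<^sub>C p + b *\<^sub>C q + c *\<^sub>C n) n = c * form n n" for a b c
    by (simp_all add: form_add form_scale o')
  have zero: "a = 0 \<and> b = 0 \<and> c = 0" if "a *\<^sub>C p + b *\<^sub>C q + c *\<^sub>C n = 0" for a b c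
    using co[of a b c] d unfolding that by simp
  interpret fd: finite_dimensional_vector_space scale "{b0, b1, b2}"
    using basis_frame by unfold_locales (simp_all add: is_basis_def range_fam3)
  have card: "card {p, q, n} = 3"
    using card_image[OF independent_fam3(1)[OF zero]] by (simp add: range_fam3)
  have "UNIV \<subseteq> span {p, q, n}"
    by (rule fd.card_ge_dim_independent[OF subset_UNIV independent_fam3(2)[OF zero]]) (simp_all only: card dim_eq_3 order_refl)
  then have "is_basis (fam3 p q n)"
    using independent_fam3[OF zero] by (auto simp: is_basis_def range_fam3)
  then obtain a b c where x: "x = a *\<^sub>C p + b *\<^sub>C q + c *\<^sub>C n" by (rule is_basis_fam3_expansion)
  show ?thesis unfolding x co using d by simp
qed

lemma real_scale_module: "module real_scale"
  by unfold_locales (simp_all add: real_scale_def scale_left_distrib scale_right_distrib)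

lemma om_4_5: "om 4 \<noteq> om 5"
proof
  assume "om 4 = om 5"
  then have "Re (om 4 * cnj (om 5)) = Re (om 5 * cnj (om 5))" by simp
  then show False unfolding om_Re_unfold using sqrt3_bounds by (simp add: cos_30)
qed

text \<open>An invariant totally real plane would give an antilinear involution \<open>\<sigma>\<close> commuting with the group up to
  scalars. It fixes the line of \<open>b0\<close>, the only common eigenline, hence commutes with the group. On the orthogonal
  complement it then has to be a multiple of \<open>(u, w) \<mapsto> (cnj w, cnj u)\<close>, which changes the sign of the form.\<close>

lemma not_R_Fuchsian_surf_image: "\<not> R_Fuchsian surf_image"
proof
  assume "R_Fuchsian surf_image"
  then obtain R where R: "totally_real_plane R" "leaves_invariant surf_image R" by (auto simp: R_Fuchsian_def)
  then obtain W where W: "totally_real_subspace W" and RW: "R = {span {w} | w. w \<in> W \<and> Re (form w w) < 0}"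
    by (auto simp: totally_real_plane_def)
  have subW: "module.subspace real_scale W" and real: "\<And>x y. x \<in> W \<Longrightarrow> y \<in> W \<Longrightarrow> form x y \<in> \<real>"
    using W by (auto simp: totally_real_subspace_def)
  have Wadd: "x + y \<in> W" if "x \<in> W" "y \<in> W" for x y
    using subW that by (simp add: module.subspace_def[OF real_scale_module])
  have Wscale: "of_real r *\<^sub>C x \<in> W" if "x \<in> W" for r x
    using subW that by (simp add: module.subspace_def[OF real_scale_module] real_scale_def)
  obtain p q n where pqn: "p \<in> W" "q \<in> W" "n \<in> W" and o: "form p q = 0" "form p n = 0" "form q n = 0"
    and sgn: "Re (form p p) > 0" "Re (form q q) > 0" "Re (form n n) < 0"
    using W by (auto simp: totally_real_subspace_def)
  have nz: "form p p \<noteq> 0" "form q q \<noteq> 0" "form n n \<noteq> 0" using sgn by auto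
  note expand = orthogonal_frame_basis[OF o nz]
  have line: "\<exists>c w'. w' \<in> W \<and> rep f w = c *\<^sub>C w'" if f: "f \<in> surf_group" and w: "w \<in> W" "Re (form w w) < 0" for f w
  proof -
    have "span {w} \<in> R" using w RW by blast
    moreover have "(\<lambda>p. rep f ` p) ` R = R" using R(2) f by (auto simp: leaves_invariant_def surf_image_def)
    ultimately have "rep f ` span {w} \<in> R" by blast
    then obtain w' where w': "w' \<in> W" "rep f ` span {w} = span {w'}" using RW by blast
    have "rep f w \<in> span {w'}" using w'(2) span_base[of w "{w}"] by blast
    then show ?thesis using w'(1) unfolding span_singleton_eq by blast
  qed
  \<comment> \<open>Invariance supplies a scalar for each negative vector separately. Here they are
    shown to agree up to real factors, so that a single \<open>c\<close> serves a whole real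
    frame.\<close>
  have common: "\<exists>c. c \<noteq> 0 \<and> (\<forall>y\<in>{p, q, n}. \<exists>y'\<in>W. rep f y = c *\<^sub>C y')" if f: "f \<in> surf_group" for f
  proof -
    note F = surf_group_su11[OF f]
    obtain c n' where n': "n' \<in> W" "rep f n = c *\<^sub>C n'" using line[OF f pqn(3) sgn(3)] by blast
    have c: "c \<noteq> 0" using nz(3) rep_form[OF F, of n n] by (auto simp: n'(2))
    have "\<exists>y'\<in>W. rep f y = c *\<^sub>C y'" if y: "y \<in> W" "form y n = 0" "Re (form y y) > 0" for y
    proof -
      define d g where "d = Re (form n n)" and "g = Re (form y y)"
      have dg: "form n n = of_real d" "form y y = of_real g" "d < 0" "g > 0"
        using form_self_real sgn(3) y(3) by (auto simp: d_def g_def)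
      \<comment> \<open>Chosen so that n + e y has norm d - d/2 = d/2 < 0: it is again a negative
        vector of \<open>W\<close>, to which \<open>line\<close> applies.\<close>
      define e where "e = sqrt (- d / (2 * g))"
      have e: "e > 0" using dg by (simp add: e_def divide_neg_pos)
      have "e * e = - d / (2 * g)" using dg by (simp add: e_def divide_nonpos_pos)
      then have eg: "e * e * g = - d / 2" using dg by (simp add: field_simps)
      define m where "m = n + of_real e *\<^sub>C y"
      have mW: "m \<in> W" unfolding m_def using pqn(3) y(1) by (intro Wadd Wscale)
      have "form m m = of_real (d + e * e * g)"
        unfolding m_def by (simp add: form_add form_scale form_add_right form_scale_right dg y(2) form_eq_0_sym[OF y(2)])
      then have "Re (form m m) = d + e * e * g" by (simp only: Re_complex_of_real)
      then have "Re (form m m) < 0" using eg dg(3) by linarith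
      then obtain c1 m' where m': "m' \<in> W" "rep f m = c1 *\<^sub>C m'" using line[OF f mW] by blast
      \<comment> \<open>Both \<open>form n m\<close> and \<open>form n' m'\<close> are real, so
        \<open>c * cnj c1\<close> is real and \<open>c1\<close> is a real multiple of
        \<open>c\<close>.\<close>
      obtain s where s: "form n' m' = of_real s" using real[OF n'(1) m'(1)] by (auto elim: Reals_cases)
      have "form n m = of_real d" unfolding m_def by (simp add: form_add_right form_scale_right dg form_eq_0_sym[OF y(2)])
      then have "c * cnj c1 * of_real s = of_real d"
        using rep_form[OF F, of n m] by (simp add: n'(2) m'(2) form_scale form_scale_right s mult_ac)
      moreover from this have "s \<noteq> 0" using dg(3) by auto
      ultimately have "c * cnj c1 = of_real (d / s)" by (simp add: field_simps)
      then have "cnj (c * cnj c1) = of_real (d / s)" by simp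
      then have "c * (cnj c * c1) = c * of_real (d / s)" by simp
      then have h: "of_real ((cmod c)\<^sup>2) * c1 = c * of_real (d / s)" unfolding complex_norm_square by (simp add: mult.assoc)
      define l where "l = (cmod c)\<^sup>2"
      have "l \<noteq> 0" using c by (simp add: l_def)
      then have "c1 = of_real (1 / l) * (of_real l * c1)" by simp
      also have "\<dots> = of_real (1 / l * (d / s)) * c" unfolding h[folded l_def] by simp
      finally have c1: "c1 = of_real (1 / l * (d / s)) * c" .
      define \<rho> where "\<rho> = 1 / l * (d / s)"
      have "rep f m = rep f n + of_real e *\<^sub>C rep f y" unfolding m_def by (simp add: rep_add rep_scale)
      then have "of_real e *\<^sub>C rep f y = rep f m - rep f n" by simp
      also have "\<dots> = c *\<^sub>C (of_real \<rho> *\<^sub>C m' + of_real (- 1) *\<^sub>C n')"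
        unfolding m'(2) n'(2) c1 \<rho>_def[symmetric] by (simp add: scale_right_distrib scale_right_diff_distrib mult.commute)
      finally have ey: "of_real e *\<^sub>C rep f y = c *\<^sub>C (of_real \<rho> *\<^sub>C m' + of_real (- 1) *\<^sub>C n')" .
      have "rep f y = of_real (1 / e) *\<^sub>C (of_real e *\<^sub>C rep f y)" using e by simp
      also have "\<dots> = c *\<^sub>C (of_real (1 / e) *\<^sub>C (of_real \<rho> *\<^sub>C m' + of_real (- 1) *\<^sub>C n'))"
        unfolding ey by (simp add: mult.commute)
      finally show ?thesis using m'(1) n'(1) Wadd Wscale by blast
    qed
    then have "\<exists>y'\<in>W. rep f p = c *\<^sub>C y'" "\<exists>y'\<in>W. rep f q = c *\<^sub>C y'" using pqn o sgn by auto
    then show ?thesis using c n' by blast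
  qed
  \<comment> \<open>Complex conjugation of \<open>V\<close> with respect to the real form
    \<open>W\<close>.\<close>
  define \<sigma> where "\<sigma> x = (cnj (form x p) / form p p) *\<^sub>C p + (cnj (form x q) / form q q) *\<^sub>C q + (cnj (form x n) / form n n) *\<^sub>C n" for x
  have \<sigma>_add: "\<sigma> (x + y) = \<sigma> x + \<sigma> y" for x y
    by (simp add: \<sigma>_def form_add add_divide_distrib scale_left_distrib algebra_simps)
  have \<sigma>_scale: "\<sigma> (a *\<^sub>C x) = cnj a *\<^sub>C \<sigma> x" for a x
    by (simp add: \<sigma>_def form_scale scale_right_distrib)
  have \<sigma>_W: "\<sigma> y = y" if "y \<in> W" for y
  proof -
    have "cnj (form y z) = form y z" if "z \<in> W" for z
      using real[OF \<open>y \<in> W\<close> that] by (simp add: Reals_cnj_iff)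
    then show ?thesis using expand[of y] pqn by (simp add: \<sigma>_def)
  qed
  have \<sigma>_form: "form (\<sigma> x) (\<sigma> y) = cnj (form x y)" for x y
  proof -
    have r: "cnj (form z z) = form z z" for z using form_cnj[of z z] by simp
    have "form x y = form x p * cnj (form y p) / form p p + form x q * cnj (form y q) / form q q + form x n * cnj (form y n) / form n n"
      by (subst expand[of y]) (simp add: form_add_right form_scale_right r mult.commute)
    moreover have "form (\<sigma> x) (\<sigma> y) = cnj (form x p) * form y p / form p p + cnj (form x q) * form y q / form q q + cnj (form x n) * form y n / form n n"
      using nz unfolding \<sigma>_def
      by (simp add: form_add form_scale form_add_right form_scale_right o o[THEN form_eq_0_sym] r mult.commute)
    ultimately show ?thesis by (simp add: r)
  qed
  \<comment> \<open>The scalar appears conjugated on one side because \<sigma> is antilinear: on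
    \<open>W\<close> the map is \<open>c\<close> times a real one.\<close>
  have comm: "\<exists>c. c \<noteq> 0 \<and> (\<forall>x. cnj c *\<^sub>C rep f (\<sigma> x) = c *\<^sub>C \<sigma> (rep f x))" if f: "f \<in> surf_group" for f
  proof -
    obtain c where c: "c \<noteq> 0" "\<forall>y\<in>{p, q, n}. \<exists>y'\<in>W. rep f y = c *\<^sub>C y'" using common[OF f] by blast
    obtain p' q' n' where W': "p' \<in> W" "q' \<in> W" "n' \<in> W" and r: "rep f p = c *\<^sub>C p'" "rep f q = c *\<^sub>C q'" "rep f n = c *\<^sub>C n'"
      using c(2) by auto
    have rr: "cnj (form z z) = form z z" for z using form_cnj[of z z] by simp
    have "cnj c *\<^sub>C rep f (\<sigma> x) = c *\<^sub>C \<sigma> (rep f x)" for x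
    proof -
      have 1: "rep f (\<sigma> x) = (cnj (form x p) / form p p * c) *\<^sub>C p' + (cnj (form x q) / form q q * c) *\<^sub>C q' + (cnj (form x n) / form n n * c) *\<^sub>C n'"
        by (simp add: \<sigma>_def rep_add rep_scale r)
      have "rep f x = (form x p / form p p * c) *\<^sub>C p' + (form x q / form q q * c) *\<^sub>C q' + (form x n / form n n * c) *\<^sub>C n'"
        by (subst expand[of x]) (simp add: rep_add rep_scale r)
      then have 2: "\<sigma> (rep f x) = cnj (form x p / form p p * c) *\<^sub>C p' + cnj (form x q / form q q * c) *\<^sub>C q' + cnj (form x n / form n n * c) *\<^sub>C n'"
        by (simp only: \<sigma>_add \<sigma>_scale \<sigma>_W W')
      show ?thesis unfolding 1 2 by (simp add: scale_right_distrib rr mult_ac)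
    qed
    then show ?thesis using c(1) by blast
  qed
  obtain \<kappa> where \<kappa>: "\<sigma> b0 = \<kappa> *\<^sub>C b0" "\<kappa> \<noteq> 0"
  proof -
    have nz0: "\<sigma> b0 \<noteq> 0" using \<sigma>_form[of b0 b0] by (auto simp: form_b)
    obtain c where c: "c \<noteq> 0" "cnj c *\<^sub>C rep (gen 0) (\<sigma> b0) = c *\<^sub>C \<sigma> b0"
      using comm[OF gen_in_surf_group, of 0] rep_b0 by metis
    have "rep (gen 0) (\<sigma> b0) = (1 / cnj c) *\<^sub>C (cnj c *\<^sub>C rep (gen 0) (\<sigma> b0))" using c(1) by simp
    then have eig: "rep (gen 0) (\<sigma> b0) = (c / cnj c) *\<^sub>C \<sigma> b0" unfolding c(2) by simp
    \<comment> \<open>The eigenvalue c / cnj c of \<sigma> b0 has modulus 1, unlike the eigenvalues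
      of \<open>gen 0\<close> on the complement of \<open>b0\<close>.\<close>
    have "\<exists>a. \<sigma> b0 = a *\<^sub>C b0"
    proof (rule ccontr)
      assume "\<nexists>a. \<sigma> b0 = a *\<^sub>C b0"
      then obtain m :: real where m: "m * m \<noteq> 1" "rep (gen 0) (\<sigma> b0) = of_real m *\<^sub>C \<sigma> b0"
        using loxodromic_eigenvector[OF gen_su11 gen_loxodromic nz0, of 0 1 "c / cnj c"] eig by auto
      then have "(c / cnj c - of_real m) *\<^sub>C \<sigma> b0 = 0" using eig by (simp add: scale_left_diff_distrib)
      then have "of_real m = c / cnj c" using nz0 by simp
      then have "cmod (of_real m) = 1" using c(1) by (simp add: norm_divide)
      then have "\<bar>m\<bar> = 1" by simp
      then show False using m(1) by (metis abs_mult_self_eq mult_1)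
    qed
    then show ?thesis using that nz0 by fastforce
  qed
  have commutes: "rep f (\<sigma> x) = \<sigma> (rep f x)" if f: "f \<in> surf_group" for f x
  proof -
    obtain c where c: "c \<noteq> 0" "\<forall>x. cnj c *\<^sub>C rep f (\<sigma> x) = c *\<^sub>C \<sigma> (rep f x)" using comm[OF f] by blast
    have "cnj c *\<^sub>C rep f (\<sigma> b0) = c *\<^sub>C \<sigma> b0" using c(2) rep_b0 by metis
    \<comment> \<open>Evaluation at the common fixed vector \<open>b0\<close> forces
      \<open>c\<close> to be real, so it cancels.\<close>
    then have "(cnj c * \<kappa> - c * \<kappa>) *\<^sub>C b0 = 0" by (simp add: \<kappa> rep_scale rep_b0 scale_left_diff_distrib)
    moreover have "b0 \<noteq> 0" using form_b(1) by auto
    ultimately have "cnj c = c" using \<kappa>(2) by simp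
    then show ?thesis using c by simp
  qed
  obtain x0 x1 x2 where x: "\<sigma> b1 = vec x0 x1 x2" using vec_cases by blast
  obtain y0 y1 y2 where y: "\<sigma> b2 = vec y0 y1 y2" using vec_cases by blast
  have "form (\<sigma> b1) (\<sigma> b0) = 0" using \<sigma>_form[of b1 b0] form_eq_0_sym[OF form_b(4)] by simp
  then have x0: "x0 = 0" using \<kappa> by (simp add: x form_scale_right form_vec_b)
  define a where "a = complex_of_real cosh_r * cis (- (pi / 3))"
  define s where "s = complex_of_real sinh_r"
  \<comment> \<open>Comparison of the coordinates along \<open>b1\<close> when \<sigma> is exchanged
    with \<open>gen 0\<close> and \<open>gen 1\<close>. These differ only in the phase
    \<open>om j\<close>: subtraction gives x2 = y1, and then x1 = 0 because \<open>a\<close> is not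
    real.\<close>
  have eq: "a * x1 + s * om j * x2 = cnj a * x1 + s * om j * y1" if kj: "k = 0 \<and> j = 4 \<or> k = 1 \<and> j = 5" for k j :: int
  proof -
    have sg: "sg k = 1" and j: "j = k + 4" using kj by (auto simp: sg_def)
    have g: "fst (gen k) = a" "snd (gen k) = s * om j" by (simp_all add: gen_def sg j a_def s_def)
    have "rep (gen k) b1 = a *\<^sub>C b1 + cnj (s * om j) *\<^sub>C b2"
      using rep_vec[of "gen k" 0 1 0] unfolding vec_b g by (simp add: vec_def)
    then have "\<sigma> (rep (gen k) b1) = cnj a *\<^sub>C \<sigma> b1 + (s * om j) *\<^sub>C \<sigma> b2" by (simp add: \<sigma>_add \<sigma>_scale)
    then have "rep (gen k) (vec x0 x1 x2) = cnj a *\<^sub>C vec x0 x1 x2 + (s * om j) *\<^sub>C vec y0 y1 y2"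
      using commutes[OF gen_in_surf_group, of k b1] unfolding x y by simp
    then show ?thesis unfolding rep_vec vec_scale vec_add vec_eq g by simp
  qed
  have e4: "a * x1 + s * om 4 * x2 = cnj a * x1 + s * om 4 * y1" using eq[of 0 4] by simp
  have e5: "a * x1 + s * om 5 * x2 = cnj a * x1 + s * om 5 * y1" using eq[of 1 5] by simp
  have "s * (om 4 - om 5) * (x2 - y1) = 0" using e4 e5 by algebra
  then have "x2 = y1" using om_4_5 sinh_r_pos by (simp add: s_def)
  then have "(a - cnj a) * x1 = 0" using e4 by (simp add: algebra_simps)
  moreover have "Im (a - cnj a) \<noteq> 0" using cosh_r_pos by (simp add: a_def sin_60)
  then have "a - cnj a \<noteq> 0" by (metis zero_complex.sel(2))
  ultimately have "x1 = 0" by simp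
  \<comment> \<open>Now \<sigma> b1 is a multiple of \<open>b2\<close> and cannot be positive,
    although \<sigma> preserves the real number \<open>form b1 b1 = 1\<close>.\<close>
  then have "form (\<sigma> b1) (\<sigma> b1) = - (x2 * cnj x2)" by (simp add: x x0 form_vec)
  also have "\<dots> = of_real (- ((cmod x2)\<^sup>2))" by (simp add: complex_norm_square del: of_real_power)
  finally have "complex_of_real (- ((cmod x2)\<^sup>2)) = of_real 1" using \<sigma>_form[of b1 b1] by (simp add: form_b)
  then have "- ((cmod x2)\<^sup>2) = 1" unfolding of_real_eq_iff .
  then show False using zero_le_power2[of "cmod x2"] by linarith
qed

lemma surface_group_counterexample:
  "(\<exists>G. discrete_subgroup G \<and>
      (\<exists>x \<in> topspace genus3. SU\<lparr>carrier := G\<rparr> \<cong> fundamental_group genus3 x) \<and>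
      C_Fuchsian G \<and> \<not> R_Fuchsian G \<and>
      (\<exists>L. complex_geodesic L \<and> leaves_invariant G L \<and>
         (\<forall>I\<in>G. \<exists>(e :: 3 \<Rightarrow> 'v) (r :: real) (\<alpha> :: complex).
            is_basis e \<and> r > 0 \<and> (\<alpha> = 1 \<or> \<alpha> = - 1) \<and>
            matrix_of e I = diag3 1 (inverse (of_real r) * \<alpha>) (of_real r * \<alpha>) \<and>
            span {e 1} \<in> L \<inter> isotropic_points \<and> span {e 2} \<in> L \<inter> isotropic_points \<and>
            span {e 0} = polar_point L)) \<and>
      (\<forall>I\<in>G. loxodromic I \<longrightarrow> hyperbolic I \<or> elliptic_part_of_order_2 I)) \<and>
   \<not> (\<forall>G. non_elementary_Kleinian G \<longrightarrow>
        (R_Fuchsian G \<longleftrightarrow> (\<forall>I\<in>G. loxodromic I \<longrightarrow> hyperbolic I \<or> elliptic_part_of_order_2 I)))"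
  (is "?ex \<and> \<not> ?all")
proof (rule conjI)
  have "C_Fuchsian surf_image"
    unfolding C_Fuchsian_def using discrete_subgroup_surf_image complex_geodesic_geod leaves_invariant_geod by blast
  then show "?ex"
    using discrete_subgroup_surf_image basepoint_topspace surf_image_iso not_R_Fuchsian_surf_image
      complex_geodesic_geod leaves_invariant_geod surf_image_normal_form surf_image_loxodromic
    by (intro exI[of _ surf_image] conjI bexI[of _ basepoint] exI[of _ geod] ballI impI) blast+
  have "non_elementary_Kleinian surf_image"
    unfolding non_elementary_Kleinian_def using discrete_subgroup_surf_image non_elementary_surf_image by blast
  then show "\<not> ?all"
    using not_R_Fuchsian_surf_image surf_image_loxodromic by blast
qed

end

text \<open>The orthogonal basis of \<open>form_signature\<close> is rescaled by 1 / sqrt |d|, which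
  turns its norms into their signs.\<close>

lemma (in hermitian_space) framed_space_exists: "\<exists>b0 b1 b2. framed_space scale form b0 b1 b2"
proof -
  obtain e :: "3 \<Rightarrow> 'v" where e: "is_basis e" and o: "\<And>i j. i \<noteq> j \<Longrightarrow> form (e i) (e j) = 0"
    and sgn: "Re (form (e 0) (e 0)) > 0" "Re (form (e 1) (e 1)) > 0" "Re (form (e 2) (e 2)) < 0"
    using form_signature by blast
  define d where "d i = Re (form (e i) (e i))" for i
  have d: "form (e i) (e i) = of_real (d i)" for i using form_self_real by (simp add: d_def)
  define t where "t i = 1 / sqrt \<bar>d i\<bar>" for i
  define b where "b i = of_real (t i) *\<^sub>C e i" for i
  have d0: "d i \<noteq> 0" for i using type3_cases[of i] sgn by (auto simp: d_def)
  have tt: "t i * t i = 1 / \<bar>d i\<bar>" for i using d0[of i] by (simp add: t_def)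
  have bb: "form (b i) (b j) = 0" if "i \<noteq> j" for i j
    using o[OF that] by (simp add: b_def form_scale form_scale_right)
  have bs: "form (b i) (b i) = of_real (sgn (d i))" for i
  proof -
    have "form (b i) (b i) = of_real (t i * t i * d i)" by (simp add: b_def form_scale form_scale_right d)
    then show ?thesis using d0[of i] unfolding tt by (simp add: sgn_real_def)
  qed
  have ex: "v = form v (b 0) *\<^sub>C b 0 + form v (b 1) *\<^sub>C b 1 + (- form v (b 2)) *\<^sub>C b 2" for v
  proof -
    define c where "c i = representation (range e) v (e i)" for i
    have v: "v = c 0 *\<^sub>C e 0 + c 1 *\<^sub>C e 1 + c 2 *\<^sub>C e 2"
      using basis_expansion[OF e, of v] unfolding UNIV_type3 c_def by (simp add: add.assoc)
    have "form v (e i) = c i * of_real (d i)" for i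
      using type3_cases[of i] by (subst v) (auto simp: form_add form_scale d o)
    then have X: "form v (b i) *\<^sub>C b i = (c i * of_real (t i * t i * d i)) *\<^sub>C e i" for i
      by (simp add: b_def form_scale_right mult_ac)
    have T: "t 0 * t 0 * d 0 = 1" "t 1 * t 1 * d 1 = 1" "t 2 * t 2 * d 2 = -1"
      using sgn unfolding tt d_def[symmetric] by simp_all
    have "form v (b 0) *\<^sub>C b 0 = c 0 *\<^sub>C e 0" "form v (b 1) *\<^sub>C b 1 = c 1 *\<^sub>C e 1"
      "form v (b 2) *\<^sub>C b 2 = - (c 2 *\<^sub>C e 2)"
      using X[of 0] X[of 1] X[of 2] unfolding T by simp_all
    then show ?thesis using v by simp
  qed
  have "framed_space scale form (b 0) (b 1) (b 2)"
    using sgn bb ex by unfold_locales (simp_all add: bs d_def[symmetric])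
  then show ?thesis by blast
qed

theorem mainTheorem2:
  fixes scale :: "complex \<Rightarrow> 'v::ab_group_add \<Rightarrow> 'v"
    and form :: "'v \<Rightarrow> 'v \<Rightarrow> complex"
  assumes "hermitian_space scale form"
  shows
    "(\<exists>G. hermitian_space.discrete_subgroup scale form G \<and>
        (\<exists>x \<in> topspace (closed_orientable_surface 3).
           (hermitian_space.SU scale form)\<lparr>carrier := G\<rparr> \<cong>
             fundamental_group (closed_orientable_surface 3) x) \<and>
        hermitian_space.C_Fuchsian scale form G \<and>
        \<not> hermitian_space.R_Fuchsian scale form G \<and>
        (\<exists>L. hermitian_space.complex_geodesic scale form L \<and>
           hermitian_space.leaves_invariant G L \<and>
           (\<forall>I\<in>G. \<exists>(e :: 3 \<Rightarrow> 'v) (r :: real) (\<alpha> :: complex).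
              vector_space.is_basis scale e \<and> r > 0 \<and> (\<alpha> = 1 \<or> \<alpha> = - 1) \<and>
              vector_space.matrix_of scale e I = diag3 1 (inverse (of_real r) * \<alpha>) (of_real r * \<alpha>) \<and>
              module.span scale {e 1} \<in> L \<inter> hermitian_space.isotropic_points scale form \<and>
              module.span scale {e 2} \<in> L \<inter> hermitian_space.isotropic_points scale form \<and>
              module.span scale {e 0} = hermitian_space.polar_point form L)) \<and>
        (\<forall>I\<in>G. hermitian_space.loxodromic scale form I \<longrightarrow>
           hermitian_space.hyperbolic scale form I \<or>
           hermitian_space.elliptic_part_of_order_2 scale form I)) \<and>
     \<not> (\<forall>G. hermitian_space.non_elementary_Kleinian scale form G \<longrightarrow>
          (hermitian_space.R_Fuchsian scale form G \<longleftrightarrow>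
             (\<forall>I\<in>G. hermitian_space.loxodromic scale form I \<longrightarrow>
                hermitian_space.hyperbolic scale form I \<or>
                hermitian_space.elliptic_part_of_order_2 scale form I)))"
proof -
  obtain b0 b1 b2 where "framed_space scale form b0 b1 b2"
    using hermitian_space.framed_space_exists[OF assms] by blast
  then show ?thesis by (rule framed_space.surface_group_counterexample)
qed

end
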